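(* There is a constant $C>0$ such that for any $f\in W^{-1}_{2,unif}(\mathbb{R})$ there exist functions $\sigma\in L_{2,unif}(\mathbb{R})$ and $\tau\in L_{1,unif}(\mathbb{R})$ such that $f=\sigma'+\tau$ (derivative in the sense of distributions) and $$C^{-1}\bigl(\|\sigma\|_{2,unif}+\|\tau\|_{1,unif}\bigr)\le \|f\|_{W^{-1}_{2,unif}(\mathbb{R})}\le C\bigl(\|\sigma\|_{2,unif}+\|\tau\|_{1,unif}\bigr),$$ the constant $C$ being independent of $f$. Moreover, the function $\tau$ can be chosen uniformly bounded.
   Context: $W^1_2(\mathbb{R})$ is the standard Sobolev space, and $W^{-1}_2(\mathbb{R})$ is its dual: the space of distributions $f$ that define continuous functionals on $W^1_2(\mathbb{R})$, with norm $\|f\|_{W^{-1}_2(\mathbb{R})}:=\sup_{0\ne\psi\in W^1_2(\mathbb{R})}|\langle \psi,f\rangle|/\|\psi\|_{W^1_2(\mathbb{R})}$, where $\langle\cdot,\cdot\rangle$ is the duality pairing. $W^{-1}_{2,loc}(\mathbb{R})$ is the space of distributions $f$ on $\mathbb{R}$ with $f\psi\in W^{-1}_2(\mathbb{R})$ for every test function $\psi\in C_0^\infty(\mathbb{R})$; such an $f$ extends naturally to compactly supported functions in $W^1_2(\mathbb{R})$. Let $\phi(t)=2(t+1)^2$ for $t\in[-1,-1/2)$, $\phi(t)=1-2t^2$ for $t\in[-1/2,1/2)$, $\phi(t)=2(t-1)^2$ for $t\in[1/2,1]$, and $\phi(t)=0$ otherwise; put $\phi_n(t):=\phi(t-n)$,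 $n\in\mathbb{Z}$. The product $f\phi_n$ is defined by $\langle f\phi_n,\psi\rangle=\langle f,\phi_n\psi\rangle$. A distribution $f\in W^{-1}_{2,loc}(\mathbb{R})$ belongs to $W^{-1}_{2,unif}(\mathbb{R})$ if $f\phi_n\in W^{-1}_2(\mathbb{R})$ for all $n\in\mathbb{Z}$ and $\|f\|_{W^{-1}_{2,unif}(\mathbb{R})}:=\sup_{n\in\mathbb{Z}}\|f\phi_n\|_{W^{-1}_2(\mathbb{R})}<\infty$. $L_{2,unif}(\mathbb{R})$ and $L_{1,unif}(\mathbb{R})$ are the spaces of measurable functions with finite norms $\|\sigma\|_{2,unif}:=\bigl(\sup_{t\in\mathbb{R}}\int_t^{t+1}|\sigma(s)|^2\,ds\bigr)^{1/2}$ and $\|\tau\|_{1,unif}:=\sup_{t\in\mathbb{R}}\int_t^{t+1}|\tau(s)|\,ds$, respectively. *)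

theory Defs
  imports "HOL-Analysis.Analysis"
begin

section \<open>Test functions and distributions on the real line\<close>

definition vderiv :: "(real \<Rightarrow> complex) \<Rightarrow> real \<Rightarrow> complex" where
  "vderiv \<psi> = (\<lambda>t. vector_derivative \<psi> (at t))"

definition supp :: "(real \<Rightarrow> complex) \<Rightarrow> real set" where
  "supp \<psi> = closure {t. \<psi> t \<noteq> 0}"

definition test_fun :: "(real \<Rightarrow> complex) \<Rightarrow> bool" where
  "test_fun \<psi> \<longleftrightarrow> (\<forall>k t. (vderiv ^^ k) \<psi> differentiable (at t)) \<and> compact (supp \<psi>)"

text \<open>
  A distribution is a functional whose values matter only on test functions; accordingly, equality
  of distributions is equality there. The pairing is bilinear (no conjugation). Continuity is
  stated by the usual seminorm estimates on each compact set.
\<close>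

definition distribution :: "((real \<Rightarrow> complex) \<Rightarrow> complex) \<Rightarrow> bool" where
  "distribution f \<longleftrightarrow>
     (\<forall>\<psi> \<eta>. test_fun \<psi> \<longrightarrow> test_fun \<eta> \<longrightarrow> f (\<lambda>t. \<psi> t + \<eta> t) = f \<psi> + f \<eta>) \<and>
     (\<forall>c \<psi>. test_fun \<psi> \<longrightarrow> f (\<lambda>t. c * \<psi> t) = c * f \<psi>) \<and>
     (\<forall>K. compact K \<longrightarrow> (\<exists>B N. \<forall>\<psi>. test_fun \<psi> \<longrightarrow> supp \<psi> \<subseteq> K \<longrightarrow>
        norm (f \<psi>) \<le> B * (\<Sum>k\<le>N. SUP t. norm ((vderiv ^^ k) \<psi> t))))"

definition dist_eq ::
  "((real \<Rightarrow> complex) \<Rightarrow> complex) \<Rightarrow> ((real \<Rightarrow> complex) \<Rightarrow> complex) \<Rightarrow> bool" where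
  "dist_eq f g \<longleftrightarrow> (\<forall>\<psi>. test_fun \<psi> \<longrightarrow> f \<psi> = g \<psi>)"

definition dist_of_fun :: "(real \<Rightarrow> complex) \<Rightarrow> (real \<Rightarrow> complex) \<Rightarrow> complex" where
  "dist_of_fun u = (\<lambda>\<psi>. LINT t|lebesgue. u t * \<psi> t)"

definition dist_add ::
  "((real \<Rightarrow> complex) \<Rightarrow> complex) \<Rightarrow> ((real \<Rightarrow> complex) \<Rightarrow> complex) \<Rightarrow> (real \<Rightarrow> complex) \<Rightarrow> complex" where
  "dist_add f g = (\<lambda>\<psi>. f \<psi> + g \<psi>)"

definition dist_deriv :: "((real \<Rightarrow> complex) \<Rightarrow> complex) \<Rightarrow> (real \<Rightarrow> complex) \<Rightarrow> complex" where
  "dist_deriv f = (\<lambda>\<psi>. - f (vderiv \<psi>))"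

definition dist_mult ::
  "((real \<Rightarrow> complex) \<Rightarrow> complex) \<Rightarrow> (real \<Rightarrow> complex) \<Rightarrow> (real \<Rightarrow> complex) \<Rightarrow> complex" where
  "dist_mult f \<eta> = (\<lambda>\<psi>. f (\<lambda>t. \<eta> t * \<psi> t))"


section \<open>The Sobolev space W12 and its dual Wm12\<close>

definition L2 :: "(real \<Rightarrow> complex) \<Rightarrow> bool" where
  "L2 u \<longleftrightarrow> u \<in> borel_measurable lebesgue \<and> integrable lebesgue (\<lambda>t. (norm (u t))\<^sup>2)"

definition weak_deriv :: "(real \<Rightarrow> complex) \<Rightarrow> (real \<Rightarrow> complex) \<Rightarrow> bool" where
  "weak_deriv u v \<longleftrightarrow> L2 v \<and> dist_eq (dist_deriv (dist_of_fun u)) (dist_of_fun v)"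

text \<open>
  Elements of the Sobolev space are represented by functions; functions that agree almost
  everywhere represent the same element. The weak derivative in the norm is unique up to null sets.
\<close>

definition W12 :: "(real \<Rightarrow> complex) \<Rightarrow> bool" where
  "W12 u \<longleftrightarrow> L2 u \<and> (\<exists>v. weak_deriv u v)"

definition norm_W12 :: "(real \<Rightarrow> complex) \<Rightarrow> real" where
  "norm_W12 u = sqrt ((LINT t|lebesgue. (norm (u t))\<^sup>2) +
                      (LINT t|lebesgue. (norm ((SOME v. weak_deriv u v) t))\<^sup>2))"

text \<open>
  \<open>W12_extension f F\<close>: \<open>F\<close> is a continuous linear functional on the Sobolev space that agrees with
  \<open>f\<close> on test functions. By density of the test functions, \<open>f\<close> determines the values of \<open>F\<close> on
  \<open>W12\<close>, so that \<open>W12_pairing\<close> below is well defined there. The estimate forces \<open>F\<close> to respect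
  almost-everywhere equality.
\<close>

definition W12_extension ::
  "((real \<Rightarrow> complex) \<Rightarrow> complex) \<Rightarrow> ((real \<Rightarrow> complex) \<Rightarrow> complex) \<Rightarrow> bool" where
  "W12_extension f F \<longleftrightarrow>
     dist_eq F f \<and>
     (\<forall>u v. W12 u \<longrightarrow> W12 v \<longrightarrow> F (\<lambda>t. u t + v t) = F u + F v) \<and>
     (\<forall>c u. W12 u \<longrightarrow> F (\<lambda>t. c * u t) = c * F u) \<and>
     (\<exists>B. \<forall>u. W12 u \<longrightarrow> norm (F u) \<le> B * norm_W12 u)"

definition Wm12 :: "((real \<Rightarrow> complex) \<Rightarrow> complex) \<Rightarrow> bool" where
  "Wm12 f \<longleftrightarrow> distribution f \<and> (\<exists>F. W12_extension f F)"

definition W12_pairing :: "((real \<Rightarrow> complex) \<Rightarrow> complex) \<Rightarrow> (real \<Rightarrow> complex) \<Rightarrow> complex" where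
  "W12_pairing f = (SOME F. W12_extension f F)"

definition norm_Wm12 :: "((real \<Rightarrow> complex) \<Rightarrow> complex) \<Rightarrow> real" where
  "norm_Wm12 f = (SUP u \<in> {u. W12 u \<and> \<not> (AE t in lebesgue. u t = 0)}.
                    norm (W12_pairing f u) / norm_W12 u)"


section \<open>Local and uniform versions\<close>

definition Wm12_loc :: "((real \<Rightarrow> complex) \<Rightarrow> complex) \<Rightarrow> bool" where
  "Wm12_loc f \<longleftrightarrow> distribution f \<and> (\<forall>\<eta>. test_fun \<eta> \<longrightarrow> Wm12 (dist_mult f \<eta>))"

text \<open>
  Extension of \<open>f\<close> in \<open>Wm12_loc\<close> to compactly supported \<open>u\<close> in \<open>W12\<close>: pair \<open>u\<close> with \<open>\<eta> f\<close>, where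
  the test function \<open>\<eta>\<close> is 1 near the support of \<open>u\<close>. The result does not depend on \<open>\<eta>\<close>.
\<close>

definition cutoff :: "(real \<Rightarrow> complex) \<Rightarrow> (real \<Rightarrow> complex) \<Rightarrow> bool" where
  "cutoff u \<eta> \<longleftrightarrow> test_fun \<eta> \<and> (\<exists>U. open U \<and> supp u \<subseteq> U \<and> (\<forall>t\<in>U. \<eta> t = 1))"

definition loc_pairing :: "((real \<Rightarrow> complex) \<Rightarrow> complex) \<Rightarrow> (real \<Rightarrow> complex) \<Rightarrow> complex" where
  "loc_pairing f u = W12_pairing (dist_mult f (SOME \<eta>. cutoff u \<eta>)) u"

definition phi :: "real \<Rightarrow> real" where
  "phi t = (if -1 \<le> t \<and> t < -1/2 then 2 * (t + 1)\<^sup>2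
            else if -1/2 \<le> t \<and> t < 1/2 then 1 - 2 * t\<^sup>2
            else if 1/2 \<le> t \<and> t \<le> 1 then 2 * (t - 1)\<^sup>2
            else 0)"

definition phi_n :: "int \<Rightarrow> real \<Rightarrow> complex" where
  "phi_n n t = complex_of_real (phi (t - of_int n))"

text \<open>
  The functions \<open>phi_n n\<close> are not smooth, so the product with them needs \<open>loc_pairing\<close> in place
  of \<open>dist_mult\<close>.
\<close>

definition mult_phi :: "((real \<Rightarrow> complex) \<Rightarrow> complex) \<Rightarrow> int \<Rightarrow> (real \<Rightarrow> complex) \<Rightarrow> complex" where
  "mult_phi f n = (\<lambda>\<psi>. loc_pairing f (\<lambda>t. phi_n n t * \<psi> t))"

definition Wm12_unif :: "((real \<Rightarrow> complex) \<Rightarrow> complex) \<Rightarrow> bool" where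
  "Wm12_unif f \<longleftrightarrow> Wm12_loc f \<and> (\<forall>n. Wm12 (mult_phi f n)) \<and>
     bdd_above (range (\<lambda>n. norm_Wm12 (mult_phi f n)))"

definition norm_Wm12_unif :: "((real \<Rightarrow> complex) \<Rightarrow> complex) \<Rightarrow> real" where
  "norm_Wm12_unif f = (SUP n. norm_Wm12 (mult_phi f n))"

definition L2_unif :: "(real \<Rightarrow> complex) \<Rightarrow> bool" where
  "L2_unif \<sigma> \<longleftrightarrow> \<sigma> \<in> borel_measurable lebesgue \<and>
     (\<forall>t. set_integrable lebesgue {t..t+1} (\<lambda>s. (norm (\<sigma> s))\<^sup>2)) \<and>
     bdd_above (range (\<lambda>t. LINT s:{t..t+1}|lebesgue. (norm (\<sigma> s))\<^sup>2))"

definition norm_L2_unif :: "(real \<Rightarrow> complex) \<Rightarrow> real" where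
  "norm_L2_unif \<sigma> = sqrt (SUP t. LINT s:{t..t+1}|lebesgue. (norm (\<sigma> s))\<^sup>2)"

definition L1_unif :: "(real \<Rightarrow> complex) \<Rightarrow> bool" where
  "L1_unif \<tau> \<longleftrightarrow> \<tau> \<in> borel_measurable lebesgue \<and>
     (\<forall>t. set_integrable lebesgue {t..t+1} (\<lambda>s. norm (\<tau> s))) \<and>
     bdd_above (range (\<lambda>t. LINT s:{t..t+1}|lebesgue. norm (\<tau> s)))"

definition norm_L1_unif :: "(real \<Rightarrow> complex) \<Rightarrow> real" where
  "norm_L1_unif \<tau> = (SUP t. LINT s:{t..t+1}|lebesgue. norm (\<tau> s))"

end

theory Submission
  imports Defs
begin

text \<open>
  Each localized functional \<open>mult_phi f n\<close> lives near \<open>n\<close>. Integrating \<open>h\<close> in \<open>L2\<close> from \<open>n\<close> and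
  cutting off gives an element of the Sobolev space whose norm is controlled by that of \<open>h\<close>, so by
  the Riesz theorem on \<open>L2\<close> the functional acts on such elements as integration against a square
  integrable \<open>g\<close>. A test function is, near \<open>n\<close>, the sum of the primitive of its derivative and of
  its value at \<open>n\<close>; that value is an average over \<open>[n, n + 1]\<close> up to another integral of the
  derivative. This represents the localized functional as \<open>s' + a\<close> with \<open>s\<close> in \<open>L2\<close> supported near
  \<open>n\<close> and \<open>a\<close> constant on \<open>[n, n + 1)\<close>, and the pieces add up because the \<open>phi_n\<close> are a partition
  of unity. The upper estimate, and the independence of \<open>loc_pairing\<close> from the cutoff, rest on the
  fact that a continuous functional on the Sobolev space is determined by its values on test
  functions; this follows from the same Riesz argument and the du Bois-Reymond lemma.
\<close>


section \<open>Smooth functions and cutoffs\<close>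

text \<open>The constant may not depend on \<open>f\<close>, so every construction must be uniform
  in \<open>n\<close>: the cutoffs have ramps of fixed width, and one bound \<open>K\<close> for
  their derivatives enters the estimates. Riesz's theorem is applied to the derivative
  \<open>h\<close> and not inside the Sobolev space; this needs only the completeness of
  \<open>L2\<close>, and the representing functions can be truncated to bounded support. The value
  of a test function at \<open>n\<close> must be averaged because a point mass is not an integrable
  function: averaging turns it into a bounded density plus the derivative of a square integrable
  ramp, and since the half-open unit intervals are disjoint, the densities glue to a bounded
  \<open>\<tau>\<close>. The main obstacle is that the \<open>phi_n\<close> are only once
  continuously differentiable. Neither \<open>f\<close> nor the identity
  \<open>f = \<sigma>' + \<tau>\<close> can be applied directly to
  \<open>phi_n n t * \<psi> t\<close>, so every computation with \<open>mult_phi\<close> passes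
  through a functional on the Sobolev space that is identified by its values on test
  functions.\<close>

definition Ck :: "nat \<Rightarrow> (real \<Rightarrow> complex) \<Rightarrow> bool" where
  "Ck n f \<longleftrightarrow> (\<forall>k<n. \<forall>t. (vderiv ^^ k) f differentiable (at t))"

lemma vderiv_eqI:
  assumes "\<And>t. (f has_vector_derivative g t) (at t)"
  shows "vderiv f = g"
  using assms by (auto simp: vderiv_def intro: vector_derivative_at)

lemma Ck_0 [simp]: "Ck 0 f"
  by (simp add: Ck_def)

text \<open>Together with \<open>Ck_SucD\<close> this reduces smoothness to an induction on the
  order: only one derivative has to be computed, and closure properties of \<open>Ck n\<close> do
  the rest.\<close>

lemma Ck_SucI:
  assumes "\<And>t. (f has_vector_derivative g t) (at t)" and "Ck n g"
  shows "Ck (Suc n) f"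
  unfolding Ck_def
proof (intro allI impI)
  fix k t assume k: "k < Suc n"
  show "(vderiv ^^ k) f differentiable at t"
  proof (cases k)
    case 0
    with assms(1)[of t] show ?thesis by (auto intro: differentiableI_vector)
  next
    case (Suc j)
    have "(vderiv ^^ k) f = (vderiv ^^ j) g"
      using vderiv_eqI[OF assms(1)] by (simp add: Suc funpow_swap1)
    with assms(2) Suc k show ?thesis by (simp add: Ck_def)
  qed
qed

lemma Ck_SucD:
  assumes "Ck (Suc n) f"
  shows "(f has_vector_derivative vderiv f t) (at t)" and "Ck n (vderiv f)"
proof -
  have "f differentiable at t"
    using assms unfolding Ck_def by (metis funpow_0 zero_less_Suc)
  then show "(f has_vector_derivative vderiv f t) (at t)"
    by (simp add: vderiv_def vector_derivative_works)
  show "Ck n (vderiv f)"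
    using assms unfolding Ck_def by (metis Suc_less_eq comp_apply funpow_Suc_right)
qed

lemma Ck_mono: "Ck n f \<Longrightarrow> m \<le> n \<Longrightarrow> Ck m f"
  by (simp add: Ck_def)

lemma Ck_const: "Ck n (\<lambda>t. c)"
proof (induction n arbitrary: c)
  case (Suc n)
  show ?case by (rule Ck_SucI[OF _ Suc[of 0]]) auto
qed simp

lemma Ck_add:
  assumes "Ck n f" "Ck n g"
  shows "Ck n (\<lambda>t. f t + g t)"
  using assms
proof (induction n arbitrary: f g)
  case (Suc n)
  show ?case
    by (rule Ck_SucI[OF has_vector_derivative_add[OF Ck_SucD(1)[OF Suc(2)] Ck_SucD(1)[OF Suc(3)]]])
       (intro Suc.IH Ck_SucD Suc.prems)
qed simp

text \<open>The product rule mixes the factors with their derivatives, so the induction hypothesis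
  is needed for all pairs of functions, and \<open>Ck_mono\<close> lowers the order of the
  undifferentiated factors.\<close>

lemma Ck_mult:
  assumes "Ck n f" "Ck n g"
  shows "Ck n (\<lambda>t. f t * g t)"
  using assms
proof (induction n arbitrary: f g)
  case (Suc n)
  show ?case
    by (rule Ck_SucI[OF has_vector_derivative_mult[OF Ck_SucD(1)[OF Suc(2)] Ck_SucD(1)[OF Suc(3)]]])
       (intro Ck_add Suc.IH Ck_SucD Suc.prems Ck_mono[OF Suc.prems(1)] Ck_mono[OF Suc.prems(2)] le_SucI order_refl)
qed simp

lemma Ck_inverse:
  assumes "Ck n f" "\<And>t. f t \<noteq> 0"
  shows "Ck n (\<lambda>t. inverse (f t))"
  using assms
proof (induction n)
  case (Suc n)
  \<comment> \<open>The derivative is written as a product that again contains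
    \<open>inverse (f t)\<close>, so that the induction hypothesis and \<open>Ck_mult\<close>
    suffice.\<close>
  have "((\<lambda>t. inverse (f t)) has_vector_derivative
           (-1) * (vderiv f t * (inverse (f t) * inverse (f t)))) (at t)" for t
  proof -
    have "(f has_vector_derivative vderiv f t) (at t)"
      using Ck_SucD Suc.prems by blast
    then have "((inverse \<circ> f) has_vector_derivative
        (vderiv f t * (- (inverse (f t) * inverse (f t))))) (at t)"
      by (rule field_vector_diff_chain_at)
        (use DERIV_inverse[OF Suc.prems(2)] in \<open>auto simp: power2_eq_square numeral_2_eq_2\<close>)
    then show ?thesis by (simp add: o_def)
  qed
  then show ?case
    by (rule Ck_SucI)
       (intro Ck_mult Ck_const Suc.IH Ck_SucD Suc.prems Ck_mono[OF Suc.prems(1)] le_SucI order_refl)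
qed simp

lemma has_vector_derivative_affine:
  fixes f :: "real \<Rightarrow> complex"
  assumes "(f has_vector_derivative f') (at (a * t + b))"
  shows "((\<lambda>t. f (a * t + b)) has_vector_derivative complex_of_real a * f') (at t)"
proof -
  have "((\<lambda>t. a * t + b) has_real_derivative a) (at t)"
    by (auto intro!: derivative_eq_intros)
  then have "((\<lambda>t. a * t + b) has_vector_derivative a) (at t)"
    by (simp add: has_real_derivative_iff_has_vector_derivative)
  from vector_diff_chain_at[OF this, of f f'] assms
  show ?thesis by (simp add: o_def scaleR_conv_of_real)
qed

lemma Ck_affine:
  assumes "Ck n f"
  shows "Ck n (\<lambda>t. f (a * t + b))"
  using assms
proof (induction n arbitrary: f)
  case (Suc n)
  show ?case
    by (rule Ck_SucI[OF has_vector_derivative_affine[OF Ck_SucD(1)[OF Suc(2)]]])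
       (intro Ck_mult Ck_const Suc.IH Ck_SucD Suc.prems)
qed simp

text \<open>The function \<open>exp (- 1 / t)\<close> extended by zero; the negative powers are
  included because they make the family closed under differentiation.\<close>

definition flat_exp :: "nat \<Rightarrow> real \<Rightarrow> real" where
  "flat_exp m t = (if 0 < t then exp (- 1 / t) / t ^ m else 0)"

lemma flat_exp_has_derivative:
  "(flat_exp m has_real_derivative flat_exp (m + 2) t - m * flat_exp (m + 1) t) (at t)"
proof -
  consider "t < 0" | "t = 0" | "0 < t" by linarith
  then show ?thesis
  proof cases
    case 1
    have "\<forall>\<^sub>F x in nhds t. flat_exp m x = 0"
      using order_tendstoD(2)[OF filterlim_ident[of "nhds t"] 1]
      by (auto elim!: eventually_mono simp: flat_exp_def)
    then have "(flat_exp m has_real_derivative 0) (at t) = ((\<lambda>_. 0) has_real_derivative 0) (at t)"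
      by (intro DERIV_cong_ev refl)
    then show ?thesis using 1 by (simp add: flat_exp_def)
  next
    case 2
    have "((\<lambda>x. flat_exp m x / x) \<longlongrightarrow> 0) (at_right 0)"
    proof -
      \<comment> \<open>With \<open>y = 1 / x\<close> this is the limit of
        \<open>y ^ (m + 1) / exp y\<close> at infinity.\<close>
      have "((\<lambda>x::real. exp (- 1 / x) / x ^ (m + 1)) \<longlongrightarrow> 0) (at_right 0)"
      proof -
        have "((\<lambda>x::real. inverse x ^ (m + 1) / exp (inverse x)) \<longlongrightarrow> 0) (at_right 0)"
          by (rule filterlim_compose[OF tendsto_power_div_exp_0 filterlim_inverse_at_top_right])
        moreover have "inverse x ^ (m + 1) / exp (inverse x) = exp (- 1 / x) / x ^ (m + 1)" for x :: real
          by (simp add: exp_minus divide_inverse power_inverse mult.commute)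
        ultimately show ?thesis by simp
      qed
      then show ?thesis
        by (rule Lim_transform_eventually)
           (auto simp: flat_exp_def eventually_at_right_field intro!: exI[of _ 1])
    qed
    moreover have "((\<lambda>x. flat_exp m x / x) \<longlongrightarrow> 0) (at_left 0)"
      by (rule Lim_transform_eventually[OF tendsto_const])
         (auto simp: flat_exp_def eventually_at_left_field intro!: exI[of _ "-1"])
    ultimately have "((\<lambda>x. flat_exp m x / x) \<longlongrightarrow> 0) (at 0)"
      by (simp add: filterlim_split_at)
    then show ?thesis using 2 by (simp add: has_field_derivative_iff flat_exp_def)
  next
    case 3
    have ev: "\<forall>\<^sub>F x in nhds t. flat_exp m x = exp (- 1 / x) * inverse (x ^ m)"
      using order_tendstoD(1)[OF filterlim_ident[of "nhds t"] 3]
      by (auto elim!: eventually_mono simp: flat_exp_def field_simps)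
    have "((\<lambda>x. exp (- 1 / x) * inverse (x ^ m)) has_real_derivative
           flat_exp (m + 2) t - m * flat_exp (m + 1) t) (at t)"
      using 3 by (cases m)
        (auto intro!: derivative_eq_intros simp: flat_exp_def field_simps power2_eq_square,
         metis One_nat_def mult.commute neq0_conv power_minus_mult)
    then show ?thesis using DERIV_cong_ev[OF refl ev refl] by blast
  qed
qed

lemma Ck_flat_exp: "Ck n (\<lambda>t. complex_of_real (flat_exp m t))"
proof (induction n arbitrary: m)
  case (Suc n)
  have "((\<lambda>t. complex_of_real (flat_exp m t)) has_vector_derivative
     complex_of_real (flat_exp (m + 2) t) + (- of_nat m) * complex_of_real (flat_exp (m + 1) t)) (at t)" for t
    using has_vector_derivative_of_real[OF flat_exp_has_derivative[of m t]] by simp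
  then show ?case
    by (rule Ck_SucI) (intro Ck_add Ck_mult Ck_const Suc.IH)
qed simp

lemma flat_exp_nonneg: "0 \<le> flat_exp m t" and flat_exp_pos: "0 < t \<Longrightarrow> 0 < flat_exp m t"
  by (auto simp: flat_exp_def)

text \<open>The usual smooth transition from 0 to 1 on \<open>[0, 1]\<close>; the denominator never
  vanishes because \<open>t\<close> or \<open>1 - t\<close> is positive.\<close>

definition smooth_step :: "real \<Rightarrow> real" where
  "smooth_step t = flat_exp 0 t / (flat_exp 0 t + flat_exp 0 (1 - t))"

lemma smooth_step_denom: "0 < flat_exp 0 t + flat_exp 0 (1 - t)"
  using flat_exp_nonneg[of 0 t] flat_exp_nonneg[of 0 "1 - t"] flat_exp_pos[of t 0] flat_exp_pos[of "1 - t" 0]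
  by (cases "0 < t") auto

lemma smooth_step_range: "0 \<le> smooth_step t" "smooth_step t \<le> 1"
  using smooth_step_denom[of t] flat_exp_nonneg[of 0 t] flat_exp_nonneg[of 0 "1 - t"]
  by (auto simp: smooth_step_def divide_simps)

lemma smooth_step_0: "t \<le> 0 \<Longrightarrow> smooth_step t = 0"
  and smooth_step_1: "1 \<le> t \<Longrightarrow> smooth_step t = 1"
  by (auto simp: smooth_step_def flat_exp_def)

lemma Ck_smooth_step: "Ck n (\<lambda>t. complex_of_real (smooth_step t))"
proof -
  have "Ck n (\<lambda>t. complex_of_real (flat_exp 0 ((-1) * t + 1)))"
    using Ck_affine[OF Ck_flat_exp] .
  then have "Ck n (\<lambda>t. complex_of_real (flat_exp 0 t) *
      inverse (complex_of_real (flat_exp 0 t) + complex_of_real (flat_exp 0 ((-1) * t + 1))))"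
    using smooth_step_denom
    by (intro Ck_mult Ck_inverse Ck_add Ck_flat_exp)
       (auto simp flip: of_real_add simp: less_le)
  then show ?thesis by (simp add: smooth_step_def divide_inverse)
qed

section \<open>Test functions in working form\<close>

lemma has_vector_derivative_locally_const:
  fixes f :: "real \<Rightarrow> complex"
  assumes "(f has_vector_derivative f') (at t)" "open U" "t \<in> U" "\<And>s. s \<in> U \<Longrightarrow> f s = c"
  shows "f' = 0"
proof -
  have "((\<lambda>_. c) has_vector_derivative f') (at t)"
    using has_vector_derivative_transform_within_open[OF assms(1-3)] assms(4) by auto
  then show ?thesis
    using vector_derivative_unique_at has_vector_derivative_const by blast
qed

text \<open>A closure is closed, so compactness of \<open>supp\<close> amounts to boundedness of the
  set of nonzeros, which can be checked pointwise.\<close>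

lemma test_fun_iff:
  "test_fun \<psi> \<longleftrightarrow> (\<forall>n. Ck n \<psi>) \<and> (\<exists>R. \<forall>t. R < \<bar>t\<bar> \<longrightarrow> \<psi> t = 0)"
proof -
  have "(\<forall>n. Ck n \<psi>) = (\<forall>k t. (vderiv ^^ k) \<psi> differentiable (at t))"
    by (auto simp: Ck_def)
  moreover have "compact (supp \<psi>) \<longleftrightarrow> (\<exists>R. \<forall>t. R < \<bar>t\<bar> \<longrightarrow> \<psi> t = 0)"
  proof -
    have "bounded {t. \<psi> t \<noteq> 0} \<longleftrightarrow> (\<exists>R. \<forall>t. R < \<bar>t\<bar> \<longrightarrow> \<psi> t = 0)"
      unfolding bounded_iff real_norm_def mem_Collect_eq
      by (intro ex_cong1 all_cong1) (auto simp: not_less)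
    then show ?thesis by (simp add: supp_def)
  qed
  ultimately show ?thesis by (simp add: test_fun_def)
qed

lemma test_fun_bounded_support:
  assumes "test_fun \<psi>"
  obtains R where "R > 0" "\<And>t. R < \<bar>t\<bar> \<Longrightarrow> \<psi> t = 0"
proof -
  obtain R where "\<And>t. R < \<bar>t\<bar> \<Longrightarrow> \<psi> t = 0" using assms test_fun_iff by auto
  then show ?thesis using that[of "max R 1"] by auto
qed

lemma test_fun_has_derivative:
  "test_fun \<psi> \<Longrightarrow> (\<psi> has_vector_derivative vderiv \<psi> t) (at t)"
  using Ck_SucD test_fun_iff by blast

lemma vderiv_eq_0:
  fixes f :: "real \<Rightarrow> complex"
  assumes "\<And>t. (f has_vector_derivative g t) (at t)" "\<And>t. R < \<bar>t\<bar> \<Longrightarrow> f t = 0" "R < \<bar>t\<bar>"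
  shows "g t = 0"
proof (rule has_vector_derivative_locally_const[OF assms(1)])
  show "open {t. R < \<bar>t\<bar>}" by (intro open_Collect_less continuous_intros)
qed (use assms in auto)

lemma test_fun_vderiv:
  assumes "test_fun \<psi>" shows "test_fun (vderiv \<psi>)"
proof -
  obtain R where "\<And>t. R < \<bar>t\<bar> \<Longrightarrow> \<psi> t = 0" using test_fun_bounded_support[OF assms] by blast
  then have "\<forall>t. R < \<bar>t\<bar> \<longrightarrow> vderiv \<psi> t = 0"
    using vderiv_eq_0[OF test_fun_has_derivative[OF assms]] by blast
  moreover have "Ck n (vderiv \<psi>)" for n using assms Ck_SucD test_fun_iff by blast
  ultimately show ?thesis using test_fun_iff by blast
qed

lemma test_fun_mult_smooth:
  assumes "test_fun \<psi>" "\<And>n. Ck n f"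
  shows "test_fun (\<lambda>t. f t * \<psi> t)"
  using assms unfolding test_fun_iff by (auto intro: Ck_mult)

lemma test_fun_mult: "test_fun \<eta> \<Longrightarrow> test_fun \<psi> \<Longrightarrow> test_fun (\<lambda>t. \<eta> t * \<psi> t)"
  using test_fun_mult_smooth test_fun_iff by blast

lemma test_fun_add:
  assumes "test_fun \<psi>" "test_fun \<eta>"
  shows "test_fun (\<lambda>t. \<psi> t + \<eta> t)"
proof -
  obtain R S where "\<forall>t. R < \<bar>t\<bar> \<longrightarrow> \<psi> t = 0" "\<forall>t. S < \<bar>t\<bar> \<longrightarrow> \<eta> t = 0"
    using assms test_fun_iff by blast
  then have "\<forall>t. max R S < \<bar>t\<bar> \<longrightarrow> \<psi> t + \<eta> t = 0" by auto
  moreover have "Ck n (\<lambda>t. \<psi> t + \<eta> t)" for n using assms Ck_add test_fun_iff by blast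
  ultimately show ?thesis using test_fun_iff by blast
qed

lemma test_fun_cmult: "test_fun \<psi> \<Longrightarrow> test_fun (\<lambda>t. c * \<psi> t)"
  by (intro test_fun_mult_smooth Ck_const)

lemma vderiv_mult:
  assumes "test_fun \<eta>" "test_fun \<psi>"
  shows "vderiv (\<lambda>t. \<eta> t * \<psi> t) = (\<lambda>t. \<eta> t * vderiv \<psi> t + vderiv \<eta> t * \<psi> t)"
  by (intro vderiv_eqI has_vector_derivative_mult test_fun_has_derivative assms)

lemma test_fun_continuous: "test_fun \<psi> \<Longrightarrow> continuous_on UNIV \<psi>"
  by (meson continuous_at_imp_continuous_on has_vector_derivative_continuous test_fun_has_derivative)

lemma continuous_compact_support_bounded:
  fixes f :: "real \<Rightarrow> complex"
  assumes "continuous_on UNIV f" "\<And>t. R < \<bar>t\<bar> \<Longrightarrow> f t = 0"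
  obtains B where "B > 0" "\<And>t. norm (f t) \<le> B"
proof -
  have "compact (f ` {-R..R})"
    using assms(1) by (intro compact_continuous_image) (auto intro: continuous_on_subset)
  then obtain B where B: "\<And>t. t \<in> {-R..R} \<Longrightarrow> norm (f t) \<le> B"
    by (meson bounded_iff compact_imp_bounded imageI)
  have "norm (f t) \<le> max B 1" for t
    using B[of t] assms(2)[of t] by (cases "R < \<bar>t\<bar>") (auto simp: abs_le_iff not_less max_def)
  then show ?thesis using that[of "max B 1"] by auto
qed

lemma test_fun_bounded:
  assumes "test_fun \<psi>" obtains B where "B > 0" "\<And>t. norm (\<psi> t) \<le> B"
  by (metis assms continuous_compact_support_bounded test_fun_bounded_support test_fun_continuous)

text \<open>A product of a rising and a falling step, each of width 1 whatever \<open>a\<close> and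
  \<open>b\<close> are; this is what makes the derivative bound uniform in both parameters.\<close>

definition plateau :: "real \<Rightarrow> real \<Rightarrow> real \<Rightarrow> complex" where
  "plateau a b t = complex_of_real (smooth_step (t - a + 1) * smooth_step (b + 1 - t))"

lemma plateau_eq_1: "a \<le> t \<Longrightarrow> t \<le> b \<Longrightarrow> plateau a b t = 1"
  and plateau_eq_0: "t \<le> a - 1 \<or> b + 1 \<le> t \<Longrightarrow> plateau a b t = 0"
  by (auto simp: plateau_def smooth_step_0 smooth_step_1)

lemma norm_plateau_le: "norm (plateau a b t) \<le> 1"
  unfolding plateau_def norm_of_real
  by (auto simp: abs_mult smooth_step_range intro: mult_le_one)

lemma Ck_plateau: "Ck n (plateau a b)"
proof -
  have "Ck n (\<lambda>t. complex_of_real (smooth_step (1 * t + (1 - a))) *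
                 complex_of_real (smooth_step ((-1) * t + (b + 1))))"
    by (intro Ck_mult Ck_affine[OF Ck_smooth_step])
  then show ?thesis by (simp add: plateau_def[abs_def] algebra_simps)
qed

lemma test_fun_plateau: "test_fun (plateau a b)"
  unfolding test_fun_iff
proof (intro conjI allI Ck_plateau exI impI)
  fix t assume "max \<bar>a\<bar> \<bar>b\<bar> + 1 < \<bar>t\<bar>"
  then show "plateau a b t = 0" by (intro plateau_eq_0) auto
qed

text \<open>Only translates and reflections of the single function \<open>smooth_step\<close> occur,
  so the sup of its derivative controls all plateaus. The constant found here determines the
  constant of the theorem.\<close>

lemma vderiv_plateau_bounded:
  obtains K where "K > 0" "\<And>a b t. norm (vderiv (plateau a b) t) \<le> K"
proof -
  define s where "s = (\<lambda>t. complex_of_real (smooth_step t))"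
  have ds: "(s has_vector_derivative vderiv s t) (at t)" for t
    using Ck_SucD(1)[OF Ck_smooth_step] unfolding s_def .
  have "Ck (Suc 0) (vderiv s)" using Ck_SucD(2)[OF Ck_smooth_step] unfolding s_def .
  then have cont: "continuous_on UNIV (vderiv s)"
    by (meson Ck_SucD(1) continuous_at_imp_continuous_on has_vector_derivative_continuous)
  \<comment> \<open>The step is constant outside \<open>[0, 1]\<close>, so its continuous derivative
    has bounded support and is therefore bounded.\<close>
  have "vderiv s t = 0" if "1 < \<bar>t\<bar>" for t
  proof (cases "t > 1")
    case True
    show ?thesis
      by (rule has_vector_derivative_locally_const[OF ds, of "{1<..}" _ 1])
         (use True in \<open>auto simp: s_def smooth_step_1\<close>)
  next
    case False
    show ?thesis
      by (rule has_vector_derivative_locally_const[OF ds, of "{..<0}" _ 0])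
         (use False that in \<open>auto simp: s_def smooth_step_0\<close>)
  qed
  with cont obtain B where B: "B > 0" "\<And>t. norm (vderiv s t) \<le> B"
    using continuous_compact_support_bounded by blast
  have "norm (vderiv (plateau a b) t) \<le> 2 * B" for a b t
  proof -
    have "plateau a b = (\<lambda>t. s (1 * t + (1 - a)) * s ((-1) * t + (b + 1)))"
      by (simp add: plateau_def[abs_def] s_def algebra_simps)
    then have "vderiv (plateau a b) t =
        s (1 * t + (1 - a)) * (of_real (-1) * vderiv s ((-1) * t + (b + 1)))
        + of_real 1 * vderiv s (1 * t + (1 - a)) * s ((-1) * t + (b + 1))"
      using vector_derivative_at[OF has_vector_derivative_mult[OF
          has_vector_derivative_affine[OF ds, where a = 1 and b = "1 - a" and t = t]
          has_vector_derivative_affine[OF ds, where a = "-1" and b = "b + 1" and t = t]]]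
      by (simp add: vderiv_def vector_derivative_at)
    moreover have "norm (s t) \<le> 1" for t by (simp add: s_def smooth_step_range)
    moreover have "norm (x * (of_real (-1) * y') + of_real 1 * x' * y) \<le> 1 * B + B * 1"
      if "norm x \<le> 1" "norm y \<le> 1" "norm x' \<le> B" "norm y' \<le> B" for x x' y y' :: complex
      by (rule norm_triangle_mono) (use that B in \<open>auto simp: norm_mult intro: mult_mono[of _ 1 _ B, simplified] mult_mono[of _ B _ 1, simplified]\<close>)
    ultimately have "norm (vderiv (plateau a b) t) \<le> 1 * B + B * 1"
      using B by (simp only:)
    then show ?thesis by simp
  qed
  then show ?thesis using that[of "2 * B"] B by simp
qed


section \<open>Square integrable functions and the Riesz representation\<close>

definition norm_L2 :: "(real \<Rightarrow> complex) \<Rightarrow> real" where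
  "norm_L2 u = sqrt (LINT t|lebesgue. (norm (u t))\<^sup>2)"

lemma L2_measurable: "L2 u \<Longrightarrow> u \<in> borel_measurable lebesgue"
  and L2_integrable: "L2 u \<Longrightarrow> integrable lebesgue (\<lambda>t. (norm (u t))\<^sup>2)"
  by (auto simp: L2_def)

lemma norm_L2_nonneg [simp]: "0 \<le> norm_L2 u"
  by (simp add: norm_L2_def)

lemma norm_L2_power2: "(norm_L2 u)\<^sup>2 = (LINT t|lebesgue. (norm (u t))\<^sup>2)"
  by (simp add: norm_L2_def)

lemma L2_dominated:
  assumes "L2 u" "v \<in> borel_measurable lebesgue" "\<And>t. norm (v t) \<le> B * norm (u t)"
  shows "L2 v" and "norm_L2 v \<le> \<bar>B\<bar> * norm_L2 u"
proof -
  have le: "(norm (v t))\<^sup>2 \<le> B\<^sup>2 * (norm (u t))\<^sup>2" for t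
    using power_mono[OF assms(3) norm_ge_zero, of t 2] by (simp add: power_mult_distrib)
  have int: "integrable lebesgue (\<lambda>t. B\<^sup>2 * (norm (u t))\<^sup>2)"
    using L2_integrable[OF assms(1)] by simp
  have "integrable lebesgue (\<lambda>t. (norm (v t))\<^sup>2)"
    by (rule Bochner_Integration.integrable_bound[OF int]) (use assms(2) le in auto)
  then show "L2 v" using assms(2) by (simp add: L2_def)
  have "(LINT t|lebesgue. (norm (v t))\<^sup>2) \<le> (LINT t|lebesgue. B\<^sup>2 * (norm (u t))\<^sup>2)"
    by (rule integral_mono) (use le int \<open>integrable lebesgue (\<lambda>t. (norm (v t))\<^sup>2)\<close> in auto)
  also have "\<dots> = B\<^sup>2 * (LINT t|lebesgue. (norm (u t))\<^sup>2)" by simp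
  finally have "norm_L2 v \<le> sqrt (B\<^sup>2 * (LINT t|lebesgue. (norm (u t))\<^sup>2))"
    unfolding norm_L2_def by (rule real_sqrt_le_mono)
  then show "norm_L2 v \<le> \<bar>B\<bar> * norm_L2 u"
    by (simp add: real_sqrt_mult norm_L2_def)
qed

lemma L2_add:
  assumes "L2 u" "L2 v" shows "L2 (\<lambda>t. u t + v t)"
proof -
  note [measurable] = L2_measurable[OF assms(1)] L2_measurable[OF assms(2)]
  have int: "integrable lebesgue (\<lambda>t. 2 * (norm (u t))\<^sup>2 + 2 * (norm (v t))\<^sup>2)"
    using L2_integrable assms by simp
  have le: "(norm (a + b))\<^sup>2 \<le> 2 * (norm a)\<^sup>2 + 2 * (norm b)\<^sup>2" for a b :: complex
  proof -
    have "(norm (a + b))\<^sup>2 \<le> (norm a + norm b)\<^sup>2" by (simp add: norm_triangle_ineq power_mono)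
    also have "\<dots> \<le> 2 * (norm a)\<^sup>2 + 2 * (norm b)\<^sup>2"
      using sum_squares_ge_zero[of "norm a - norm b" 0] by (simp add: power2_eq_square algebra_simps)
    finally show ?thesis .
  qed
  have "integrable lebesgue (\<lambda>t. (norm (u t + v t))\<^sup>2)"
    by (rule Bochner_Integration.integrable_bound[OF int]) (use le in auto)
  then show ?thesis by (simp add: L2_def)
qed

lemma L2_cmult: "L2 u \<Longrightarrow> L2 (\<lambda>t. c * u t)"
  by (rule L2_dominated(1)[where B = "norm c"]) (auto simp: norm_mult dest: L2_measurable)

lemma norm_L2_cmult: "norm_L2 (\<lambda>t. c * u t) = norm c * norm_L2 u"
  by (simp add: norm_L2_def norm_mult power_mult_distrib real_sqrt_mult)

lemma L2_diff: "L2 u \<Longrightarrow> L2 v \<Longrightarrow> L2 (\<lambda>t. u t - v t)"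
  using L2_add[of u "\<lambda>t. (-1) * v t"] L2_cmult[of v "-1"] by simp

lemma L2_zero [simp]: "L2 (\<lambda>t. 0)"
  by (simp add: L2_def)

lemma L2_sum: "(\<And>i. i \<in> A \<Longrightarrow> L2 (u i)) \<Longrightarrow> L2 (\<lambda>t. \<Sum>i\<in>A. u i t)"
  by (induction A rule: infinite_finite_induct) (auto intro: L2_add)

lemma L2_cnj:
  assumes "L2 u" shows "L2 (\<lambda>t. cnj (u t))"
proof -
  have "(\<lambda>t. cnj (u t)) \<in> borel_measurable lebesgue"
    by (rule measurable_compose[OF L2_measurable[OF assms]])
       (rule borel_measurable_continuous_onI, intro continuous_intros)
  with L2_integrable[OF assms] show ?thesis by (simp add: L2_def)
qed

lemma norm_L2_cnj: "norm_L2 (\<lambda>t. cnj (u t)) = norm_L2 u"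
  by (simp add: norm_L2_def)

lemma L2_indicator:
  assumes "L2 u" "A \<in> sets lebesgue" shows "L2 (\<lambda>t. indicator A t * u t)"
  by (rule L2_dominated(1)[OF assms(1), where B = 1])
     (use assms in \<open>auto simp: indicator_def norm_mult intro!: borel_measurable_times borel_measurable_indicator dest: L2_measurable\<close>)

lemma L2_mult_integrable:
  assumes "L2 u" "L2 v" shows "integrable lebesgue (\<lambda>t. u t * v t)"
proof -
  note [measurable] = L2_measurable[OF assms(1)] L2_measurable[OF assms(2)]
  have int: "integrable lebesgue (\<lambda>t. (norm (u t))\<^sup>2 + (norm (v t))\<^sup>2)"
    using L2_integrable assms by simp
  have le: "x * y \<le> x\<^sup>2 + y\<^sup>2" if "0 \<le> x" "0 \<le> y" for x y :: real
    using zero_le_power2[of "x - y"] mult_nonneg_nonneg[OF that]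
    by (simp add: power2_diff)
  show ?thesis
    by (rule Bochner_Integration.integrable_bound[OF int]) (use le in \<open>auto simp: norm_mult\<close>)
qed

text \<open>Carries the inequality over from nonnegative integrals. The norms stay inside the
  integral because the integrability check for Fubini in \<open>weak_deriv_prim\<close> needs the
  absolute version.\<close>

lemma L2_Cauchy_Schwarz_norm:
  assumes "L2 u" "L2 v"
  shows "(LINT t|lebesgue. norm (u t) * norm (v t)) \<le> norm_L2 u * norm_L2 v"
proof -
  note [measurable] = L2_measurable[OF assms(1)] L2_measurable[OF assms(2)]
  have int: "integrable lebesgue (\<lambda>t. norm (u t) * norm (v t))"
    using integrable_norm[OF L2_mult_integrable[OF assms]] by (simp add: norm_mult)
  have "(\<integral>\<^sup>+t. ennreal (norm (u t)) * ennreal (norm (v t)) \<partial>lebesgue)\<^sup>2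
     \<le> (\<integral>\<^sup>+t. ennreal (norm (u t)) ^ 2 \<partial>lebesgue) * (\<integral>\<^sup>+t. ennreal (norm (v t)) ^ 2 \<partial>lebesgue)"
    by (rule Cauchy_Schwarz_nn_integral) measurable
  also have "(\<integral>\<^sup>+t. ennreal (norm (u t)) * ennreal (norm (v t)) \<partial>lebesgue) =
      ennreal (LINT t|lebesgue. norm (u t) * norm (v t))"
    by (subst nn_integral_eq_integral[OF int, symmetric]) (auto simp: ennreal_mult)
  also have "(\<integral>\<^sup>+t. ennreal (norm (u t)) ^ 2 \<partial>lebesgue) = ennreal ((norm_L2 u)\<^sup>2)"
    unfolding norm_L2_power2
    by (subst nn_integral_eq_integral[OF L2_integrable[OF assms(1)], symmetric]) (auto simp: ennreal_power)
  also have "(\<integral>\<^sup>+t. ennreal (norm (v t)) ^ 2 \<partial>lebesgue) = ennreal ((norm_L2 v)\<^sup>2)"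
    unfolding norm_L2_power2
    by (subst nn_integral_eq_integral[OF L2_integrable[OF assms(2)], symmetric]) (auto simp: ennreal_power)
  finally have "(LINT t|lebesgue. norm (u t) * norm (v t))\<^sup>2 \<le> (norm_L2 u * norm_L2 v)\<^sup>2"
    by (simp add: ennreal_power power_mult_distrib flip: ennreal_mult)
  then show ?thesis by (rule power2_le_imp_le) simp
qed

lemma L2_Cauchy_Schwarz:
  assumes "L2 u" "L2 v"
  shows "norm (LINT t|lebesgue. u t * v t) \<le> norm_L2 u * norm_L2 v"
proof -
  have "norm (LINT t|lebesgue. u t * v t) \<le> (LINT t|lebesgue. norm (u t) * norm (v t))"
    using integral_norm_bound[of lebesgue "\<lambda>t. u t * v t"] by (simp add: norm_mult)
  with L2_Cauchy_Schwarz_norm[OF assms] show ?thesis by linarith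
qed

lemma norm_L2_add_power2:
  assumes "L2 u" "L2 v"
  shows "(norm_L2 (\<lambda>t. u t + v t))\<^sup>2 =
    (norm_L2 u)\<^sup>2 + (norm_L2 v)\<^sup>2 + 2 * Re (LINT t|lebesgue. cnj (u t) * v t)"
proof -
  have int: "integrable lebesgue (\<lambda>t. cnj (u t) * v t)"
    by (intro L2_mult_integrable L2_cnj assms)
  have "(norm (a + b))\<^sup>2 = (norm a)\<^sup>2 + (norm b)\<^sup>2 + 2 * Re (cnj a * b)" for a b :: complex
    unfolding cmod_power2 by (simp add: power2_eq_square algebra_simps)
  then have "(norm_L2 (\<lambda>t. u t + v t))\<^sup>2 =
      (LINT t|lebesgue. (norm (u t))\<^sup>2 + (norm (v t))\<^sup>2 + 2 * Re (cnj (u t) * v t))"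
    by (simp only: norm_L2_power2)
  also have "\<dots> = (norm_L2 u)\<^sup>2 + (norm_L2 v)\<^sup>2 + (LINT t|lebesgue. 2 * Re (cnj (u t) * v t))"
  proof -
    have *: "(LINT t|lebesgue. p t + q t + r t) =
        (LINT t|lebesgue. p t) + (LINT t|lebesgue. q t) + (LINT t|lebesgue. r t)"
      if "integrable lebesgue p" "integrable lebesgue q" "integrable lebesgue r" for p q r :: "real \<Rightarrow> real"
      using that by simp
    then show ?thesis
      unfolding norm_L2_power2
      by (intro L2_integrable assms * integrable_mult_right integrable_Re int)
  qed
  also have "(LINT t|lebesgue. 2 * Re (cnj (u t) * v t)) = 2 * Re (LINT t|lebesgue. cnj (u t) * v t)"
    by (subst integral_Re[OF int, symmetric]) (rule integral_mult_right_zero)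
  finally show ?thesis .
qed

lemma norm_L2_triangle:
  assumes "L2 u" "L2 v"
  shows "norm_L2 (\<lambda>t. u t + v t) \<le> norm_L2 u + norm_L2 v"
proof -
  have "Re (LINT t|lebesgue. cnj (u t) * v t) \<le> norm_L2 u * norm_L2 v"
    using complex_Re_le_cmod L2_Cauchy_Schwarz[OF L2_cnj[OF assms(1)] assms(2)]
    by (metis norm_L2_cnj order_trans)
  then have "(norm_L2 (\<lambda>t. u t + v t))\<^sup>2 \<le> (norm_L2 u + norm_L2 v)\<^sup>2"
    using norm_L2_add_power2[OF assms] by (simp add: power2_sum)
  then show ?thesis by (rule power2_le_imp_le) simp
qed

lemma norm_L2_diff_commute: "norm_L2 (\<lambda>t. u t - v t) = norm_L2 (\<lambda>t. v t - u t)"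
  by (simp add: norm_L2_def norm_minus_commute)

lemma norm_L2_triangle_diff:
  assumes "L2 u" "L2 v"
  shows "norm_L2 u \<le> norm_L2 v + norm_L2 (\<lambda>t. u t - v t)"
  using norm_L2_triangle[OF assms(2) L2_diff[OF assms]] by simp

section \<open>Completeness of \<open>L2\<close> and the Riesz theorem\<close>

lemma summable_if_weighted_squares_bounded:
  fixes d :: "nat \<Rightarrow> complex"
  assumes "\<And>k. 2 ^ k * (norm (d k))\<^sup>2 \<le> c"
  shows "summable d"
proof -
  \<comment> \<open>Taking square roots gives geometric decay with ratio
    \<open>1 / sqrt 2\<close>.\<close>
  have "norm (d k) \<le> sqrt c * (1 / sqrt 2) ^ k" for k
  proof -
    have "(sqrt 2) ^ k * norm (d k) = sqrt (2 ^ k * (norm (d k))\<^sup>2)"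
      by (simp add: real_sqrt_mult real_sqrt_power)
    also have "\<dots> \<le> sqrt c" using assms by simp
    finally show ?thesis by (simp add: field_simps)
  qed
  moreover have "summable (\<lambda>k. sqrt c * (1 / sqrt 2) ^ k)"
    by (intro summable_mult summable_geometric) (auto simp: real_less_lsqrt)
  ultimately show ?thesis by (rule summable_comparison_test'[rotated])
qed

text \<open>
  Fast convergence makes \<open>2 ^ k * (norm (g (k + 1) t - g k t))\<^sup>2\<close> summable for almost every \<open>t\<close>, which
  gives pointwise convergence; Fatou's lemma then identifies the limit.
\<close>

lemma L2_complete:
  assumes g: "\<And>k. L2 (g k)"
    and cauchy: "\<And>k j. k \<le> j \<Longrightarrow> (norm_L2 (\<lambda>t. g j t - g k t))\<^sup>2 \<le> K * (1 / 4) ^ k"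
  obtains h where "L2 h" "\<And>k. (norm_L2 (\<lambda>t. h t - g k t))\<^sup>2 \<le> K * (1 / 4) ^ k"
proof -
  note [measurable] = L2_measurable[OF g]
  have K: "0 \<le> K" using order_trans[OF zero_le_power2 cauchy[of 0 0]] by simp
  define d where "d k t = g (Suc k) t - g k t" for k t
  have d: "L2 (d k)" for k unfolding d_def by (intro L2_diff g)
  note [measurable] = L2_measurable[OF d]
  have "(\<integral>\<^sup>+t. (\<Sum>k. ennreal (2 ^ k * (norm (d k t))\<^sup>2)) \<partial>lebesgue) =
        (\<Sum>k. \<integral>\<^sup>+t. ennreal (2 ^ k * (norm (d k t))\<^sup>2) \<partial>lebesgue)"
    by (rule nn_integral_suminf) measurable
  also have "\<dots> \<le> (\<Sum>k. ennreal (K * (1 / 2) ^ k))"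
  proof (intro suminf_le)
    fix k
    have "(\<integral>\<^sup>+t. ennreal (2 ^ k * (norm (d k t))\<^sup>2) \<partial>lebesgue) = ennreal (2 ^ k * (norm_L2 (d k))\<^sup>2)"
      unfolding norm_L2_power2 using L2_integrable[OF d]
      by (subst nn_integral_eq_integral) auto
    also have "\<dots> \<le> ennreal (2 ^ k * (K * (1 / 4) ^ k))"
      using cauchy[of k "Suc k"] by (intro ennreal_leI mult_left_mono) (auto simp: d_def[abs_def])
    also have "2 ^ k * (K * (1 / 4) ^ k) = K * (1 / 2 :: real) ^ k"
    proof -
      have "(1 / 4 :: real) ^ k = (1 / 2) ^ k * (1 / 2) ^ k" by (simp flip: power_mult_distrib)
      then show ?thesis by (simp add: power_divide)
    qed
    finally show "(\<integral>\<^sup>+t. ennreal (2 ^ k * (norm (d k t))\<^sup>2) \<partial>lebesgue) \<le> ennreal (K * (1 / 2) ^ k)" .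
  qed auto
  also have "\<dots> = ennreal (\<Sum>k. K * (1 / 2) ^ k)"
    using K by (intro suminf_ennreal2 summable_mult summable_geometric) auto
  also have "\<dots> < \<infinity>" by simp
  finally have "AE t in lebesgue. (\<Sum>k. ennreal (2 ^ k * (norm (d k t))\<^sup>2)) \<noteq> \<infinity>"
    by (intro nn_integral_PInf_AE) auto
  then have conv: "AE t in lebesgue. convergent (\<lambda>k. g k t)"
  proof (rule AE_mp, intro AE_I2 impI)
    fix t assume fin: "(\<Sum>k. ennreal (2 ^ k * (norm (d k t))\<^sup>2)) \<noteq> \<infinity>"
    define f where "f k = ennreal (2 ^ k * (norm (d k t))\<^sup>2)" for k
    define c where "c = enn2real (suminf f)"
    have "suminf f < top" using fin unfolding f_def infinity_ennreal_def less_top .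
    then have c: "suminf f = ennreal c" "0 \<le> c" unfolding c_def by simp_all
    have "2 ^ k * (norm (d k t))\<^sup>2 \<le> c" for k
    proof -
      have "sum f {k} \<le> suminf f" by (rule sum_le_suminf) auto
      then have "f k \<le> ennreal c" by (simp add: c)
      then show ?thesis unfolding f_def using c(2) by (simp only: ennreal_le_iff)
    qed
    then have "summable (\<lambda>k. d k t)" by (rule summable_if_weighted_squares_bounded)
    then have "convergent (\<lambda>n. \<Sum>k<n. d k t)" by (simp add: summable_iff_convergent)
    moreover have "(\<Sum>k<n. d k t) = g n t - g 0 t" for n
      unfolding d_def by (rule sum_lessThan_telescope)
    ultimately have "convergent (\<lambda>n. g n t - g 0 t)" by simp
    from convergent_add[OF this convergent_const[of "g 0 t"]] show "convergent (\<lambda>n. g n t)" by simp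
  qed
  \<comment> \<open>Where the sequence diverges, \<open>lim\<close> is some unspecified value; such
    points form a null set by \<open>conv\<close>, and \<open>h\<close> is measurable in any
    case.\<close>
  define h where "h t = lim (\<lambda>k. g k t)" for t
  have h [measurable]: "h \<in> borel_measurable lebesgue"
    unfolding h_def[abs_def] by measurable
  have *: "(\<integral>\<^sup>+t. ennreal ((norm (h t - g k t))\<^sup>2) \<partial>lebesgue) \<le> ennreal (K * (1 / 4) ^ k)" for k
  proof -
    have "(\<integral>\<^sup>+t. ennreal ((norm (h t - g k t))\<^sup>2) \<partial>lebesgue) =
          (\<integral>\<^sup>+t. liminf (\<lambda>j. ennreal ((norm (g j t - g k t))\<^sup>2)) \<partial>lebesgue)"
    proof (rule nn_integral_cong_AE, rule AE_mp[OF conv], intro AE_I2 impI)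
      fix t assume "convergent (\<lambda>k. g k t)"
      then have "(\<lambda>j. g j t) \<longlonglongrightarrow> h t" by (simp add: h_def convergent_LIMSEQ_iff)
      then have "(\<lambda>j. ennreal ((norm (g j t - g k t))\<^sup>2)) \<longlonglongrightarrow> ennreal ((norm (h t - g k t))\<^sup>2)"
        by (intro tendsto_intros)
      then show "ennreal ((norm (h t - g k t))\<^sup>2) = liminf (\<lambda>j. ennreal ((norm (g j t - g k t))\<^sup>2))"
        using lim_imp_Liminf[OF sequentially_bot] by metis
    qed
    also have "\<dots> \<le> liminf (\<lambda>j. \<integral>\<^sup>+t. ennreal ((norm (g j t - g k t))\<^sup>2) \<partial>lebesgue)"
      by (rule nn_integral_liminf) measurable
    also have "\<dots> \<le> liminf (\<lambda>j. ennreal (K * (1 / 4) ^ k))"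
    proof (rule Liminf_mono, rule eventually_sequentiallyI)
      fix j assume "k \<le> j"
      have "(\<integral>\<^sup>+t. ennreal ((norm (g j t - g k t))\<^sup>2) \<partial>lebesgue) = ennreal ((norm_L2 (\<lambda>t. g j t - g k t))\<^sup>2)"
        unfolding norm_L2_power2 using L2_integrable[OF L2_diff[OF g g]]
        by (subst nn_integral_eq_integral) auto
      with cauchy[OF \<open>k \<le> j\<close>]
      show "(\<integral>\<^sup>+t. ennreal ((norm (g j t - g k t))\<^sup>2) \<partial>lebesgue) \<le> ennreal (K * (1 / 4) ^ k)"
        by (simp add: ennreal_leI)
    qed
    also have "\<dots> = ennreal (K * (1 / 4) ^ k)" by (simp add: Liminf_const)
    finally show ?thesis .
  qed
  have hg: "L2 (\<lambda>t. h t - g k t)" for k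
    unfolding L2_def
  proof (intro conjI integrableI_bounded)
    show "(\<integral>\<^sup>+t. ennreal (norm ((norm (h t - g k t))\<^sup>2)) \<partial>lebesgue) < \<infinity>"
      using *[of k] by (simp add: order_le_less_trans)
  qed measurable
  show ?thesis
  proof
    show "L2 h" using L2_add[OF hg[of 0] g[of 0]] by simp
    show "(norm_L2 (\<lambda>t. h t - g k t))\<^sup>2 \<le> K * (1 / 4) ^ k" for k
      using *[of k] K nn_integral_eq_integral[OF L2_integrable[OF hg[of k]]]
      by (simp add: norm_L2_power2)
  qed
qed

lemma quadratic_nonneg_imp_linear_zero:
  fixes a b :: real
  assumes "\<And>x. 0 \<le> 2 * x * a + x\<^sup>2 * b"
  shows "a = 0"
proof (rule ccontr)
  assume "a \<noteq> 0"
  have b: "0 \<le> b" using assms[of 1] assms[of "-1"] by simp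
  \<comment> \<open>A point near the minimizer \<open>- a / b\<close>; the added 1 avoids division
    by zero and still makes the quadratic negative.\<close>
  have "0 \<le> 2 * (- a / (b + 1)) * a + (- a / (b + 1))\<^sup>2 * b" by (rule assms)
  also have "\<dots> = - (a\<^sup>2 * (b + 2) / (b + 1)\<^sup>2)"
  proof -
    have "2 * (- a / c) * a + (- a / c)\<^sup>2 * b = - (a\<^sup>2 * (b + 2) / c\<^sup>2)" if "c = b + 1" "c \<noteq> 0" for c
    proof -
      have "2 * (- a / c) * a = - (2 * a\<^sup>2 * c) / c\<^sup>2"
        using that(2) by (simp add: power2_eq_square)
      moreover have "(- a / c)\<^sup>2 * b = a\<^sup>2 * b / c\<^sup>2" by (simp add: power_divide)
      moreover have "2 * a\<^sup>2 * c = 2 * a\<^sup>2 * b + 2 * a\<^sup>2" by (simp add: that(1) algebra_simps)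
      ultimately show ?thesis by (simp add: algebra_simps flip: add_divide_distrib)
    qed
    then show ?thesis using b by simp
  qed
  also have "\<dots> < 0" using b \<open>a \<noteq> 0\<close> by simp
  finally show False by simp
qed

text \<open>The representing function minimizes \<open>(norm_L2 u)\<^sup>2 - 2 * Re (F u)\<close>.\<close>

lemma L2_Riesz:
  assumes add: "\<And>u v. L2 u \<Longrightarrow> L2 v \<Longrightarrow> F (\<lambda>t. u t + v t) = F u + F v"
    and scale: "\<And>c u. L2 u \<Longrightarrow> F (\<lambda>t. c * u t) = c * F u"
    and bound: "\<And>u. L2 u \<Longrightarrow> norm (F u) \<le> B * norm_L2 u"
    and "0 \<le> B"
  obtains g where "L2 g" "norm_L2 g \<le> B" "\<And>u. L2 u \<Longrightarrow> F u = (LINT t|lebesgue. g t * u t)"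
proof -
  define Q where "Q u = (norm_L2 u)\<^sup>2 - 2 * Re (F u)" for u
  \<comment> \<open>Completing the square in \<open>norm_L2 u\<close> bounds \<open>Q\<close>
    below.\<close>
  have Q_lower: "- B\<^sup>2 \<le> Q u" if "L2 u" for u
  proof -
    have "Re (F u) \<le> B * norm_L2 u"
      using bound[OF that] complex_Re_le_cmod order_trans by blast
    with zero_le_power2[of "norm_L2 u - B"] show ?thesis
      by (simp add: Q_def power2_diff algebra_simps)
  qed
  define m where "m = (INF u\<in>Collect L2. Q u)"
  have bdd: "bdd_below (Q ` Collect L2)" using Q_lower by (auto intro!: bdd_belowI)
  have m_le: "m \<le> Q u" if "L2 u" for u
    unfolding m_def using bdd that by (auto intro!: cINF_lower)
  have "\<exists>u. L2 u \<and> Q u < m + (1 / 4) ^ k" for k :: nat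
  proof -
    have "Collect L2 \<noteq> {}" using L2_zero by blast
    then show ?thesis
      using cINF_less_iff[OF _ bdd, of "m + (1 / 4) ^ k"] by (auto simp: m_def)
  qed
  then obtain g where g: "\<And>k. L2 (g k)" and Qg: "\<And>k::nat. Q (g k) < m + (1 / 4) ^ k"
    by metis
  \<comment> \<open>The parallelogram law. Two functions whose values under \<open>Q\<close> are
    within \<open>(1 / 4) ^ k\<close> of the infimum then have squared distance at most
    \<open>4 * (1 / 4) ^ k\<close>, because their midpoint cannot go below \<open>m\<close>.\<close>
  have half: "Q u + Q v - 2 * Q (\<lambda>t. (1 / 2) * (u t + v t)) = (norm_L2 (\<lambda>t. u t - v t))\<^sup>2 / 2"
    if "L2 u" "L2 v" for u v
  proof -
    have "Q (\<lambda>t. (1 / 2) * (u t + v t)) = (norm_L2 (\<lambda>t. u t + v t))\<^sup>2 / 4 - Re (F u) - Re (F v)"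
      unfolding Q_def scale[OF L2_add[OF that]] add[OF that] norm_L2_cmult
      by (simp add: power_divide add_divide_distrib)
    moreover have "(norm_L2 (\<lambda>t. u t - v t))\<^sup>2 =
      (norm_L2 u)\<^sup>2 + (norm_L2 v)\<^sup>2 - 2 * Re (LINT t|lebesgue. cnj (u t) * v t)"
      using norm_L2_add_power2[OF that(1) L2_cmult[OF that(2), of "-1"]] norm_L2_cmult[of "-1" v]
      by simp
    ultimately show ?thesis
      using norm_L2_add_power2[OF that] unfolding Q_def[of u] Q_def[of v] by linarith
  qed
  have "(norm_L2 (\<lambda>t. g j t - g k t))\<^sup>2 \<le> 4 * (1 / 4) ^ k" if "k \<le> j" for j k
  proof -
    have "(1 / 4 :: real) ^ j \<le> (1 / 4) ^ k" using that by (simp add: power_decreasing)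
    moreover have "m \<le> Q (\<lambda>t. (1 / 2) * (g j t + g k t))"
      by (intro m_le L2_cmult L2_add g)
    ultimately show ?thesis using half[OF g[of j] g[of k]] Qg[of j] Qg[of k] by linarith
  qed
  from L2_complete[OF g this] obtain h where h: "L2 h"
    and hg: "\<And>k. (norm_L2 (\<lambda>t. h t - g k t))\<^sup>2 \<le> 4 * (1 / 4) ^ k" by blast
  have hg': "norm_L2 (\<lambda>t. h t - g k t) \<le> 2 * (1 / 2) ^ k" for k
  proof (rule power2_le_imp_le)
    show "(norm_L2 (\<lambda>t. h t - g k t))\<^sup>2 \<le> (2 * (1 / 2) ^ k)\<^sup>2"
      using hg[of k] by (simp add: power_mult_distrib power2_eq_square flip: power_mult_distrib)
  qed simp
  have lim: "(\<lambda>k. norm_L2 (\<lambda>t. h t - g k t)) \<longlonglongrightarrow> 0"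
  proof (rule tendsto_sandwich[OF _ _ tendsto_const])
    show "(\<lambda>k. 2 * (1 / 2 :: real) ^ k) \<longlonglongrightarrow> 0"
      by (intro tendsto_mult_right_zero LIMSEQ_realpow_zero) auto
  qed (use hg' in auto)
  have "(\<lambda>k. Q (g k)) \<longlonglongrightarrow> Q h"
  proof -
    have "(\<lambda>k. norm_L2 (g k)) \<longlonglongrightarrow> norm_L2 h"
    proof (rule Lim_transform2[OF tendsto_const], rule Lim_null_comparison[OF _ lim], rule always_eventually, rule allI)
      show "norm (norm_L2 h - norm_L2 (g k)) \<le> norm_L2 (\<lambda>t. h t - g k t)" for k
        using norm_L2_triangle_diff[OF h g[of k]] norm_L2_triangle_diff[OF g[of k] h]
          norm_L2_diff_commute[of h "g k"] by simp
    qed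
    moreover have "(\<lambda>k. F (g k)) \<longlonglongrightarrow> F h"
    proof (rule Lim_transform2[OF tendsto_const], rule Lim_null_comparison, rule always_eventually, rule allI)
      show "norm (F h - F (g k)) \<le> B * norm_L2 (\<lambda>t. h t - g k t)" for k
        using bound[OF L2_diff[OF h g[of k]]] add[OF h L2_cmult[OF g[of k], of "-1"]] scale[OF g[of k], of "-1"]
        by simp
      show "(\<lambda>k. B * norm_L2 (\<lambda>t. h t - g k t)) \<longlonglongrightarrow> 0"
        using lim by (rule tendsto_mult_right_zero)
    qed
    ultimately show ?thesis unfolding Q_def by (intro tendsto_intros)
  qed
  moreover have "(\<lambda>k. m + (1 / 4) ^ k) \<longlonglongrightarrow> m"
    using tendsto_add[OF tendsto_const LIMSEQ_realpow_zero, of "1 / 4" m] by simp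
  ultimately have "Q h \<le> m"
    by (rule LIMSEQ_le) (use Qg in \<open>auto intro: less_imp_le\<close>)
  have Re_eq: "Re (F u) = Re (LINT t|lebesgue. cnj (h t) * u t)" if u: "L2 u" for u
  proof -
    \<comment> \<open>The first variation: moving from the minimizer \<open>h\<close> by a real
      multiple \<open>x\<close> of \<open>u\<close> cannot decrease \<open>Q\<close>, so the
      coefficient linear in \<open>x\<close> must vanish.\<close>
    have "0 \<le> 2 * x * (Re (LINT t|lebesgue. cnj (h t) * u t) - Re (F u)) + x\<^sup>2 * (norm_L2 u)\<^sup>2" for x :: real
    proof -
      have "m \<le> Q (\<lambda>t. h t + complex_of_real x * u t)"
        by (intro m_le L2_add L2_cmult h u)
      moreover have "(LINT t|lebesgue. cnj (h t) * (complex_of_real x * u t)) =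
          complex_of_real x * (LINT t|lebesgue. cnj (h t) * u t)"
        by (simp add: algebra_simps flip: integral_mult_right_zero)
      ultimately show ?thesis
        using \<open>Q h \<le> m\<close> norm_L2_add_power2[OF h L2_cmult[OF u, of "complex_of_real x"]]
          add[OF h L2_cmult[OF u, of "complex_of_real x"]]
        by (simp add: Q_def scale[OF u] norm_L2_cmult power_mult_distrib algebra_simps)
    qed
    from quadratic_nonneg_imp_linear_zero[OF this] show ?thesis by simp
  qed
  have F_eq: "F u = (LINT t|lebesgue. cnj (h t) * u t)" if u: "L2 u" for u
  proof (rule complex_eqI)
    show "Re (F u) = Re (LINT t|lebesgue. cnj (h t) * u t)" by (rule Re_eq[OF u])
    \<comment> \<open>The imaginary parts follow from the real parts for
      \<open>\<i> * u\<close>.\<close>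
    have "(LINT t|lebesgue. cnj (h t) * (\<i> * u t)) = \<i> * (LINT t|lebesgue. cnj (h t) * u t)"
      by (simp add: algebra_simps flip: integral_mult_right_zero)
    then show "Im (F u) = Im (LINT t|lebesgue. cnj (h t) * u t)"
      using Re_eq[OF L2_cmult[OF u, of \<i>]] by (simp add: scale[OF u])
  qed
  have "norm_L2 h \<le> B"
  proof (cases "norm_L2 h = 0")
    case False
    have "cnj z * z = of_real ((norm z)\<^sup>2)" for z by (metis complex_norm_square mult.commute)
    then have "F h = of_real ((norm_L2 h)\<^sup>2)"
      by (simp add: F_eq[OF h] norm_L2_power2 del: of_real_power)
    with bound[OF h] have "(norm_L2 h)\<^sup>2 \<le> B * norm_L2 h" by (simp add: norm_power)
    moreover have "0 < norm_L2 h" using False norm_L2_nonneg[of h] by linarith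
    ultimately show ?thesis by (simp add: power2_eq_square)
  qed (use \<open>0 \<le> B\<close> in simp)
  then show ?thesis
    \<comment> \<open>The pairing of the statement is bilinear while the minimizer is found with the
      inner product, hence the conjugate. The norm bound came from testing with \<open>h\<close>
      itself.\<close>
    by (intro that[of "\<lambda>t. cnj (h t)"]) (auto simp: L2_cnj[OF h] norm_L2_cnj F_eq)
qed


section \<open>Weak derivatives\<close>

lemma continuous_imp_lebesgue_measurable:
  fixes f :: "real \<Rightarrow> 'a::{real_normed_vector, second_countable_topology}"
  shows "continuous_on UNIV f \<Longrightarrow> f \<in> borel_measurable lebesgue"
  by (intro measurable_completion) (simp add: borel_measurable_continuous_onI)

lemma test_fun_measurable: "test_fun \<psi> \<Longrightarrow> \<psi> \<in> borel_measurable lebesgue"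
  by (intro continuous_imp_lebesgue_measurable test_fun_continuous)

lemma L2_indicator_interval: "L2 (indicator {a..b})"
proof -
  have "integrable lebesgue (indicator {a..b} :: real \<Rightarrow> real)"
    by (rule integrable_real_indicator) (auto simp: emeasure_lborel_Icc_eq)
  moreover have "(\<lambda>t. (norm (indicator {a..b} t :: complex))\<^sup>2) = (indicator {a..b} :: real \<Rightarrow> real)"
    by (auto simp: indicator_def)
  moreover have "(indicator {a..b} :: real \<Rightarrow> complex) \<in> borel_measurable lebesgue"
    by (rule borel_measurable_indicator) simp
  ultimately show ?thesis by (simp add: L2_def)
qed

lemma L2_bounded_support:
  assumes "f \<in> borel_measurable lebesgue" "\<And>t. norm (f t) \<le> B" "\<And>t. R < \<bar>t\<bar> \<Longrightarrow> f t = 0"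
  shows "L2 f"
proof (rule L2_dominated(1)[OF L2_indicator_interval assms(1)])
  fix t show "norm (f t) \<le> B * norm (indicator {-R..R} t :: complex)"
    using assms(2)[of t] assms(3)[of t] by (cases "R < \<bar>t\<bar>") (auto simp: indicator_def)
qed

lemma L2_continuous_support:
  assumes "continuous_on UNIV f" "\<And>t. R < \<bar>t\<bar> \<Longrightarrow> f t = 0"
  shows "L2 f"
proof -
  obtain B where "\<And>t. norm (f t) \<le> B" using continuous_compact_support_bounded[OF assms] by blast
  then show ?thesis
    by (intro L2_bounded_support continuous_imp_lebesgue_measurable) (use assms in auto)
qed

lemma L2_test_fun: "test_fun \<psi> \<Longrightarrow> L2 \<psi>"
  by (metis L2_continuous_support test_fun_bounded_support test_fun_continuous)

definition locally_integrable :: "(real \<Rightarrow> complex) \<Rightarrow> bool" where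
  "locally_integrable g \<longleftrightarrow> g \<in> borel_measurable lebesgue \<and> (\<forall>R. set_integrable lebesgue {-R..R} g)"

lemma locally_integrable_mult:
  assumes "locally_integrable g" "f \<in> borel_measurable lebesgue"
    "\<And>t. norm (f t) \<le> B" "\<And>t. R < \<bar>t\<bar> \<Longrightarrow> f t = 0"
  shows "integrable lebesgue (\<lambda>t. g t * f t)"
proof (rule Bochner_Integration.integrable_bound)
  show "integrable lebesgue (\<lambda>t. B * norm (indicator {-R..R} t *\<^sub>R g t))"
    using assms(1) unfolding locally_integrable_def set_integrable_def by (intro integrable_mult_right integrable_norm) auto
  show "(\<lambda>t. g t * f t) \<in> borel_measurable lebesgue"
    using assms unfolding locally_integrable_def by auto
  have "norm (g t * f t) \<le> norm (B * norm (indicator {-R..R} t *\<^sub>R g t))" for t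
  proof (cases "R < \<bar>t\<bar>")
    case False
    have "norm (g t) * norm (f t) \<le> norm (g t) * \<bar>B\<bar>"
      using assms(3)[of t] by (intro mult_left_mono) auto
    then show ?thesis using False by (auto simp: norm_mult mult.commute abs_mult indicator_def)
  qed (use assms(4) in simp)
  then show "AE t in lebesgue. norm (g t * f t) \<le> norm (B * norm (indicator {-R..R} t *\<^sub>R g t))" by simp
qed

lemma locally_integrable_test:
  assumes "locally_integrable g" "test_fun \<psi>"
  shows "integrable lebesgue (\<lambda>t. g t * \<psi> t)"
proof -
  obtain R where "\<And>t. R < \<bar>t\<bar> \<Longrightarrow> \<psi> t = 0" using test_fun_bounded_support[OF assms(2)] by blast
  moreover obtain B where "\<And>t. norm (\<psi> t) \<le> B" using test_fun_bounded[OF assms(2)] by blast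
  ultimately show ?thesis
    using locally_integrable_mult[OF assms(1) test_fun_measurable[OF assms(2)]] by blast
qed

lemma L2_locally_integrable:
  assumes "L2 u" shows "locally_integrable u"
  unfolding locally_integrable_def set_integrable_def
proof (intro conjI allI L2_measurable assms)
  fix R
  have "(\<lambda>t. indicator {-R..R} t *\<^sub>R u t) = (\<lambda>t. indicator {-R..R} t * u t)"
    by (auto simp: indicator_def)
  with L2_mult_integrable[OF L2_indicator_interval assms, of "-R" R]
  show "integrable lebesgue (\<lambda>t. indicator {-R..R} t *\<^sub>R u t)" by simp
qed

lemma continuous_locally_integrable:
  assumes "continuous_on UNIV u" shows "locally_integrable u"
  unfolding locally_integrable_def set_integrable_def
proof (intro conjI allI continuous_imp_lebesgue_measurable assms)
  fix R
  have "integrable lborel (\<lambda>t. indicator {-R..R} t *\<^sub>R u t)"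
    by (rule borel_integrable_compact) (use assms in \<open>auto intro: continuous_on_subset\<close>)
  then show "integrable lebesgue (\<lambda>t. indicator {-R..R} t *\<^sub>R u t)"
    by (subst integrable_completion) auto
qed

lemma locally_integrable_diff:
  "locally_integrable u \<Longrightarrow> locally_integrable v \<Longrightarrow> locally_integrable (\<lambda>t. u t - v t)"
  unfolding locally_integrable_def by (auto intro!: set_integral_diff)

lemma locally_integrable_const: "locally_integrable (\<lambda>t. c)"
  by (intro continuous_locally_integrable continuous_intros)

section \<open>Test functions separate locally integrable functions\<close>

lemma integral_derivative_compact_support:
  assumes "\<And>t. (F has_vector_derivative f t) (at t)" "continuous_on UNIV f"
    "\<And>t. R < \<bar>t\<bar> \<Longrightarrow> F t = (0 :: complex)"
  shows "(LINT t|lebesgue. f t) = 0"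
proof -
  define S where "S = \<bar>R\<bar> + 1"
  have "f t = 0" if "R < \<bar>t\<bar>" for t using vderiv_eq_0[OF assms(1,3) that] .
  then have f: "f = (\<lambda>t. indicator {-S..S} t *\<^sub>R f t)"
    by (force simp: fun_eq_iff indicator_def S_def)
  have "(LINT t|lebesgue. f t) = (LINT t|lborel. f t)"
    by (rule integral_completion) (simp add: assms(2) borel_measurable_continuous_onI)
  also have "\<dots> = (LINT t|lborel. indicator {-S..S} t *\<^sub>R f t)" by (subst f) simp
  also have "\<dots> = F S - F (-S)"
    by (rule integral_FTC_atLeastAtMost)
       (use assms in \<open>auto simp: S_def intro: has_vector_derivative_at_within continuous_on_subset\<close>)
  also have "\<dots> = 0" using assms(3)[of S] assms(3)[of "-S"] by (simp add: S_def)
  finally show ?thesis .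
qed

lemma interval_bump_test_fun:
  assumes "0 < k"
  shows "test_fun (\<lambda>t. of_real (flat_exp 0 (k * (t - a)) * flat_exp 0 (k * (b - t))))"
  unfolding test_fun_iff
proof (intro conjI allI exI impI)
  fix n
  have "Ck n (\<lambda>t. of_real (flat_exp 0 (k * t + (- k * a))) * of_real (flat_exp 0 ((-k) * t + k * b)))"
    by (intro Ck_mult Ck_affine[OF Ck_flat_exp])
  then show "Ck n (\<lambda>t. of_real (flat_exp 0 (k * (t - a)) * flat_exp 0 (k * (b - t))))"
    by (simp add: algebra_simps)
next
  fix t assume "max \<bar>a\<bar> \<bar>b\<bar> < \<bar>t\<bar>"
  then have "t \<le> a \<or> b \<le> t" by auto
  then have "k * (t - a) \<le> 0 \<or> k * (b - t) \<le> 0"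
    using assms by (auto intro: mult_nonneg_nonpos)
  then show "complex_of_real (flat_exp 0 (k * (t - a)) * flat_exp 0 (k * (b - t))) = 0"
    by (auto simp: flat_exp_def)
qed

lemma flat_exp_le_1: "flat_exp 0 t \<le> 1"
  by (simp add: flat_exp_def)

lemma flat_exp_scale_tendsto:
  "(\<lambda>k. flat_exp 0 (real (Suc k) * s)) \<longlonglongrightarrow> (if 0 < s then 1 else 0)"
proof (cases "0 < s")
  case True
  have "(\<lambda>k. exp (- (inverse (real (Suc k)) * inverse s))) \<longlonglongrightarrow> exp (- (0 * inverse s))"
    by (intro tendsto_intros LIMSEQ_inverse_real_of_nat)
  moreover have "flat_exp 0 (real (Suc k) * s) = exp (- (inverse (real (Suc k)) * inverse s))" for k
    using True by (simp add: flat_exp_def divide_inverse del: of_nat_Suc)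
  ultimately show ?thesis using True by simp
next
  case False
  then have "real (Suc k) * s \<le> 0" for k by (intro mult_nonneg_nonpos) auto
  then have "flat_exp 0 (real (Suc k) * s) = 0" for k by (simp add: flat_exp_def not_less del: of_nat_Suc)
  with False show ?thesis by simp
qed

text \<open>The test functions \<open>flat_exp 0 (k (t - a)) * flat_exp 0 (k (b - t))\<close> tend to the indicator of \<open>(a, b)\<close>.\<close>

lemma orthogonal_test_funs_integral_interval:
  assumes g: "locally_integrable g"
    and orth: "\<And>\<psi>. test_fun \<psi> \<Longrightarrow> (LINT t|lebesgue. g t * \<psi> t) = 0"
  shows "(LINT t|lebesgue. g t * indicator {a<..<b} t) = 0"
proof -
  define \<psi> where "\<psi> k t = complex_of_real (flat_exp 0 (real (Suc k) * (t - a)) * flat_exp 0 (real (Suc k) * (b - t)))" for k t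
  have \<psi>: "test_fun (\<psi> k)" for k
    unfolding \<psi>_def by (rule interval_bump_test_fun) simp
  define R where "R = max \<bar>a\<bar> \<bar>b\<bar>"
  have nb: "norm (\<psi> k t) \<le> indicator {-R..R} t" for k t
  proof (cases "t \<in> {-R..R}")
    case True
    then show ?thesis unfolding \<psi>_def norm_of_real abs_mult
      by (auto intro!: mult_le_one simp: flat_exp_le_1 flat_exp_nonneg simp del: of_nat_Suc)
  next
    case False
    then have "t \<le> a \<or> b \<le> t" by (auto simp: R_def)
    then have "real (Suc k) * (t - a) \<le> 0 \<or> real (Suc k) * (b - t) \<le> 0"
      by (auto intro: mult_nonneg_nonpos simp del: of_nat_Suc)
    then show ?thesis by (auto simp: \<psi>_def flat_exp_def simp del: of_nat_Suc)
  qed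
  have "(\<lambda>k. LINT t|lebesgue. g t * \<psi> k t) \<longlonglongrightarrow> (LINT t|lebesgue. g t * indicator {a<..<b} t)"
  proof (rule integral_dominated_convergence)
    show "integrable lebesgue (\<lambda>t. norm (indicator {-R..R} t *\<^sub>R g t))"
      using g unfolding locally_integrable_def set_integrable_def by (intro integrable_norm) auto
    show "AE t in lebesgue. (\<lambda>k. g t * \<psi> k t) \<longlonglongrightarrow> g t * indicator {a<..<b} t"
    proof (intro AE_I2 tendsto_mult tendsto_const)
      fix t
      have "(\<lambda>k. flat_exp 0 (real (Suc k) * (t - a)) * flat_exp 0 (real (Suc k) * (b - t))) \<longlonglongrightarrow>
          (if 0 < t - a then 1 else 0) * (if 0 < b - t then 1 else 0)"
        by (intro tendsto_mult flat_exp_scale_tendsto)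
      from tendsto_of_real[OF this]
      have "(\<lambda>k. \<psi> k t) \<longlonglongrightarrow> of_real ((if 0 < t - a then 1 else 0) * (if 0 < b - t then 1 else 0))"
        unfolding \<psi>_def .
      also have "of_real ((if 0 < t - a then 1 else 0) * (if 0 < b - t then 1 else 0)) = (indicator {a<..<b} t :: complex)"
        by (auto simp: indicator_def)
      finally show "(\<lambda>k. \<psi> k t) \<longlonglongrightarrow> indicator {a<..<b} t" .
    qed
    show "AE t in lebesgue. norm (g t * \<psi> k t) \<le> norm (indicator {-R..R} t *\<^sub>R g t)" for k
    proof (rule AE_I2)
      fix t
      have "norm (g t) * norm (\<psi> k t) \<le> norm (g t) * indicator {-R..R} t"
        using nb by (intro mult_left_mono) auto
      then show "norm (g t * \<psi> k t) \<le> norm (indicator {-R..R} t *\<^sub>R g t)"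
        by (simp add: norm_mult mult.commute)
    qed
    show "(\<lambda>t. g t * \<psi> k t) \<in> borel_measurable lebesgue" for k
      using g test_fun_measurable[OF \<psi>] unfolding locally_integrable_def by auto
    show "(\<lambda>t. g t * indicator {a<..<b} t) \<in> borel_measurable lebesgue"
      using g unfolding locally_integrable_def by (intro borel_measurable_times borel_measurable_indicator) auto
  qed
  then have "(\<lambda>k. 0) \<longlonglongrightarrow> (LINT t|lebesgue. g t * indicator {a<..<b} t)"
    by (simp add: orth[OF \<psi>])
  then show ?thesis using LIMSEQ_unique tendsto_const by blast
qed

lemma sigma_finite_lebesgue: "sigma_finite_measure (lebesgue :: real measure)"
proof
  obtain A :: "real set set" where "countable A" "A \<subseteq> sets lborel" "\<Union>A = space lborel"
    "\<forall>a\<in>A. emeasure lborel a \<noteq> \<infinity>"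
    using lborel.sigma_finite_countable by blast
  then show "\<exists>A. countable A \<and> A \<subseteq> sets lebesgue \<and> \<Union>A = space (lebesgue :: real measure) \<and>
      (\<forall>a\<in>A. emeasure lebesgue a \<noteq> \<infinity>)"
    by (intro exI[of _ A]) (auto simp: emeasure_completion)
qed

text \<open>Open intervals form an intersection-stable generator of the Borel sets, so vanishing
  integrals spread to all Borel sets by Dynkin's argument; the hypothesis \<open>zero\<close>
  handles complements. An integrable function with zero integral over every measurable set vanishes
  almost everywhere.\<close>

lemma integrable_zero_on_intervals_AE_zero:
  fixes f :: "real \<Rightarrow> complex"
  assumes f: "integrable lebesgue f" and zero: "(LINT t|lebesgue. f t) = 0"
    and intervals: "\<And>a b. (LINT t:{a<..<b}|lebesgue. f t) = 0"
  shows "AE t in lebesgue. f t = 0"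
proof (rule sigma_finite_measure.density_zero[OF sigma_finite_lebesgue f])
  have si: "set_integrable lebesgue A f" if "A \<in> sets borel" for A
    unfolding set_integrable_def using that by (intro integrable_mult_indicator f) auto
  have borel: "(LINT t:A|lebesgue. f t) = 0" if "A \<in> sets borel" for A
  proof -
    have gen: "sets borel = sigma_sets UNIV (range (\<lambda>(a, b). {a<..<b :: real}))"
      by (subst borel_eq_box) (simp add: sets_measure_of case_prod_unfold)
    have "Int_stable (range (\<lambda>(a, b). {a<..<b :: real}))"
    proof (rule Int_stableI)
      fix A B assume "A \<in> range (\<lambda>(a, b). {a<..<b :: real})" "B \<in> range (\<lambda>(a, b). {a<..<b :: real})"
      then obtain a b c d where AB: "A = {a<..<b}" "B = {c<..<d}" by auto
      have "A \<inter> B = (\<lambda>(a, b). {a<..<b}) (max a c, min b d)" unfolding AB by auto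
      then show "A \<inter> B \<in> range (\<lambda>(a, b). {a<..<b})" by (simp only: rangeI)
    qed
    moreover have "range (\<lambda>(a, b). {a<..<b :: real}) \<subseteq> Pow UNIV" by simp
    moreover have "A \<in> sigma_sets UNIV (range (\<lambda>(a, b). {a<..<b :: real}))" using that by (simp only: gen)
    ultimately show ?thesis
    proof (induction A rule: sigma_sets_induct_disjoint)
      case (compl A)
      then have A: "A \<in> sets borel" by (simp add: gen)
      have "(LINT t:A \<union> (UNIV - A)|lebesgue. f t) = (LINT t:A|lebesgue. f t) + (LINT t:UNIV - A|lebesgue. f t)"
        using A by (intro set_integral_Un si) auto
      with compl zero show ?case by (simp add: set_lebesgue_integral_def)
    next
      case (union A)
      then have A: "A i \<in> sets borel" for i by (auto simp: gen)
      have "(LINT t:(\<Union>i. A i)|lebesgue. f t) = (\<Sum>i. LINT t:A i|lebesgue. f t)"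
        using A union(1) by (intro lebesgue_integral_countable_add si) (auto simp: disjoint_family_on_def)
      with union show ?case by simp
    qed (use intervals in \<open>auto simp: set_lebesgue_integral_def\<close>)
  qed
  fix A :: "real set" assume A: "A \<in> sets lebesgue"
  \<comment> \<open>A Lebesgue set differs from its Borel main part by a null set, so the Borel case
    is enough.\<close>
  have M: "main_part lborel A \<in> sets lborel" using A by (rule main_part_sets)
  have "(LINT t:A|lebesgue. f t) = (LINT t:main_part lborel A|lebesgue. f t)"
  proof (rule set_integral_cong_set)
    show "AE t in lebesgue. (t \<in> main_part lborel A) = (t \<in> A)"
      using AE_completion[OF AE_in_main_part[OF A]] .
  qed (unfold set_borel_measurable_def,
      intro borel_measurable_scaleR borel_measurable_indicator borel_measurable_integrable[OF f]
        sets_completionI_sets M,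
      intro borel_measurable_scaleR borel_measurable_indicator borel_measurable_integrable[OF f] A)
  with borel[of "main_part lborel A"] M show "(LINT t:A|lebesgue. f t) = 0" by simp
qed

text \<open>The function \<open>g\<close> is only locally integrable, so it is truncated to
  \<open>(-n, n)\<close>; there the interval lemma applies, and countably many null sets are
  collected.\<close>

lemma orthogonal_test_funs_AE_zero:
  assumes g: "locally_integrable g"
    and orth: "\<And>\<psi>. test_fun \<psi> \<Longrightarrow> (LINT t|lebesgue. g t * \<psi> t) = 0"
  shows "AE t in lebesgue. g t = 0"
proof -
  have "AE t in lebesgue. g t * indicator {- real n<..<real n} t = 0" for n
  proof (rule integrable_zero_on_intervals_AE_zero)
    show "integrable lebesgue (\<lambda>t. g t * indicator {- real n<..<real n} t)"
      by (rule locally_integrable_mult[OF g borel_measurable_indicator, where B = 1 and R = n])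
         (auto simp: indicator_def)
    show "(LINT t|lebesgue. g t * indicator {- real n<..<real n} t) = 0"
      by (rule orthogonal_test_funs_integral_interval[OF assms])
    fix a b
    have "(LINT t:{a<..<b}|lebesgue. g t * indicator {- real n<..<real n} t) =
          (LINT t|lebesgue. g t * indicator {max a (- real n)<..<min b (real n)} t)"
      unfolding set_lebesgue_integral_def by (intro Bochner_Integration.integral_cong) (auto simp: indicator_def)
    then show "(LINT t:{a<..<b}|lebesgue. g t * indicator {- real n<..<real n} t) = 0"
      using orthogonal_test_funs_integral_interval[OF assms] by simp
  qed
  then have "AE t in lebesgue. \<forall>n. g t * indicator {- real n<..<real n} t = 0"
    by (simp only: AE_all_countable) blast
  then show ?thesis
  proof (rule AE_mp, intro AE_I2 impI)
    fix t assume *: "\<forall>n. g t * indicator {- real n<..<real n} t = 0"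
    obtain n :: nat where "\<bar>t\<bar> < real n" using reals_Archimedean2 by blast
    then have "t \<in> {- real n<..<real n}" by auto
    with *[rule_format, of n] show "g t = 0" by simp
  qed
qed

section \<open>Calculus of weak derivatives\<close>

lemma weak_deriv_iff:
  "weak_deriv u v \<longleftrightarrow> L2 v \<and>
    (\<forall>\<psi>. test_fun \<psi> \<longrightarrow> - (LINT t|lebesgue. u t * vderiv \<psi> t) = (LINT t|lebesgue. v t * \<psi> t))"
  by (simp add: weak_deriv_def dist_eq_def dist_deriv_def dist_of_fun_def)

lemma weak_deriv_unique:
  assumes "weak_deriv u v" "weak_deriv u w"
  shows "AE t in lebesgue. v t = w t"
proof -
  have vw: "L2 v" "L2 w" using assms by (auto simp: weak_deriv_iff)
  have "AE t in lebesgue. v t - w t = 0"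
  proof (rule orthogonal_test_funs_AE_zero)
    show "locally_integrable (\<lambda>t. v t - w t)" by (intro L2_locally_integrable L2_diff vw)
    fix \<psi> assume \<psi>: "test_fun \<psi>"
    have "(LINT t|lebesgue. v t * \<psi> t) = (LINT t|lebesgue. w t * \<psi> t)"
      using assms \<psi> unfolding weak_deriv_iff by metis
    then show "(LINT t|lebesgue. (v t - w t) * \<psi> t) = 0"
      using L2_mult_integrable[OF vw(1) L2_test_fun[OF \<psi>]] L2_mult_integrable[OF vw(2) L2_test_fun[OF \<psi>]]
      by (simp add: left_diff_distrib)
  qed
  then show ?thesis by simp
qed

text \<open>Weak derivatives agree almost everywhere, so the one chosen by \<open>SOME\<close> in
  the norm may be replaced by any other. All later norm computations start from here.\<close>

lemma norm_W12_eq: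
  assumes "weak_deriv u v"
  shows "norm_W12 u = sqrt ((norm_L2 u)\<^sup>2 + (norm_L2 v)\<^sup>2)"
proof -
  have w: "weak_deriv u (SOME v. weak_deriv u v)" (is "weak_deriv u ?w")
    using someI[of "weak_deriv u", OF assms] by simp
  have "(LINT t|lebesgue. (norm (?w t))\<^sup>2) = (LINT t|lebesgue. (norm (v t))\<^sup>2)"
  proof (rule integral_cong_AE)
    show "AE t in lebesgue. (norm (?w t))\<^sup>2 = (norm (v t))\<^sup>2"
      using weak_deriv_unique[OF w assms] by auto
  qed (use w assms L2_integrable in \<open>auto simp: weak_deriv_iff intro: borel_measurable_integrable\<close>)
  then show ?thesis by (simp add: norm_W12_def norm_L2_power2)
qed

lemma norm_W12_le:
  assumes "weak_deriv u v" shows "norm_W12 u \<le> norm_L2 u + norm_L2 v"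
  unfolding norm_W12_eq[OF assms] by (rule sqrt_sum_squares_le_sum) auto

lemma norm_L2_le_norm_W12:
  assumes "weak_deriv u v" shows "norm_L2 u \<le> norm_W12 u" "norm_L2 v \<le> norm_W12 u"
  unfolding norm_W12_eq[OF assms] by (auto intro: real_le_rsqrt)

lemma weak_deriv_L2: "weak_deriv u v \<Longrightarrow> L2 v"
  by (simp add: weak_deriv_iff)

lemma weak_deriv_add:
  assumes u: "locally_integrable u" "weak_deriv u v" and u': "locally_integrable u'" "weak_deriv u' v'"
  shows "weak_deriv (\<lambda>t. u t + u' t) (\<lambda>t. v t + v' t)"
  unfolding weak_deriv_iff
proof (intro conjI allI impI)
  show "L2 (\<lambda>t. v t + v' t)" using assms by (auto simp: weak_deriv_iff intro: L2_add)
  fix \<psi> assume \<psi>: "test_fun \<psi>"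
  have "L2 v" "L2 v'" using assms by (auto simp: weak_deriv_iff)
  then have "(LINT t|lebesgue. (v t + v' t) * \<psi> t) = (LINT t|lebesgue. v t * \<psi> t) + (LINT t|lebesgue. v' t * \<psi> t)"
    using L2_mult_integrable[OF _ L2_test_fun[OF \<psi>]] by (simp add: distrib_right)
  moreover have "(LINT t|lebesgue. (u t + u' t) * vderiv \<psi> t) =
      (LINT t|lebesgue. u t * vderiv \<psi> t) + (LINT t|lebesgue. u' t * vderiv \<psi> t)"
    using locally_integrable_test[OF u(1) test_fun_vderiv[OF \<psi>]]
      locally_integrable_test[OF u'(1) test_fun_vderiv[OF \<psi>]] by (simp add: distrib_right)
  moreover have "- (LINT t|lebesgue. u t * vderiv \<psi> t) = (LINT t|lebesgue. v t * \<psi> t)"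
    "- (LINT t|lebesgue. u' t * vderiv \<psi> t) = (LINT t|lebesgue. v' t * \<psi> t)"
    using u(2) u'(2) \<psi> unfolding weak_deriv_iff by blast+
  ultimately show "- (LINT t|lebesgue. (u t + u' t) * vderiv \<psi> t) = (LINT t|lebesgue. (v t + v' t) * \<psi> t)"
    by (simp only: minus_add_distrib)
qed

lemma weak_deriv_cmult:
  assumes "weak_deriv u v" shows "weak_deriv (\<lambda>t. c * u t) (\<lambda>t. c * v t)"
  unfolding weak_deriv_iff
proof (intro conjI allI impI)
  show "L2 (\<lambda>t. c * v t)" using assms by (simp add: weak_deriv_iff L2_cmult)
  fix \<psi> assume "test_fun \<psi>"
  then have "- (LINT t|lebesgue. u t * vderiv \<psi> t) = (LINT t|lebesgue. v t * \<psi> t)"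
    using assms by (simp add: weak_deriv_iff)
  from arg_cong[OF this, of "(*) c"]
  show "- (LINT t|lebesgue. c * u t * vderiv \<psi> t) = (LINT t|lebesgue. c * v t * \<psi> t)"
    by (simp add: mult.assoc)
qed

text \<open>One continuous derivative is enough for integration by parts; this generality is needed
  for products with \<open>phi_n\<close>, which are not test functions.\<close>

lemma weak_deriv_classical:
  assumes u: "\<And>t. (u has_vector_derivative u' t) (at t)" "continuous_on UNIV u'"
    and supp: "\<And>t. R < \<bar>t\<bar> \<Longrightarrow> u t = 0"
  shows "weak_deriv u u'" "W12 u"
proof -
  have cont: "continuous_on UNIV u"
    by (meson continuous_at_imp_continuous_on has_vector_derivative_continuous u(1))
  have L2: "L2 u" "L2 u'"
    using L2_continuous_support[OF cont supp] L2_continuous_support[OF u(2) vderiv_eq_0[OF u(1) supp]]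
    by auto
  show "weak_deriv u u'"
    unfolding weak_deriv_iff
  proof (intro conjI allI impI L2)
    fix \<psi> assume \<psi>: "test_fun \<psi>"
    note d\<psi> = test_fun_vderiv[OF \<psi>]
    have "(LINT t|lebesgue. u t * vderiv \<psi> t + u' t * \<psi> t) = 0"
    proof (rule integral_derivative_compact_support)
      show "((\<lambda>t. u t * \<psi> t) has_vector_derivative u t * vderiv \<psi> t + u' t * \<psi> t) (at t)" for t
        by (intro has_vector_derivative_mult u test_fun_has_derivative \<psi>)
      show "continuous_on UNIV (\<lambda>t. u t * vderiv \<psi> t + u' t * \<psi> t)"
        by (intro continuous_intros cont u test_fun_continuous \<psi> d\<psi>)
      show "u t * \<psi> t = 0" if "R < \<bar>t\<bar>" for t using supp[OF that] by simp
    qed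
    then show "- (LINT t|lebesgue. u t * vderiv \<psi> t) = (LINT t|lebesgue. u' t * \<psi> t)"
      using L2_mult_integrable[OF L2(1) L2_test_fun[OF d\<psi>]] L2_mult_integrable[OF L2(2) L2_test_fun[OF \<psi>]]
      by (simp add: minus_unique)
  qed
  then show "W12 u" using L2(1) by (auto simp: W12_def)
qed

lemma weak_deriv_test_fun:
  assumes "test_fun \<psi>" shows "weak_deriv \<psi> (vderiv \<psi>)" "W12 \<psi>"
proof -
  obtain R where "\<And>t. R < \<bar>t\<bar> \<Longrightarrow> \<psi> t = 0" using test_fun_bounded_support[OF assms] by blast
  note * = test_fun_has_derivative[OF assms] test_fun_continuous[OF test_fun_vderiv[OF assms]] this
  show "weak_deriv \<psi> (vderiv \<psi>)" by (rule weak_deriv_classical(1)[where R = R]) (fact *)+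
  show "W12 \<psi>" by (rule weak_deriv_classical(2)[where R = R and u' = "vderiv \<psi>"]) (fact *)+
qed

text \<open>Local integrability is the right assumption on \<open>u\<close> because the lemma is
  applied to primitives, which need not be square integrable on the line; the part of the product
  rule containing \<open>u\<close> is put in \<open>L2\<close> by a separate hypothesis.\<close>

lemma weak_deriv_mult_test_fun:
  assumes u: "locally_integrable u" "weak_deriv u v" and \<eta>: "test_fun \<eta>"
    and L2: "L2 (\<lambda>t. vderiv \<eta> t * u t)"
  shows "weak_deriv (\<lambda>t. \<eta> t * u t) (\<lambda>t. vderiv \<eta> t * u t + \<eta> t * v t)"
  unfolding weak_deriv_iff
proof (intro conjI allI impI)
  have v: "L2 v" using u(2) by (simp add: weak_deriv_iff)
  obtain B where B: "\<And>t. norm (\<eta> t) \<le> B" using test_fun_bounded[OF \<eta>] by blast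
  have "L2 (\<lambda>t. \<eta> t * v t)"
  proof (rule L2_dominated(1)[OF v])
    show "(\<lambda>t. \<eta> t * v t) \<in> borel_measurable lebesgue"
      by (intro borel_measurable_times test_fun_measurable[OF \<eta>] L2_measurable[OF v])
    show "norm (\<eta> t * v t) \<le> B * norm (v t)" for t
      using B by (simp add: norm_mult mult_right_mono)
  qed
  with L2 show "L2 (\<lambda>t. vderiv \<eta> t * u t + \<eta> t * v t)" by (rule L2_add)
  fix \<psi> assume \<psi>: "test_fun \<psi>"
  note t1 = test_fun_mult[OF \<eta> \<psi>] and t2 = test_fun_mult[OF \<eta> test_fun_vderiv[OF \<psi>]]
    and t3 = test_fun_mult[OF test_fun_vderiv[OF \<eta>] \<psi>]
  have "- (LINT t|lebesgue. u t * (\<eta> t * vderiv \<psi> t + vderiv \<eta> t * \<psi> t)) = (LINT t|lebesgue. v t * (\<eta> t * \<psi> t))"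
  proof -
    have "- (LINT t|lebesgue. u t * vderiv (\<lambda>t. \<eta> t * \<psi> t) t) = (LINT t|lebesgue. v t * (\<eta> t * \<psi> t))"
      using u(2) t1 unfolding weak_deriv_iff by simp
    then show ?thesis by (simp only: vderiv_mult[OF \<eta> \<psi>])
  qed
  then have "- (LINT t|lebesgue. u t * (\<eta> t * vderiv \<psi> t)) - (LINT t|lebesgue. u t * (vderiv \<eta> t * \<psi> t))
     = (LINT t|lebesgue. v t * (\<eta> t * \<psi> t))"
    using locally_integrable_test[OF u(1) t2] locally_integrable_test[OF u(1) t3]
    by (simp add: distrib_left)
  then have "- (LINT t|lebesgue. u t * (\<eta> t * vderiv \<psi> t)) =
     (LINT t|lebesgue. u t * (vderiv \<eta> t * \<psi> t)) + (LINT t|lebesgue. v t * (\<eta> t * \<psi> t))"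
    by (simp add: diff_eq_eq add.commute)
  also have "\<dots> = (LINT t|lebesgue. u t * (vderiv \<eta> t * \<psi> t) + v t * (\<eta> t * \<psi> t))"
    using locally_integrable_test[OF u(1) t3] L2_mult_integrable[OF v L2_test_fun[OF t1]] by simp
  also have "\<dots> = (LINT t|lebesgue. (vderiv \<eta> t * u t + \<eta> t * v t) * \<psi> t)"
    by (rule arg_cong[where f = "integral\<^sup>L lebesgue"]) (simp add: fun_eq_iff algebra_simps)
  also have "(LINT t|lebesgue. u t * (\<eta> t * vderiv \<psi> t)) = (LINT t|lebesgue. \<eta> t * u t * vderiv \<psi> t)"
    by (rule arg_cong[where f = "integral\<^sup>L lebesgue"]) (simp add: fun_eq_iff algebra_simps)
  finally show "- (LINT t|lebesgue. \<eta> t * u t * vderiv \<psi> t) =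
      (LINT t|lebesgue. (vderiv \<eta> t * u t + \<eta> t * v t) * \<psi> t)" .
qed


section \<open>Primitives of square integrable functions\<close>

text \<open>The signed indicator of the interval between \<open>c\<close> and \<open>t\<close>.
  Half-open intervals make \<open>kern_diff\<close> hold at every point, so differences of
  primitives are primitives without exceptional null sets.\<close>

definition kern :: "real \<Rightarrow> real \<Rightarrow> real \<Rightarrow> complex" where
  "kern c t s = (if c < s \<and> s \<le> t then 1 else if t < s \<and> s \<le> c then -1 else 0)"

text \<open>\<open>prim c h t\<close> is the integral of \<open>h\<close> from \<open>c\<close> to \<open>t\<close>; the kernel supplies the sign.\<close>

definition prim :: "real \<Rightarrow> (real \<Rightarrow> complex) \<Rightarrow> real \<Rightarrow> complex" where
  "prim c h t = (LINT s|lebesgue. kern c t s * h s)"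

lemma norm_kern: "norm (kern c t s) = indicator {min c t<..max c t} s"
  by (auto simp: kern_def indicator_def)

lemma kern_diff: "kern c t s - kern c t' s = kern t' t s"
  by (auto simp: kern_def)

lemma kern_measurable [measurable]: "kern c t \<in> borel_measurable lebesgue"
proof -
  have "kern c t = (\<lambda>s. indicator {c<..t} s - indicator {t<..c} s)"
    by (auto simp: kern_def indicator_def fun_eq_iff)
  moreover have "\<dots> \<in> borel_measurable lebesgue"
    by (intro borel_measurable_diff borel_measurable_indicator) auto
  ultimately show ?thesis by simp
qed

lemma kern_measurable' [measurable]: "(\<lambda>t. kern c t s) \<in> borel_measurable lebesgue"
proof -
  have "(\<lambda>t. kern c t s) = (\<lambda>t. if c < s then indicator {s..} t else - indicator {..<s} t)"
    by (auto simp: kern_def indicator_def fun_eq_iff)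
  moreover have "\<dots> \<in> borel_measurable lebesgue"
    by (cases "c < s") (simp_all add: borel_measurable_indicator borel_measurable_uminus)
  ultimately show ?thesis by simp
qed

lemma L2_kern: "L2 (kern c t)" and norm_L2_kern: "norm_L2 (kern c t) = sqrt \<bar>t - c\<bar>"
proof -
  have "(\<lambda>s. (norm (kern c t s))\<^sup>2) = indicator {min c t<..max c t}"
    by (auto simp: norm_kern indicator_def)
  moreover have "has_bochner_integral lebesgue (indicator {min c t<..max c t} :: real \<Rightarrow> real) (measure lebesgue {min c t<..max c t})"
    by (rule has_bochner_integral_real_indicator) (auto simp: emeasure_lborel_Ioc)
  moreover have "measure lebesgue {min c t<..max c t} = \<bar>t - c\<bar>" by (simp add: measure_lborel_Ioc)
  ultimately have *: "has_bochner_integral lebesgue (\<lambda>s. (norm (kern c t s))\<^sup>2) \<bar>t - c\<bar>" by simp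
  then show "L2 (kern c t)" by (simp add: L2_def has_bochner_integral_iff)
  from * show "norm_L2 (kern c t) = sqrt \<bar>t - c\<bar>"
    by (simp add: norm_L2_def has_bochner_integral_iff)
qed

lemma norm_prim_le: "L2 h \<Longrightarrow> norm (prim c h t) \<le> sqrt \<bar>t - c\<bar> * norm_L2 h"
  using L2_Cauchy_Schwarz[OF L2_kern, of h c t] by (simp add: prim_def norm_L2_kern)

lemma prim_add: "L2 h \<Longrightarrow> L2 k \<Longrightarrow> prim c (\<lambda>t. h t + k t) t = prim c h t + prim c k t"
  by (simp add: prim_def distrib_left L2_mult_integrable[OF L2_kern])

lemma prim_cmult: "prim c (\<lambda>t. a * h t) t = a * prim c h t"
  by (simp add: prim_def mult.left_commute)

lemma prim_diff: "L2 h \<Longrightarrow> prim c h t - prim c h t' = prim t' h t"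
  by (simp add: prim_def L2_mult_integrable[OF L2_kern] left_diff_distrib
      flip: kern_diff[of c t _ t'])

text \<open>The difference of two values is a primitive over the interval between them, and
  Cauchy-Schwarz gives Hoelder continuity with exponent 1/2.\<close>

lemma continuous_prim:
  assumes "L2 h" shows "continuous_on UNIV (prim c h)"
  unfolding continuous_on_def
proof
  fix t :: real
  show "(prim c h \<longlongrightarrow> prim c h t) (at t within UNIV)"
  proof (rule LIM_zero_cancel, rule Lim_null_comparison, rule always_eventually, rule allI)
    show "norm (prim c h s - prim c h t) \<le> sqrt \<bar>s - t\<bar> * norm_L2 h" for s
      using prim_diff[OF assms] norm_prim_le[OF assms] by metis
    have "((\<lambda>s. sqrt \<bar>s - t\<bar> * norm_L2 h) \<longlongrightarrow> sqrt \<bar>t - t\<bar> * norm_L2 h) (at t)"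
      by (intro tendsto_intros)
    then show "((\<lambda>s. sqrt \<bar>s - t\<bar> * norm_L2 h) \<longlongrightarrow> 0) (at t)" by simp
  qed
qed

lemma prim_vderiv:
  assumes "test_fun \<psi>" shows "prim c (vderiv \<psi>) t = \<psi> t - \<psi> c"
proof -
  have le: "prim a (vderiv \<psi>) b = \<psi> b - \<psi> a" if "a \<le> b" for a b
  proof -
    \<comment> \<open>The kernel lives on the half-open interval, the fundamental theorem on the
      closed one; they differ only at \<open>a\<close>.\<close>
    have "AE s in lborel. s \<noteq> a" by (rule AE_lborel_singleton)
    then have "prim a (vderiv \<psi>) b = (LINT s|lebesgue. indicator {a..b} s *\<^sub>R vderiv \<psi> s)"
      unfolding prim_def
    proof (intro integral_cong_AE borel_measurable_times borel_measurable_scaleR kern_measurable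
        borel_measurable_indicator test_fun_measurable test_fun_vderiv assms)
      assume "AE s in lborel. s \<noteq> a"
      then show "AE s in lebesgue. kern a b s * vderiv \<psi> s = indicator {a..b} s *\<^sub>R vderiv \<psi> s"
        using that by (intro AE_completion) (auto elim!: AE_mp simp: kern_def indicator_def)
    qed auto
    also have "\<dots> = (LINT s|lborel. indicator {a..b} s *\<^sub>R vderiv \<psi> s)"
      by (intro integral_completion borel_measurable_scaleR borel_measurable_indicator)
         (auto intro: borel_measurable_continuous_onI test_fun_continuous test_fun_vderiv assms)
    also have "\<dots> = \<psi> b - \<psi> a"
      by (rule integral_FTC_atLeastAtMost)
         (use that in \<open>auto intro: has_vector_derivative_at_within test_fun_has_derivative[OF assms]
            continuous_on_subset[OF test_fun_continuous[OF test_fun_vderiv[OF assms]]]\<close>)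
    finally show ?thesis .
  qed
  show ?thesis
  proof (cases "c \<le> t")
    case False
    have "kern t t s = 0" for s by (simp add: kern_def)
    then have "prim t (vderiv \<psi>) t = 0" by (simp add: prim_def)
    with le[of t c] False prim_diff[OF L2_test_fun[OF test_fun_vderiv[OF assms]], of t t c] show ?thesis
      by simp
  qed (rule le)
qed

text \<open>Fubini: in the double integral of \<open>kern c t s * h s * vderiv \<psi> t\<close>,
  integrating over \<open>s\<close> first gives the primitive, and integrating over \<open>t\<close>
  first gives \<open>- h s * \<psi> s\<close>.\<close>

lemma weak_deriv_prim:
  assumes h: "L2 h" shows "weak_deriv (prim c h) h"
  unfolding weak_deriv_iff
proof (intro conjI allI impI h)
  fix \<psi> assume \<psi>: "test_fun \<psi>"
  note d\<psi> = test_fun_vderiv[OF \<psi>]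
  note [measurable] = L2_measurable[OF h] test_fun_measurable[OF d\<psi>]
  interpret pair_sigma_finite "lebesgue :: real measure" "lebesgue :: real measure"
    using sigma_finite_lebesgue by (simp add: pair_sigma_finite_def)
  define f where "f = (\<lambda>(t, s). kern c t s * h s * vderiv \<psi> t)"
  have id: "(\<lambda>t::real. t) \<in> borel_measurable lebesgue"
    by (intro continuous_imp_lebesgue_measurable continuous_intros)
  have [measurable]: "(\<lambda>p. fst p) \<in> borel_measurable ((lebesgue :: real measure) \<Otimes>\<^sub>M (lebesgue :: real measure))"
    by (rule measurable_compose[OF measurable_fst id])
  have [measurable]: "(\<lambda>p. snd p) \<in> borel_measurable ((lebesgue :: real measure) \<Otimes>\<^sub>M (lebesgue :: real measure))"
    by (rule measurable_compose[OF measurable_snd id])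
  have [measurable]: "(\<lambda>p. kern c (fst p) (snd p)) \<in> borel_measurable (lebesgue \<Otimes>\<^sub>M lebesgue)"
    unfolding kern_def by measurable
  have meas: "f \<in> borel_measurable (lebesgue \<Otimes>\<^sub>M lebesgue)"
    unfolding f_def case_prod_unfold
    by (intro borel_measurable_times measurable_compose[OF measurable_fst test_fun_measurable[OF d\<psi>]]
        measurable_compose[OF measurable_snd L2_measurable[OF h]]) measurable
  obtain R where "R > 0" and R0: "\<And>t. R < \<bar>t\<bar> \<Longrightarrow> \<psi> t = 0" using test_fun_bounded_support[OF \<psi>] by blast
  then have R: "R > 0" "\<And>t. R < \<bar>t\<bar> \<Longrightarrow> vderiv \<psi> t = 0"
    using vderiv_eq_0[OF test_fun_has_derivative[OF \<psi>]] by blast+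
  obtain B where B: "B > 0" "\<And>t. norm (vderiv \<psi> t) \<le> B" using test_fun_bounded[OF d\<psi>] by blast
  have "integrable (lebesgue \<Otimes>\<^sub>M lebesgue) f"
  proof (rule Fubini_integrable[OF meas])
    show "AE t in lebesgue. integrable lebesgue (\<lambda>s. f (t, s))"
      using L2_mult_integrable[OF L2_kern h] by (simp add: f_def)
    have "integrable lebesgue (\<lambda>t. indicator {-R..R} t * (sqrt (R + \<bar>c\<bar>) * norm_L2 h * B))"
      by (intro integrable_mult_left integrable_real_indicator) (auto simp: emeasure_lborel_Icc_eq)
    then show "integrable lebesgue (\<lambda>t. LINT s|lebesgue. norm (f (t, s)))"
    proof (rule Bochner_Integration.integrable_bound)
      have "(\<lambda>p. norm (f p)) \<in> borel_measurable (lebesgue \<Otimes>\<^sub>M lebesgue)" using meas by measurable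
      then show "(\<lambda>t. LINT s|lebesgue. norm (f (t, s))) \<in> borel_measurable lebesgue"
        by (intro sigma_finite_measure.borel_measurable_lebesgue_integral[OF sigma_finite_lebesgue])
           (simp add: case_prod_unfold)
      show "AE t in lebesgue. norm (LINT s|lebesgue. norm (f (t, s))) \<le>
          norm (indicator {-R..R} t * (sqrt (R + \<bar>c\<bar>) * norm_L2 h * B))"
      proof (rule AE_I2)
        fix t
        have "(LINT s|lebesgue. norm (f (t, s))) = (LINT s|lebesgue. norm (kern c t s) * norm (h s)) * norm (vderiv \<psi> t)"
          by (simp add: f_def norm_mult)
        also have "\<dots> \<le> indicator {-R..R} t * (sqrt (R + \<bar>c\<bar>) * norm_L2 h * B)"
        proof (cases "R < \<bar>t\<bar>")
          case False
          have "(LINT s|lebesgue. norm (kern c t s) * norm (h s)) \<le> sqrt \<bar>t - c\<bar> * norm_L2 h"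
            using L2_Cauchy_Schwarz_norm[OF L2_kern h] by (simp add: norm_L2_kern)
          also have "\<dots> \<le> sqrt (R + \<bar>c\<bar>) * norm_L2 h"
            using False by (intro mult_right_mono real_sqrt_le_mono) auto
          finally have "(LINT s|lebesgue. norm (kern c t s) * norm (h s)) * norm (vderiv \<psi> t)
              \<le> (sqrt (R + \<bar>c\<bar>) * norm_L2 h) * B"
            using B R(1) by (intro mult_mono) auto
          then show ?thesis using False by (auto simp: indicator_def)
        qed (use R in \<open>auto simp: indicator_def\<close>)
        finally show "norm (LINT s|lebesgue. norm (f (t, s))) \<le>
          norm (indicator {-R..R} t * (sqrt (R + \<bar>c\<bar>) * norm_L2 h * B))"
          by (simp add: abs_of_nonneg)
      qed
    qed
  qed
  then have "(LINT s|lebesgue. LINT t|lebesgue. f (t, s)) = (LINT t|lebesgue. LINT s|lebesgue. f (t, s))"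
    using Fubini_integral[of "\<lambda>t s. f (t, s)"] by (simp add: case_prod_unfold)
  moreover have "(LINT s|lebesgue. f (t, s)) = prim c h t * vderiv \<psi> t" for t
    by (simp add: f_def prim_def)
  moreover have "(LINT t|lebesgue. f (t, s)) = - h s * \<psi> s" for s
  proof -
    \<comment> \<open>A point beyond the support of \<open>\<psi>\<close> on either side. As a
      function of \<open>t\<close>, the kernel is 1 on the half-line from \<open>s\<close> upwards
      if \<open>c < s\<close>, and -1 below \<open>s\<close> otherwise; in both cases integrating
      the derivative leaves \<open>- \<psi> s\<close>.\<close>
    define S where "S = R + \<bar>s\<bar> + 1"
    have S: "\<psi> S = 0" "\<psi> (- S) = 0" using R(1) by (auto intro!: R0 simp: S_def)
    have ae: "AE t in lebesgue. t \<noteq> s" by (intro AE_completion AE_lborel_singleton)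
    have "(LINT t|lebesgue. kern c t s * vderiv \<psi> t) = - \<psi> s"
    proof (cases "c < s")
      case True
      have "kern c t s * vderiv \<psi> t = kern s S t * vderiv \<psi> t" if "t \<noteq> s" for t
        using True that R(2)[of t] by (cases "R < \<bar>t\<bar>") (auto simp: kern_def S_def)
      then have "(LINT t|lebesgue. kern c t s * vderiv \<psi> t) = prim s (vderiv \<psi>) S"
        unfolding prim_def using ae by (intro integral_cong_AE) (auto elim!: AE_mp)
      then show ?thesis using S by (simp add: prim_vderiv[OF \<psi>])
    next
      case False
      have "kern c t s * vderiv \<psi> t = - kern (-S) s t * vderiv \<psi> t" if "t \<noteq> s" for t
        using False that R(2)[of t] by (cases "R < \<bar>t\<bar>") (auto simp: kern_def S_def)
      then have "(LINT t|lebesgue. kern c t s * vderiv \<psi> t) = (LINT t|lebesgue. - (kern (-S) s t * vderiv \<psi> t))"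
        using ae by (intro integral_cong_AE) (auto elim!: AE_mp)
      then show ?thesis using S prim_vderiv[OF \<psi>, of "-S" s] by (simp add: prim_def)
    qed
    moreover have "(LINT t|lebesgue. f (t, s)) = h s * (LINT t|lebesgue. kern c t s * vderiv \<psi> t)"
      by (simp add: f_def mult.assoc mult.left_commute[of _ "h s"])
    ultimately show ?thesis by simp
  qed
  ultimately have "- (LINT t|lebesgue. h t * \<psi> t) = (LINT t|lebesgue. prim c h t * vderiv \<psi> t)"
    by simp
  from this[symmetric] show "- (LINT t|lebesgue. prim c h t * vderiv \<psi> t) = (LINT t|lebesgue. h t * \<psi> t)"
    by simp
qed

lemma test_fun_antiderivative:
  assumes \<psi>: "test_fun \<psi>" and zero: "(LINT t|lebesgue. \<psi> t) = 0"
  obtains \<Psi> where "test_fun \<Psi>" "vderiv \<Psi> = \<psi>"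
proof -
  obtain R where R: "R > 0" "\<And>t. R < \<bar>t\<bar> \<Longrightarrow> \<psi> t = 0" using test_fun_bounded_support[OF \<psi>] by blast
  \<comment> \<open>Starting one unit to the left of the support keeps every
    \<open>t \<ge> - R\<close> in the interior of the integration range, where a two-sided
    derivative is available. To the right of the support the zero mean makes the integral
    vanish.\<close>
  define \<Psi> where "\<Psi> t = integral {- R - 1..t} \<psi>" for t
  have left: "\<Psi> t = 0" if "t < - R" for t
  proof -
    have "\<Psi> t = integral {- R - 1..t} (\<lambda>_. 0)"
      unfolding \<Psi>_def using R that by (intro integral_cong) auto
    then show ?thesis by simp
  qed
  have right: "\<Psi> t = 0" if "R < t" for t
  proof -
    have eq: "(\<lambda>s. indicator {- R - 1..t} s *\<^sub>R \<psi> s) = \<psi>"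
      using R that by (force simp: indicator_def fun_eq_iff)
    have "integrable lebesgue \<psi>"
      using locally_integrable_test[OF locally_integrable_const[of 1] \<psi>] by simp
    then have "set_integrable lebesgue {- R - 1..t} \<psi>" by (simp add: set_integrable_def eq)
    from set_lebesgue_integral_eq_integral(2)[OF this] zero show ?thesis
      by (simp add: \<Psi>_def set_lebesgue_integral_def eq)
  qed
  have deriv: "(\<Psi> has_vector_derivative \<psi> t) (at t)" for t
  proof (cases "t < - R")
    case True
    have "((\<lambda>_. 0) has_vector_derivative \<psi> t) (at t)" using True R by simp
    then show ?thesis
      by (rule has_vector_derivative_transform_within_open[of _ _ _ "{..< - R}"]) (use True left in auto)
  next
    case False
    have "continuous_on {- R - 1..t + 1} \<psi>"
      using test_fun_continuous[OF \<psi>] continuous_on_subset by blast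
    then have "(\<Psi> has_vector_derivative \<psi> t) (at t within {- R - 1..t + 1})"
      unfolding \<Psi>_def by (rule integral_has_vector_derivative) (use False in auto)
    moreover have "at t within {- R - 1..t + 1} = at t"
      using False by (intro at_within_Icc_at) auto
    ultimately show ?thesis by simp
  qed
  have "test_fun \<Psi>"
    unfolding test_fun_iff
  proof (intro conjI allI exI impI)
    have "Ck n \<psi>" for n using \<psi> by (simp add: test_fun_iff)
    then show "Ck n \<Psi>" for n using Ck_mono[OF Ck_SucI[OF deriv]] by (meson le_SucI order_refl)
    show "\<Psi> t = 0" if "R < \<bar>t\<bar>" for t using that left right by (cases "t < 0") auto
  qed
  with deriv show ?thesis using that vderiv_eqI by blast
qed

lemma test_fun_unit_integral:
  obtains \<rho> where "test_fun \<rho>" "(LINT t|lebesgue. \<rho> t) = 1"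
proof -
  define p where "p t = smooth_step (t + 1) * smooth_step (2 - t)" for t
  have p: "plateau 0 1 t = complex_of_real (p t)" for t by (simp add: plateau_def p_def)
  have int: "integrable lebesgue p"
  proof -
    have "integrable lebesgue (plateau 0 1)"
      using locally_integrable_test[OF locally_integrable_const[of 1] test_fun_plateau] by simp
    then show ?thesis using integrable_Re by (fastforce simp: p)
  qed
  have "(1 :: real) = (LINT t|lebesgue. indicator {0..1::real} t)" 
    by (simp add: measure_lborel_Icc)
  also have "\<dots> \<le> (LINT t|lebesgue. p t)"
  proof (rule integral_mono[OF _ int])
    show "integrable lebesgue (indicator {0..1::real} :: real \<Rightarrow> real)"
      by (rule integrable_real_indicator) (auto simp: emeasure_lborel_Icc_eq)
    show "indicator {0..1} t \<le> p t" for t :: real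
      by (auto simp: p_def indicator_def smooth_step_1 intro: mult_nonneg_nonneg smooth_step_range)
  qed
  finally have "(LINT t|lebesgue. p t) \<noteq> 0" by simp
  then have "(LINT t|lebesgue. inverse (complex_of_real (LINT t|lebesgue. p t)) * plateau 0 1 t) = 1"
    by (simp add: p)
  then show ?thesis using that test_fun_cmult[OF test_fun_plateau] by blast
qed

text \<open>The du Bois-Reymond lemma. Subtracting from \<open>\<psi>\<close> its integral times
  \<open>\<rho>\<close> leaves a function of mean zero, hence the derivative of a test function; so
  \<open>w\<close> acts on \<open>\<psi>\<close> like the constant \<open>c\<close>, the integral of
  \<open>w * \<rho>\<close>.\<close>

lemma orthogonal_derivatives_AE_const:
  assumes w: "locally_integrable w"
    and orth: "\<And>\<psi>. test_fun \<psi> \<Longrightarrow> (LINT t|lebesgue. w t * vderiv \<psi> t) = 0"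
  obtains c where "AE t in lebesgue. w t = c"
proof -
  obtain \<rho> where \<rho>: "test_fun \<rho>" "(LINT t|lebesgue. \<rho> t) = 1" by (rule test_fun_unit_integral)
  define c where "c = (LINT t|lebesgue. w t * \<rho> t)"
  have "AE t in lebesgue. w t - c = 0"
  proof (rule orthogonal_test_funs_AE_zero)
    show "locally_integrable (\<lambda>t. w t - c)"
      by (intro locally_integrable_diff w locally_integrable_const)
    fix \<psi> assume \<psi>: "test_fun \<psi>"
    define m where "m = (LINT t|lebesgue. \<psi> t)"
    have int: "integrable lebesgue \<xi>" "integrable lebesgue (\<lambda>t. w t * \<xi> t)" if "test_fun \<xi>" for \<xi>
      using locally_integrable_test[OF locally_integrable_const[of 1] that]
        locally_integrable_test[OF w that] by simp_all
    have "test_fun (\<lambda>t. \<psi> t + (- m) * \<rho> t)"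
      by (intro test_fun_add test_fun_cmult \<psi> \<rho>)
    moreover have "(LINT t|lebesgue. \<psi> t + (- m) * \<rho> t) = 0"
      using int[OF \<psi>] int[OF \<rho>(1)] by (simp add: m_def \<rho>(2))
    ultimately obtain \<Psi> where \<Psi>: "test_fun \<Psi>" "vderiv \<Psi> = (\<lambda>t. \<psi> t + (- m) * \<rho> t)"
      by (rule test_fun_antiderivative)
    have "0 = (LINT t|lebesgue. w t * \<psi> t - m * (w t * \<rho> t))"
      using orth[OF \<Psi>(1)] unfolding \<Psi>(2) by (simp add: right_diff_distrib mult.left_commute[of _ m])
    also have "\<dots> = (LINT t|lebesgue. w t * \<psi> t) - m * c"
      using int[OF \<psi>] int[OF \<rho>(1)] by (simp add: c_def)
    finally have "(LINT t|lebesgue. w t * \<psi> t) = c * m" by (simp add: mult.commute)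
    moreover have "(LINT t|lebesgue. (w t - c) * \<psi> t) = (LINT t|lebesgue. w t * \<psi> t) - c * m"
      using int[OF \<psi>] by (simp add: left_diff_distrib m_def)
    ultimately show "(LINT t|lebesgue. (w t - c) * \<psi> t) = 0" by simp
  qed
  then show ?thesis using that[of c] by simp
qed

text \<open>The difference of \<open>u\<close> and the primitive of its weak derivative has weak
  derivative zero, so it is a constant.\<close>

lemma weak_deriv_imp_prim:
  assumes "locally_integrable u" "weak_deriv u v"
  obtains d where "AE t in lebesgue. u t = d + prim c v t"
proof -
  note v = weak_deriv_L2[OF assms(2)]
  note p = continuous_locally_integrable[OF continuous_prim[OF v, of c]]
  have "(LINT t|lebesgue. (u t - prim c v t) * vderiv \<psi> t) = 0" if \<psi>: "test_fun \<psi>" for \<psi>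
  proof -
    have "(LINT t|lebesgue. u t * vderiv \<psi> t) = (LINT t|lebesgue. prim c v t * vderiv \<psi> t)"
    proof -
      have "- (LINT t|lebesgue. u t * vderiv \<psi> t) = (LINT t|lebesgue. v t * \<psi> t)"
        using assms(2) \<psi> unfolding weak_deriv_iff by blast
      moreover have "- (LINT t|lebesgue. prim c v t * vderiv \<psi> t) = (LINT t|lebesgue. v t * \<psi> t)"
        using weak_deriv_prim[OF v, of c] \<psi> unfolding weak_deriv_iff by blast
      ultimately show ?thesis by (metis neg_equal_iff_equal)
    qed
    then show ?thesis
      using locally_integrable_test[OF assms(1) test_fun_vderiv[OF \<psi>]]
        locally_integrable_test[OF p test_fun_vderiv[OF \<psi>]] by (simp add: left_diff_distrib)
  qed
  with locally_integrable_diff[OF assms(1) p]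
  obtain d where "AE t in lebesgue. u t - prim c v t = d" by (rule orthogonal_derivatives_AE_const)
  then have "AE t in lebesgue. u t = d + prim c v t"
    by (rule AE_mp) (intro AE_I2 impI, simp only: diff_eq_eq)
  then show ?thesis by (rule that)
qed


section \<open>Continuous functionals on the Sobolev space\<close>

lemma W12E:
  assumes "W12 u" obtains v where "weak_deriv u v" "L2 u" "L2 v" "locally_integrable u"
  using assms that L2_locally_integrable weak_deriv_L2 unfolding W12_def by blast

lemma W12I: "L2 u \<Longrightarrow> weak_deriv u v \<Longrightarrow> W12 u"
  by (auto simp: W12_def)

lemma W12_add:
  assumes "W12 u" "W12 v" shows "W12 (\<lambda>t. u t + v t)"
proof -
  obtain u' v' where "weak_deriv u u'" "L2 u" "locally_integrable u" "weak_deriv v v'" "L2 v" "locally_integrable v"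
    using assms W12E by metis
  then show ?thesis by (intro W12I[OF L2_add weak_deriv_add])
qed

lemma W12_cmult:
  assumes "W12 u" shows "W12 (\<lambda>t. c * u t)"
proof -
  obtain u' where "weak_deriv u u'" "L2 u" using assms W12E by metis
  then show ?thesis by (intro W12I[OF L2_cmult weak_deriv_cmult])
qed

lemma W12_diff: "W12 u \<Longrightarrow> W12 v \<Longrightarrow> W12 (\<lambda>t. u t - v t)"
  using W12_add[of u "\<lambda>t. (-1) * v t"] W12_cmult[of v "-1"] by simp

lemma W12_sum: "(\<And>i. i \<in> A \<Longrightarrow> W12 (u i)) \<Longrightarrow> W12 (\<lambda>t. \<Sum>i\<in>A. u i t)"
proof (induction A rule: infinite_finite_induct)
  case (insert i A)
  then show ?case using W12_add[of "u i"] by simp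
qed (use weak_deriv_classical(2)[of "\<lambda>_. 0" "\<lambda>_. 0" 0] in auto)

lemma norm_W12_nonneg [simp]: "0 \<le> norm_W12 u"
  by (simp add: norm_W12_def)

lemma L2_bounded_mult:
  assumes "L2 u" "f \<in> borel_measurable lebesgue" "\<And>t. norm (f t) \<le> B"
  shows "L2 (\<lambda>t. f t * u t)" "norm_L2 (\<lambda>t. f t * u t) \<le> B * norm_L2 u"
proof -
  have m: "(\<lambda>t. f t * u t) \<in> borel_measurable lebesgue"
    using assms(2) L2_measurable[OF assms(1)] by (rule borel_measurable_times)
  have le: "norm (f t * u t) \<le> B * norm (u t)" for t
    using assms(3) by (simp add: norm_mult mult_right_mono)
  have "0 \<le> B" using assms(3)[of 0] norm_ge_zero order_trans by blast
  then show "L2 (\<lambda>t. f t * u t)" "norm_L2 (\<lambda>t. f t * u t) \<le> B * norm_L2 u"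
    using L2_dominated[OF assms(1) m le] by auto
qed

lemma norm_L2_bounded_support:
  assumes "f \<in> borel_measurable lebesgue" "\<And>t. norm (f t) \<le> B * indicator {a..b} t" "a \<le> b" "0 \<le> B"
  shows "L2 f" "norm_L2 f \<le> B * sqrt (b - a)"
proof -
  have le: "norm (f t) \<le> B * norm (indicator {a..b} t :: complex)" for t
    using assms(2)[of t] by (cases "t \<in> {a..b}") auto
  have "(\<lambda>t. (norm (indicator {a..b} t :: complex))\<^sup>2) = (indicator {a..b} :: real \<Rightarrow> real)"
    by (auto simp: indicator_def)
  then have "norm_L2 (indicator {a..b}) = sqrt (b - a)"
    using assms(3) by (simp add: norm_L2_def measure_lborel_Icc)
  with L2_dominated[OF L2_indicator_interval assms(1) le] assms(4)
  show "L2 f" "norm_L2 f \<le> B * sqrt (b - a)" by auto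
qed

lemma W12_mult_test_fun:
  assumes "weak_deriv u v" "L2 u" and \<eta>: "test_fun \<eta>"
  shows "weak_deriv (\<lambda>t. \<eta> t * u t) (\<lambda>t. vderiv \<eta> t * u t + \<eta> t * v t)" "W12 (\<lambda>t. \<eta> t * u t)"
proof -
  obtain B where "\<And>t. norm (\<eta> t) \<le> B" using test_fun_bounded[OF \<eta>] by blast
  then have L2: "L2 (\<lambda>t. \<eta> t * u t)"
    by (rule L2_bounded_mult(1)[OF assms(2) test_fun_measurable[OF \<eta>]])
  note d = test_fun_vderiv[OF \<eta>]
  obtain K where "\<And>t. norm (vderiv \<eta> t) \<le> K" using test_fun_bounded[OF d] by blast
  then have "L2 (\<lambda>t. vderiv \<eta> t * u t)"
    by (rule L2_bounded_mult(1)[OF assms(2) test_fun_measurable[OF d]])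
  then show *: "weak_deriv (\<lambda>t. \<eta> t * u t) (\<lambda>t. vderiv \<eta> t * u t + \<eta> t * v t)"
    by (rule weak_deriv_mult_test_fun[OF L2_locally_integrable[OF assms(2)] assms(1) \<eta>])
  show "W12 (\<lambda>t. \<eta> t * u t)" by (rule W12I[OF L2 *])
qed

lemma vderiv_eq_0_outside:
  assumes "\<And>t. (f has_vector_derivative g t) (at t)" "\<And>t. r < \<bar>t - c\<bar> \<Longrightarrow> f t = (0 :: complex)" "r < \<bar>t - c\<bar>"
  shows "g t = 0"
proof (rule has_vector_derivative_locally_const[OF assms(1)])
  show "open {t. r < \<bar>t - c\<bar>}" by (intro open_Collect_less continuous_intros)
qed (use assms in auto)

text \<open>Within distance \<open>r\<close> of \<open>c\<close> the primitive is at most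
  \<open>sqrt r * norm_L2 h\<close>. Over an interval of length \<open>2 * r\<close> this gives the
  term \<open>2 * r\<close> for the product itself and \<open>2 * r * K\<close> for the derivative
  falling on the cutoff; the 1 comes from \<open>\<eta> t * h t\<close>.\<close>

lemma cutoff_prim:
  assumes \<eta>: "test_fun \<eta>" "\<forall>t. r < \<bar>t - c\<bar> \<longrightarrow> \<eta> t = 0" "\<And>t. norm (\<eta> t) \<le> 1"
      "\<And>t. norm (vderiv \<eta> t) \<le> K"
    and h: "L2 h" and "0 < r" "0 \<le> K"
  shows "W12 (\<lambda>t. \<eta> t * prim c h t)"
    and "norm_W12 (\<lambda>t. \<eta> t * prim c h t) \<le> (2 * r + 2 * r * K + 1) * norm_L2 h"
proof -
  note d = test_fun_vderiv[OF \<eta>(1)]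
  have d0: "\<forall>t. r < \<bar>t - c\<bar> \<longrightarrow> vderiv \<eta> t = 0"
    using vderiv_eq_0_outside[OF test_fun_has_derivative[OF \<eta>(1)]] \<eta>(2) by blast
  have m: "prim c h \<in> borel_measurable lebesgue"
    by (intro continuous_imp_lebesgue_measurable continuous_prim h)
  have bound: "norm (f t * prim c h t) \<le> (A * (sqrt r * norm_L2 h)) * indicator {c - r..c + r} t"
    if "\<And>t. norm (f t) \<le> A" "\<forall>t. r < \<bar>t - c\<bar> \<longrightarrow> f t = 0" for f :: "real \<Rightarrow> complex" and A t
  proof (cases "r < \<bar>t - c\<bar>")
    case False
    have "norm (prim c h t) \<le> sqrt \<bar>t - c\<bar> * norm_L2 h" by (rule norm_prim_le[OF h])
    also have "\<dots> \<le> sqrt r * norm_L2 h" using False by (intro mult_right_mono) auto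
    finally have "norm (f t) * norm (prim c h t) \<le> A * (sqrt r * norm_L2 h)"
      using that(1) order_trans[OF norm_ge_zero that(1)] by (intro mult_mono) auto
    then show ?thesis using False by (auto simp: norm_mult indicator_def)
  qed (use that in \<open>auto simp: indicator_def\<close>)
  have L2: "L2 (\<lambda>t. f t * prim c h t)" "norm_L2 (\<lambda>t. f t * prim c h t) \<le> 2 * r * A * norm_L2 h"
    if f: "\<And>t. norm (f t) \<le> A" "\<forall>t. r < \<bar>t - c\<bar> \<longrightarrow> f t = 0" "test_fun f" for f A
  proof -
    have A: "0 \<le> A" using order_trans[OF norm_ge_zero f(1)] .
    note * = norm_L2_bounded_support[OF borel_measurable_times[OF test_fun_measurable[OF f(3)] m] bound[OF f(1,2)]]
    show "L2 (\<lambda>t. f t * prim c h t)" by (rule *(1)) (use A \<open>0 < r\<close> in auto)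
    have "norm_L2 (\<lambda>t. f t * prim c h t) \<le> A * (sqrt r * norm_L2 h) * sqrt (c + r - (c - r))"
      by (rule *(2)) (use A \<open>0 < r\<close> in auto)
    also have "\<dots> = A * norm_L2 h * (sqrt r * sqrt (2 * r))" by simp
    also have "\<dots> \<le> A * norm_L2 h * (2 * r)"
    proof (intro mult_left_mono)
      \<comment> \<open>Rounding \<open>sqrt 2 * r\<close> up to \<open>2 * r\<close> keeps roots
        out of the constants.\<close>
      have "sqrt r * sqrt (2 * r) \<le> sqrt (2 * r) * sqrt (2 * r)"
        using \<open>0 < r\<close> by (intro mult_right_mono) auto
      then show "sqrt r * sqrt (2 * r) \<le> 2 * r" using \<open>0 < r\<close> by simp
    qed (use A in auto)
    finally show "norm_L2 (\<lambda>t. f t * prim c h t) \<le> 2 * r * A * norm_L2 h" by (simp add: algebra_simps)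
  qed
  note L1 = L2[OF \<eta>(3,2,1)] and L3 = L2[OF \<eta>(4) d0 d]
  note L4 = L2_bounded_mult[OF h test_fun_measurable[OF \<eta>(1)] \<eta>(3)]
  have wd: "weak_deriv (\<lambda>t. \<eta> t * prim c h t) (\<lambda>t. vderiv \<eta> t * prim c h t + \<eta> t * h t)"
    by (rule weak_deriv_mult_test_fun[OF continuous_locally_integrable[OF continuous_prim[OF h]]
          weak_deriv_prim[OF h] \<eta>(1) L3(1)])
  then show "W12 (\<lambda>t. \<eta> t * prim c h t)" by (rule W12I[OF L1(1)])
  have "norm_W12 (\<lambda>t. \<eta> t * prim c h t) \<le>
      norm_L2 (\<lambda>t. \<eta> t * prim c h t) + norm_L2 (\<lambda>t. vderiv \<eta> t * prim c h t + \<eta> t * h t)"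
    by (rule norm_W12_le[OF wd])
  also have "\<dots> \<le> 2 * r * 1 * norm_L2 h + (2 * r * K * norm_L2 h + 1 * norm_L2 h)"
    using norm_L2_triangle[OF L3(1) L4(1)] L1(2) L3(2) L4(2) by linarith
  finally show "norm_W12 (\<lambda>t. \<eta> t * prim c h t) \<le> (2 * r + 2 * r * K + 1) * norm_L2 h"
    by (simp add: algebra_simps)
qed

text \<open>The part of \<open>W12_extension\<close> that does not mention a distribution, so that
  functionals of different origin can be compared.\<close>

definition W12_functional :: "((real \<Rightarrow> complex) \<Rightarrow> complex) \<Rightarrow> bool" where
  "W12_functional F \<longleftrightarrow>
     (\<forall>u v. W12 u \<longrightarrow> W12 v \<longrightarrow> F (\<lambda>t. u t + v t) = F u + F v) \<and>
     (\<forall>c u. W12 u \<longrightarrow> F (\<lambda>t. c * u t) = c * F u) \<and>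
     (\<exists>B. \<forall>u. W12 u \<longrightarrow> norm (F u) \<le> B * norm_W12 u)"

lemma W12_functional_add: "W12_functional F \<Longrightarrow> W12 u \<Longrightarrow> W12 v \<Longrightarrow> F (\<lambda>t. u t + v t) = F u + F v"
  and W12_functional_cmult: "W12_functional F \<Longrightarrow> W12 u \<Longrightarrow> F (\<lambda>t. c * u t) = c * F u"
  by (auto simp: W12_functional_def)

lemma W12_functional_bound:
  assumes "W12_functional F"
  obtains B where "0 \<le> B" "\<And>u. W12 u \<Longrightarrow> norm (F u) \<le> B * norm_W12 u"
proof -
  obtain B where B: "\<And>u. W12 u \<Longrightarrow> norm (F u) \<le> B * norm_W12 u"
    using assms by (auto simp: W12_functional_def)
  have "norm (F u) \<le> \<bar>B\<bar> * norm_W12 u" if "W12 u" for u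
    using B[OF that] mult_right_mono[OF abs_ge_self norm_W12_nonneg, of B u] by linarith
  then show ?thesis using that[of "\<bar>B\<bar>"] by simp
qed

lemma W12_functional_diff: "W12_functional F \<Longrightarrow> W12 u \<Longrightarrow> W12 v \<Longrightarrow> F (\<lambda>t. u t - v t) = F u - F v"
  using W12_functional_add[of F u "\<lambda>t. (-1) * v t"] W12_functional_cmult[of F v "-1"] W12_cmult[of v "-1"]
  by simp

lemma W12_functional_sum:
  assumes "W12_functional F" "\<And>i. i \<in> A \<Longrightarrow> W12 (u i)" "finite A"
  shows "F (\<lambda>t. \<Sum>i\<in>A. u i t) = (\<Sum>i\<in>A. F (u i))"
  using assms(3,2)
proof (induction A rule: finite_induct)
  case empty
  have "W12 (\<lambda>_. 0)" using W12_sum[of "{}"] by simp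
  from W12_functional_cmult[OF assms(1) this, of 0] show ?case by simp
next
  case (insert i A)
  then show ?case using W12_functional_add[OF assms(1) _ W12_sum, of "u i" A u] by simp
qed

text \<open>Riesz's theorem for the functional that maps \<open>h\<close> to
  \<open>F (\<lambda>t. \<eta> t * prim c h t)\<close>. It is used twice: with \<open>r = 2\<close>
  in \<open>local_rep_exists\<close>, where the norm bound matters, and with large \<open>r\<close>
  in the uniqueness proof, where only the representation matters.\<close>

lemma cutoff_prim_Riesz:
  assumes F: "W12_functional F" and B: "0 \<le> B" "\<And>u. W12 u \<Longrightarrow> norm (F u) \<le> B * norm_W12 u"
    and \<eta>: "test_fun \<eta>" "\<forall>t. r < \<bar>t - c\<bar> \<longrightarrow> \<eta> t = 0" "\<And>t. norm (\<eta> t) \<le> 1"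
      "\<And>t. norm (vderiv \<eta> t) \<le> K"
    and r: "0 < r" and K: "0 \<le> K"
  obtains g where "L2 g" "norm_L2 g \<le> B * (2 * r + 2 * r * K + 1)"
    "\<And>h. L2 h \<Longrightarrow> F (\<lambda>t. \<eta> t * prim c h t) = (LINT t|lebesgue. g t * h t)"
proof (rule L2_Riesz[of "\<lambda>h. F (\<lambda>t. \<eta> t * prim c h t)" "B * (2 * r + 2 * r * K + 1)"])
  note cp = cutoff_prim[OF \<eta> _ r K]
  show "F (\<lambda>t. \<eta> t * prim c (\<lambda>t. h t + k t) t) = F (\<lambda>t. \<eta> t * prim c h t) + F (\<lambda>t. \<eta> t * prim c k t)"
    if "L2 h" "L2 k" for h k
    unfolding prim_add[OF that] distrib_left by (rule W12_functional_add[OF F cp(1)[OF that(1)] cp(1)[OF that(2)]])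
  show "F (\<lambda>t. \<eta> t * prim c (\<lambda>t. b * h t) t) = b * F (\<lambda>t. \<eta> t * prim c h t)" if "L2 h" for b h
    unfolding prim_cmult mult.left_commute[of _ b] by (rule W12_functional_cmult[OF F cp(1)[OF that]])
  show "norm (F (\<lambda>t. \<eta> t * prim c h t)) \<le> B * (2 * r + 2 * r * K + 1) * norm_L2 h" if "L2 h" for h
    using B(2)[OF cp(1)[OF that]] mult_left_mono[OF cp(2)[OF that] B(1)] by (simp only: mult.assoc)
  show "0 \<le> B * (2 * r + 2 * r * K + 1)" using B r K by simp
qed (rule that)

lemma norm_W12_AE_zero:
  assumes "u \<in> borel_measurable lebesgue" "AE t in lebesgue. u t = 0"
  shows "norm_W12 u = 0"
proof -
  have *: "(LINT t|lebesgue. u t * \<psi> t) = 0" for \<psi>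
    by (rule integral_eq_zero_AE) (use assms(2) in auto)
  have "weak_deriv u (\<lambda>t. 0)" by (simp add: weak_deriv_iff *)
  moreover have "norm_L2 u = 0"
    unfolding norm_L2_def using assms(2) by (auto intro!: integral_eq_zero_AE)
  moreover have "norm_L2 (\<lambda>t. 0) = 0" by (simp add: norm_L2_def)
  ultimately show ?thesis by (simp add: norm_W12_eq)
qed

lemma W12_functional_cong_AE:
  assumes "W12_functional F" "W12 u" "W12 v" "AE t in lebesgue. u t = v t"
  shows "F u = F v"
proof -
  have "(\<lambda>t. u t - v t) \<in> borel_measurable lebesgue"
    using assms W12_def L2_measurable by (intro borel_measurable_diff) blast+
  then have "norm_W12 (\<lambda>t. u t - v t) = 0"
    by (rule norm_W12_AE_zero) (use assms(4) in auto)
  moreover obtain B where "\<And>u. W12 u \<Longrightarrow> norm (F u) \<le> B * norm_W12 u"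
    using W12_functional_bound[OF assms(1)] by blast
  ultimately have "F (\<lambda>t. u t - v t) = 0" using W12_diff[OF assms(2,3)] by fastforce
  then show ?thesis using W12_functional_diff[OF assms(1-3)] by simp
qed

lemma AE_const_L2_imp_zero:
  assumes "L2 g" "AE t in lebesgue. g t = c" shows "c = 0"
proof -
  \<comment> \<open>The norm of \<open>g\<close> dominates its part on \<open>[0, n]\<close>, which
    grows without bound unless \<open>c = 0\<close>.\<close>
  have "(norm c)\<^sup>2 * real n \<le> (norm_L2 g)\<^sup>2" for n
  proof -
    have "(norm c)\<^sup>2 * real n = (LINT t|lebesgue. (norm c)\<^sup>2 * indicator {0..real n} t)"
      by (simp add: measure_lborel_Icc)
    also have "\<dots> \<le> (LINT t|lebesgue. (norm (g t))\<^sup>2)"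
    proof (rule integral_mono_AE)
      show "integrable lebesgue (\<lambda>t. (norm c)\<^sup>2 * indicator {0..real n} t)"
        by (intro integrable_mult_right integrable_real_indicator) (auto simp: emeasure_lborel_Icc_eq)
      show "AE t in lebesgue. (norm c)\<^sup>2 * indicator {0..real n} t \<le> (norm (g t))\<^sup>2"
        using assms(2) by (rule AE_mp) (auto simp: indicator_def)
    qed (rule L2_integrable[OF assms(1)])
    finally show ?thesis by (simp add: norm_L2_power2)
  qed
  moreover obtain n where "(norm_L2 g)\<^sup>2 < real n * (norm c)\<^sup>2" if "c \<noteq> 0"
    using reals_Archimedean3[of "(norm c)\<^sup>2"] by fastforce
  ultimately show ?thesis by (metis mult.commute not_less)
qed

lemma lebesgue_sets_abs_ge: "{t::real. a \<le> \<bar>t\<bar>} \<in> sets lebesgue"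
proof -
  have "closed {t::real. a \<le> \<bar>t\<bar>}" by (intro closed_Collect_le continuous_intros)
  then show ?thesis by (intro sets_completionI_sets) auto
qed

lemma norm_L2_tail_tendsto:
  assumes "L2 u"
  shows "(\<lambda>n. norm_L2 (\<lambda>t. indicator {t. real n \<le> \<bar>t\<bar>} t * u t)) \<longlonglongrightarrow> 0"
proof -
  have "(\<lambda>n. LINT t|lebesgue. (norm (indicator {t. real n \<le> \<bar>t\<bar>} t * u t))\<^sup>2) \<longlonglongrightarrow> (LINT t::real|lebesgue. (0 :: real))"
  proof (rule integral_dominated_convergence)
    show "integrable lebesgue (\<lambda>t. (norm (u t))\<^sup>2)" by (rule L2_integrable[OF assms])
    show "(\<lambda>t. (norm (indicator {t. real n \<le> \<bar>t\<bar>} t * u t))\<^sup>2) \<in> borel_measurable lebesgue" for n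
      by (rule borel_measurable_integrable[OF L2_integrable[OF L2_indicator[OF assms lebesgue_sets_abs_ge]]])
    show "AE t in lebesgue. (\<lambda>n. (norm (indicator {t. real n \<le> \<bar>t\<bar>} t * u t))\<^sup>2) \<longlonglongrightarrow> 0"
    proof (rule AE_I2)
      fix t
      obtain N :: nat where "\<bar>t\<bar> < real N" using reals_Archimedean2 by blast
      then have "\<forall>\<^sub>F n in sequentially. 0 = (norm (indicator {t. real n \<le> \<bar>t\<bar>} t * u t))\<^sup>2"
        by (intro eventually_sequentiallyI[of N]) (auto simp: indicator_def)
      then show "(\<lambda>n. (norm (indicator {t. real n \<le> \<bar>t\<bar>} t * u t))\<^sup>2) \<longlonglongrightarrow> 0"
        by (rule Lim_transform_eventually[OF tendsto_const])
    qed
    show "AE t in lebesgue. norm ((norm (indicator {t. real n \<le> \<bar>t\<bar>} t * u t))\<^sup>2) \<le> (norm (u t))\<^sup>2" for n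
      by (auto simp: indicator_def)
  qed simp
  from tendsto_real_sqrt[OF this] show ?thesis by (simp add: norm_L2_def)
qed

text \<open>The representing function \<open>g\<close> is orthogonal to derivatives of test
  functions, hence constant, hence zero because it is in \<open>L2\<close>. So \<open>F\<close>
  vanishes on cut-off primitives, and \<open>u\<close> is a primitive plus a constant, which the
  cutoff turns into a multiple of a test function.\<close>

lemma W12_functional_eq_zero_cutoff:
  assumes F: "W12_functional F" and zero: "\<And>\<psi>. test_fun \<psi> \<Longrightarrow> F \<psi> = 0" and "W12 u"
  shows "F (\<lambda>t. plateau (- real n) (real n) t * u t) = 0"
proof -
  define \<eta> where "\<eta> = plateau (- real n) (real n)"
  obtain K where K: "K > 0" "\<And>a b t. norm (vderiv (plateau a b) t) \<le> K" using vderiv_plateau_bounded by blast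
  define r where "r = real n + 1"
  have r: "0 < r" by (simp add: r_def)
  have \<eta>: "test_fun \<eta>" "\<forall>t. r < \<bar>t - 0\<bar> \<longrightarrow> \<eta> t = 0" "\<And>t. norm (\<eta> t) \<le> 1"
      "\<And>t. norm (vderiv \<eta> t) \<le> K"
    by (auto simp: \<eta>_def r_def test_fun_plateau norm_plateau_le K intro!: plateau_eq_0)
  have K0: "0 \<le> K" using K by simp
  note cp = cutoff_prim[OF \<eta> _ r K0]
  obtain B where B: "0 \<le> B" "\<And>u. W12 u \<Longrightarrow> norm (F u) \<le> B * norm_W12 u"
    using W12_functional_bound[OF F] by blast
  define G where "G h = F (\<lambda>t. \<eta> t * prim 0 h t)" for h
  obtain g where "L2 g" "\<And>h. L2 h \<Longrightarrow> F (\<lambda>t. \<eta> t * prim 0 h t) = (LINT t|lebesgue. g t * h t)"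
    by (rule cutoff_prim_Riesz[OF F B \<eta> r K0], assumption) (rule that)
  note g = this[folded G_def]
  have "(LINT t|lebesgue. g t * vderiv \<psi> t) = 0" if \<psi>: "test_fun \<psi>" for \<psi>
  proof -
    \<comment> \<open>The primitive of \<open>vderiv \<psi>\<close> is
      \<open>\<psi> t - \<psi> 0\<close>, so after the cutoff \<open>F\<close> is applied to a
      genuine test function.\<close>
    have "(LINT t|lebesgue. g t * vderiv \<psi> t) = F (\<lambda>t. \<eta> t * \<psi> t + (- \<psi> 0) * \<eta> t)"
      using g(2)[OF L2_test_fun[OF test_fun_vderiv[OF \<psi>]]]
      by (simp add: G_def prim_vderiv[OF \<psi>] algebra_simps)
    also have "\<dots> = 0" by (intro zero test_fun_add test_fun_mult test_fun_cmult \<psi> \<eta>)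
    finally show ?thesis .
  qed
  with L2_locally_integrable[OF g(1)] obtain c where c: "AE t in lebesgue. g t = c"
    by (rule orthogonal_derivatives_AE_const)
  then have "AE t in lebesgue. g t = 0" using AE_const_L2_imp_zero[OF g(1) c] by simp
  then have G0: "G h = 0" if "L2 h" for h
    unfolding g(2)[OF that] by (intro integral_eq_zero_AE) auto
  obtain v where v: "weak_deriv u v" "L2 u" "L2 v" "locally_integrable u" using W12E[OF \<open>W12 u\<close>] by blast
  obtain d where d: "AE t in lebesgue. u t = d + prim 0 v t" using weak_deriv_imp_prim[OF v(4,1)] by blast
  have W: "W12 (\<lambda>t. d * \<eta> t)" by (intro W12_cmult weak_deriv_test_fun \<eta>)
  have "F (\<lambda>t. \<eta> t * u t) = F (\<lambda>t. d * \<eta> t + \<eta> t * prim 0 v t)"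
  proof (rule W12_functional_cong_AE[OF F])
    show "W12 (\<lambda>t. \<eta> t * u t)" by (rule W12_mult_test_fun(2)[OF v(1,2) \<eta>(1)])
    show "W12 (\<lambda>t. d * \<eta> t + \<eta> t * prim 0 v t)" by (rule W12_add[OF W cp(1)[OF v(3)]])
    show "AE t in lebesgue. \<eta> t * u t = d * \<eta> t + \<eta> t * prim 0 v t"
      using d by (rule AE_mp) (simp add: algebra_simps)
  qed
  also have "\<dots> = d * F \<eta> + G v"
    using W12_functional_add[OF F W cp(1)[OF v(3)]] W12_functional_cmult[OF F weak_deriv_test_fun(2)[OF \<eta>(1)]]
    by (simp add: G_def)
  finally show ?thesis using zero[OF \<eta>(1)] G0[OF v(3)] by (simp add: \<eta>_def)
qed

text \<open>Removes the cutoff: the remainder \<open>u - \<eta> n * u\<close> and its weak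
  derivative live on \<open>\<bar>t\<bar> \<ge> n\<close>, and since \<open>K\<close> does not
  depend on \<open>n\<close>, its norm is controlled by the tails of \<open>u\<close> and
  \<open>v\<close>.\<close>

lemma W12_functional_eq_zero:
  assumes F: "W12_functional F" and zero: "\<And>\<psi>. test_fun \<psi> \<Longrightarrow> F \<psi> = 0" and "W12 u"
  shows "F u = 0"
proof -
  obtain v where v: "weak_deriv u v" "L2 u" "L2 v" using W12E[OF \<open>W12 u\<close>] by blast
  obtain B where B: "0 \<le> B" "\<And>u. W12 u \<Longrightarrow> norm (F u) \<le> B * norm_W12 u"
    using W12_functional_bound[OF F] by blast
  obtain K where K: "K > 0" "\<And>a b t. norm (vderiv (plateau a b) t) \<le> K" using vderiv_plateau_bounded by blast
  define \<eta> where "\<eta> n = plateau (- real n) (real n)" for n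
  define tail where "tail n w t = indicator {t. real n \<le> \<bar>t\<bar>} t * (w t :: complex)" for n w t
  have \<eta>: "test_fun (\<eta> n)" for n by (simp add: \<eta>_def test_fun_plateau)
  have tail: "L2 (tail n w)" if "L2 w" for n w
    unfolding tail_def by (rule L2_indicator[OF that lebesgue_sets_abs_ge])
  have bound: "norm (F u) \<le> B * (2 * norm_L2 (tail n u) + K * norm_L2 (tail n u) + 2 * norm_L2 (tail n v))" for n
  proof -
    define w where "w t = u t - \<eta> n t * u t" for t
    note m = W12_mult_test_fun[OF v(1,2) \<eta>, of n]
    have W: "W12 w" unfolding w_def by (rule W12_diff[OF \<open>W12 u\<close> m(2)])
    have wd: "weak_deriv w (\<lambda>t. v t - (vderiv (\<eta> n) t * u t + \<eta> n t * v t))"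
    proof -
      have "weak_deriv (\<lambda>t. u t + (-1) * (\<eta> n t * u t)) (\<lambda>t. v t + (-1) * (vderiv (\<eta> n) t * u t + \<eta> n t * v t))"
        by (intro weak_deriv_add weak_deriv_cmult v m L2_locally_integrable L2_cmult)
           (use m(2) in \<open>auto simp: W12_def\<close>)
      then show ?thesis by (simp add: w_def[abs_def] algebra_simps)
    qed
    have small: "\<eta> n t = 1 \<and> vderiv (\<eta> n) t = 0" if "\<not> real n \<le> \<bar>t\<bar>" for t
    proof
      show "\<eta> n t = 1" using that by (auto simp: \<eta>_def plateau_eq_1)
      show "vderiv (\<eta> n) t = 0"
        by (rule has_vector_derivative_locally_const[OF test_fun_has_derivative[OF \<eta>], where U = "{- real n<..<real n}" and c = 1])
           (use that in \<open>auto simp: \<eta>_def plateau_eq_1\<close>)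
    qed
    have n1: "norm (1 - \<eta> n t) \<le> 2" for t
      using norm_triangle_ineq4[of 1 "\<eta> n t"] norm_plateau_le[of "- real n" "real n" t] by (simp add: \<eta>_def)
    have m1: "(\<lambda>t. 1 - \<eta> n t) \<in> borel_measurable lebesgue"
      by (intro borel_measurable_diff borel_measurable_const test_fun_measurable \<eta>)
    \<comment> \<open>On \<open>\<bar>t\<bar> < n\<close> the factors \<open>1 - \<eta> n t\<close>
      and \<open>vderiv (\<eta> n) t\<close> vanish, so inserting the tail indicator changes
      nothing.\<close>
    have e1: "w = (\<lambda>t. (1 - \<eta> n t) * tail n u t)"
      using small by (force simp: w_def tail_def indicator_def algebra_simps fun_eq_iff)
    have e2: "(\<lambda>t. v t - (vderiv (\<eta> n) t * u t + \<eta> n t * v t)) =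
        (\<lambda>t. (1 - \<eta> n t) * tail n v t + (- vderiv (\<eta> n) t) * tail n u t)"
      using small by (force simp: tail_def indicator_def algebra_simps fun_eq_iff)
    have m2: "(\<lambda>t. - vderiv (\<eta> n) t) \<in> borel_measurable lebesgue"
      by (intro borel_measurable_uminus test_fun_measurable test_fun_vderiv \<eta>)
    have n2: "norm (- vderiv (\<eta> n) t) \<le> K" for t by (simp add: \<eta>_def K)
    have F0: "F (\<lambda>t. \<eta> n t * u t) = 0"
      unfolding \<eta>_def by (rule W12_functional_eq_zero_cutoff[OF assms])
    have "F w = F u - F (\<lambda>t. \<eta> n t * u t)"
      unfolding w_def by (rule W12_functional_diff[OF F \<open>W12 u\<close> m(2)])
    then have "norm (F u) = norm (F w)" by (simp add: F0)
    also have "\<dots> \<le> B * norm_W12 w" by (rule B(2)[OF W])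
    also have "norm_W12 w \<le> norm_L2 w + norm_L2 (\<lambda>t. v t - (vderiv (\<eta> n) t * u t + \<eta> n t * v t))"
      by (rule norm_W12_le[OF wd])
    also have "norm_L2 w \<le> 2 * norm_L2 (tail n u)"
      unfolding e1 by (rule L2_bounded_mult(2)[OF tail[OF v(2), of n] m1 n1])
    also have "norm_L2 (\<lambda>t. v t - (vderiv (\<eta> n) t * u t + \<eta> n t * v t)) \<le>
        2 * norm_L2 (tail n v) + K * norm_L2 (tail n u)"
      unfolding e2
      using norm_L2_triangle[OF L2_bounded_mult(1)[OF tail[OF v(3), of n] m1 n1] L2_bounded_mult(1)[OF tail[OF v(2), of n] m2 n2]]
        L2_bounded_mult(2)[OF tail[OF v(3), of n] m1 n1] L2_bounded_mult(2)[OF tail[OF v(2), of n] m2 n2]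
      by linarith
    finally show ?thesis using B(1) by (simp add: mult_right_mono algebra_simps)
  qed
  have "(\<lambda>n. B * (2 * norm_L2 (tail n u) + K * norm_L2 (tail n u) + 2 * norm_L2 (tail n v))) \<longlonglongrightarrow>
      B * (2 * 0 + K * 0 + 2 * 0)"
    unfolding tail_def by (intro tendsto_intros norm_L2_tail_tendsto v)
  then have "norm (F u) \<le> B * (2 * 0 + K * 0 + 2 * 0)"
    by (rule LIMSEQ_le_const) (use bound in auto)
  then show ?thesis by simp
qed

text \<open>The substitute for density of the test functions. It determines the functional picked by
  \<open>SOME\<close> in \<open>W12_pairing\<close> on all of \<open>W12\<close>.\<close>

lemma W12_functional_unique:
  assumes F: "W12_functional F" and G: "W12_functional G"
    and eq: "\<And>\<psi>. test_fun \<psi> \<Longrightarrow> F \<psi> = G \<psi>" and "W12 u"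
  shows "F u = G u"
proof -
  obtain A B where AB: "\<And>u. W12 u \<Longrightarrow> norm (F u) \<le> A * norm_W12 u" "\<And>u. W12 u \<Longrightarrow> norm (G u) \<le> B * norm_W12 u"
    using F G unfolding W12_functional_def by metis
  have "W12_functional (\<lambda>u. F u - G u)"
    unfolding W12_functional_def
  proof (intro conjI allI impI exI)
    fix u assume "W12 u"
    then show "norm (F u - G u) \<le> (A + B) * norm_W12 u"
      using AB[of u] norm_triangle_ineq4[of "F u" "G u"] by (simp add: distrib_right)
  qed (use F G in \<open>auto simp: W12_functional_def algebra_simps\<close>)
  from W12_functional_eq_zero[OF this _ \<open>W12 u\<close>] eq show ?thesis by simp
qed


section \<open>The pairing and the partition of unity\<close>

lemma W12_extension_iff: "W12_extension f F \<longleftrightarrow> dist_eq F f \<and> W12_functional F"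
  by (simp add: W12_extension_def W12_functional_def)

lemma W12_pairing:
  assumes "Wm12 f"
  shows "W12_functional (W12_pairing f)" "\<And>\<psi>. test_fun \<psi> \<Longrightarrow> W12_pairing f \<psi> = f \<psi>"
proof -
  have "W12_extension f (W12_pairing f)"
    using assms someI_ex[of "W12_extension f"] unfolding Wm12_def W12_pairing_def by blast
  then show "W12_functional (W12_pairing f)" "\<And>\<psi>. test_fun \<psi> \<Longrightarrow> W12_pairing f \<psi> = f \<psi>"
    by (auto simp: W12_extension_iff dist_eq_def)
qed

lemma norm_W12_pos:
  assumes "W12 u" "\<not> (AE t in lebesgue. u t = 0)" shows "0 < norm_W12 u"
proof -
  obtain v where v: "weak_deriv u v" "L2 u" using W12E[OF assms(1)] by blast
  have "norm_L2 u \<noteq> 0"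
    using assms(2) integral_nonneg_eq_0_iff_AE[OF L2_integrable[OF v(2)]] by (simp add: norm_L2_def)
  then have "0 < norm_L2 u" using norm_L2_nonneg[of u] by linarith
  with norm_L2_le_norm_W12(1)[OF v(1)] show ?thesis by linarith
qed

text \<open>The supremum ranges only over functions that are not almost everywhere zero; for the
  others both sides vanish by continuity of the functional.\<close>

lemma norm_Wm12_upper:
  assumes "Wm12 f" "W12 u"
  shows "norm (W12_pairing f u) \<le> norm_Wm12 f * norm_W12 u"
proof -
  obtain B where B: "0 \<le> B" "\<And>u. W12 u \<Longrightarrow> norm (W12_pairing f u) \<le> B * norm_W12 u"
    using W12_functional_bound[OF W12_pairing(1)[OF assms(1)]] by blast
  show ?thesis
  proof (cases "AE t in lebesgue. u t = 0")
    case True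
    have "norm_W12 u = 0"
      using norm_W12_AE_zero[OF _ True] assms(2) L2_measurable by (auto simp: W12_def)
    with B(2)[OF assms(2)] show ?thesis by simp
  next
    case False
    have "bdd_above ((\<lambda>u. norm (W12_pairing f u) / norm_W12 u) ` {u. W12 u \<and> \<not> (AE t in lebesgue. u t = 0)})"
      using B norm_W12_pos by (auto intro!: bdd_aboveI[of _ B] simp: pos_divide_le_eq)
    then have "norm (W12_pairing f u) / norm_W12 u \<le> norm_Wm12 f"
      unfolding norm_Wm12_def using False assms(2) by (intro cSUP_upper) auto
    then show ?thesis using norm_W12_pos[OF assms(2) False] by (simp add: pos_divide_le_eq)
  qed
qed

text \<open>Shows that the index set of the supremum in \<open>norm_Wm12\<close> is nonempty,
  without which the supremum would carry no information.\<close>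

lemma not_AE_zero_plateau: "\<not> (AE t in lebesgue. plateau 0 1 t = 0)"
proof
  assume "AE t in lebesgue. plateau 0 1 t = 0"
  then have "AE t in lebesgue. t \<notin> {0..1::real}" by (rule AE_mp) (auto simp: plateau_eq_1)
  then have "emeasure lebesgue {t \<in> space lebesgue. t \<in> {0..1::real}} = 0" by (rule emeasure_eq_0_AE)
  moreover have "{t \<in> space lebesgue. t \<in> {0..1::real}} = {0..1}" by auto
  ultimately show False by (simp add: emeasure_lborel_Icc_eq)
qed

lemma norm_Wm12_least:
  assumes "\<And>u. W12 u \<Longrightarrow> norm (W12_pairing f u) \<le> B * norm_W12 u"
  shows "norm_Wm12 f \<le> B"
  unfolding norm_Wm12_def
proof (rule cSUP_least)
  show "{u. W12 u \<and> \<not> (AE t in lebesgue. u t = 0)} \<noteq> {}"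
    using not_AE_zero_plateau weak_deriv_test_fun(2)[OF test_fun_plateau] by blast
  show "norm (W12_pairing f u) / norm_W12 u \<le> B" if "u \<in> {u. W12 u \<and> \<not> (AE t in lebesgue. u t = 0)}" for u
    using assms[of u] norm_W12_pos[of u] that by (simp add: pos_divide_le_eq)
qed

lemma norm_Wm12_nonneg:
  assumes "Wm12 f" shows "0 \<le> norm_Wm12 f"
proof -
  have "W12 (plateau 0 1)" by (intro weak_deriv_test_fun test_fun_plateau)
  with norm_Wm12_upper[OF assms this] norm_W12_pos[OF this not_AE_zero_plateau]
  show ?thesis using norm_ge_zero order_trans zero_le_mult_iff by (metis not_le)
qed

lemma norm_W12_mult_test_fun_le:
  assumes \<eta>: "test_fun \<eta>"
  obtains C where "\<And>u. W12 u \<Longrightarrow> norm_W12 (\<lambda>t. \<eta> t * u t) \<le> C * norm_W12 u"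
proof -
  note d = test_fun_vderiv[OF \<eta>]
  obtain B where B: "B > 0" "\<And>t. norm (\<eta> t) \<le> B" using test_fun_bounded[OF \<eta>] by blast
  obtain K where K: "K > 0" "\<And>t. norm (vderiv \<eta> t) \<le> K" using test_fun_bounded[OF d] by blast
  have "norm_W12 (\<lambda>t. \<eta> t * u t) \<le> (B + K + B) * norm_W12 u" if "W12 u" for u
  proof -
    obtain v where v: "weak_deriv u v" "L2 u" "L2 v" using W12E[OF \<open>W12 u\<close>] by blast
    note b = L2_bounded_mult[OF v(2) test_fun_measurable[OF \<eta>] B(2)]
      L2_bounded_mult[OF v(2) test_fun_measurable[OF d] K(2)]
      L2_bounded_mult[OF v(3) test_fun_measurable[OF \<eta>] B(2)]
    have "norm_W12 (\<lambda>t. \<eta> t * u t) \<le> B * norm_L2 u + (K * norm_L2 u + B * norm_L2 v)"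
      using norm_W12_le[OF W12_mult_test_fun(1)[OF v(1,2) \<eta>]] norm_L2_triangle[OF b(3) b(5)] b(2,4,6)
      by linarith
    also have "\<dots> \<le> B * norm_W12 u + (K * norm_W12 u + B * norm_W12 u)"
      using norm_L2_le_norm_W12[OF v(1)] B K by (intro add_mono mult_left_mono) auto
    finally show ?thesis by (simp add: algebra_simps)
  qed
  then show ?thesis by (rule that)
qed

lemma W12_functional_mult_test_fun:
  assumes F: "W12_functional F" and \<eta>: "test_fun \<eta>"
  shows "W12_functional (\<lambda>u. F (\<lambda>t. \<eta> t * u t))"
proof -
  have W: "W12 (\<lambda>t. \<eta> t * u t)" if "W12 u" for u
    using W12E[OF that] W12_mult_test_fun(2)[OF _ _ \<eta>] by metis
  obtain C where C: "\<And>u. W12 u \<Longrightarrow> norm_W12 (\<lambda>t. \<eta> t * u t) \<le> C * norm_W12 u"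
    using norm_W12_mult_test_fun_le[OF \<eta>] by blast
  obtain B where B: "0 \<le> B" "\<And>u. W12 u \<Longrightarrow> norm (F u) \<le> B * norm_W12 u"
    using W12_functional_bound[OF F] by blast
  have "norm (F (\<lambda>t. \<eta> t * u t)) \<le> (B * C) * norm_W12 u" if "W12 u" for u
    using B(2)[OF W[OF that]] mult_left_mono[OF C[OF that] B(1)] by (simp add: mult.assoc)
  then show ?thesis
    unfolding W12_functional_def distrib_left mult.left_commute[of "\<eta> _"]
    using W12_functional_add[OF F W W] W12_functional_cmult[OF F W] by blast
qed

lemma Wm12_loc_mult: "Wm12_loc f \<Longrightarrow> test_fun \<eta> \<Longrightarrow> Wm12 (dist_mult f \<eta>)"
  by (simp add: Wm12_loc_def)

text \<open>Both sides are continuous functionals of \<open>u\<close>, and on test functions they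
  agree because \<open>\<theta>\<close> is 1 wherever \<open>\<eta>\<close> is nonzero. This is the
  independence of \<open>loc_pairing\<close> from the cutoff.\<close>

lemma W12_pairing_dist_mult_change:
  assumes f: "Wm12_loc f" and \<eta>: "test_fun \<eta>" "test_fun \<theta>" "\<And>t. \<theta> t * \<eta> t = \<eta> t" and u: "W12 u"
  shows "W12_pairing (dist_mult f \<eta>) u = W12_pairing (dist_mult f \<theta>) (\<lambda>t. \<eta> t * u t)"
proof (rule W12_functional_unique[OF W12_pairing(1) W12_functional_mult_test_fun[OF W12_pairing(1)] _ u])
  fix \<psi> assume \<psi>: "test_fun \<psi>"
  have "W12_pairing (dist_mult f \<theta>) (\<lambda>t. \<eta> t * \<psi> t) = f (\<lambda>t. \<theta> t * (\<eta> t * \<psi> t))"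
    using W12_pairing(2)[OF Wm12_loc_mult[OF f \<eta>(2)] test_fun_mult[OF \<eta>(1) \<psi>]] by (simp add: dist_mult_def)
  also have "\<dots> = f (\<lambda>t. \<eta> t * \<psi> t)" by (simp add: \<eta>(3) flip: mult.assoc)
  also have "\<dots> = W12_pairing (dist_mult f \<eta>) \<psi>"
    using W12_pairing(2)[OF Wm12_loc_mult[OF f \<eta>(1)] \<psi>] by (simp add: dist_mult_def)
  finally show "W12_pairing (dist_mult f \<eta>) \<psi> = W12_pairing (dist_mult f \<theta>) (\<lambda>t. \<eta> t * \<psi> t)" by simp
qed (intro Wm12_loc_mult f \<eta>)+

text \<open>Trades the unknown cutoff chosen by \<open>SOME\<close> for an explicit one. Every
  sufficiently large \<open>S\<close> is allowed, so that finitely many pairings can later share a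
  single plateau.\<close>

lemma loc_pairing_eq_plateau:
  assumes f: "Wm12_loc f" and u: "W12 u" and supp: "\<And>t. R < \<bar>t\<bar> \<Longrightarrow> u t = 0"
  obtains S0 where "\<And>S. S0 \<le> S \<Longrightarrow> loc_pairing f u = W12_pairing (dist_mult f (plateau (-S) S)) u"
proof -
  have supp_sub: "supp u \<subseteq> {-\<bar>R\<bar>..\<bar>R\<bar>}"
    unfolding supp_def by (rule closure_minimal) (use supp in \<open>auto simp: abs_le_iff not_less [symmetric]\<close>)
  \<comment> \<open>An actual cutoff must be exhibited before anything is known about the chosen
    one.\<close>
  have "cutoff u (plateau (-\<bar>R\<bar> - 1) (\<bar>R\<bar> + 1))"
    unfolding cutoff_def
  proof (intro conjI exI test_fun_plateau)
    show "open {-\<bar>R\<bar> - 1<..<\<bar>R\<bar> + 1}" by simp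
    show "supp u \<subseteq> {-\<bar>R\<bar> - 1<..<\<bar>R\<bar> + 1}" using supp_sub by force
    show "\<forall>t\<in>{-\<bar>R\<bar> - 1<..<\<bar>R\<bar> + 1}. plateau (-\<bar>R\<bar> - 1) (\<bar>R\<bar> + 1) t = 1" by (auto simp: plateau_eq_1)
  qed
  then have cut: "cutoff u (SOME \<eta>. cutoff u \<eta>)" using someI[of "cutoff u"] by blast
  define \<eta> where "\<eta> = (SOME \<eta>. cutoff u \<eta>)"
  have \<eta>: "test_fun \<eta>" using cut by (simp add: cutoff_def \<eta>_def)
  have \<eta>u: "(\<lambda>t. \<eta> t * u t) = u"
  proof
    fix t
    have "\<eta> t = 1" if "u t \<noteq> 0"
    proof -
      have "t \<in> supp u" using that closure_subset by (force simp: supp_def)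
      then show ?thesis using cut by (auto simp: cutoff_def \<eta>_def)
    qed
    then show "\<eta> t * u t = u t" by fastforce
  qed
  obtain S0 where S0: "S0 > 0" "\<And>t. S0 < \<bar>t\<bar> \<Longrightarrow> \<eta> t = 0" using test_fun_bounded_support[OF \<eta>] by blast
  have "loc_pairing f u = W12_pairing (dist_mult f (plateau (-S) S)) u" if "S0 \<le> S" for S
  proof -
    have "plateau (-S) S t * \<eta> t = \<eta> t" for t
      using S0(2)[of t] that by (cases "S0 < \<bar>t\<bar>") (auto simp: plateau_eq_1)
    from W12_pairing_dist_mult_change[OF f \<eta> test_fun_plateau this u]
    show ?thesis by (simp add: loc_pairing_def \<eta>u flip: \<eta>_def)
  qed
  then show ?thesis by (rule that)
qed

section \<open>The functions \<open>phi_n\<close> as a partition of unity\<close>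

definition dphi :: "real \<Rightarrow> real" where
  "dphi t = 4 * max 0 (t + 1) - 8 * max 0 (t + 1 / 2) + 8 * max 0 (t - 1 / 2) - 4 * max 0 (t - 1)"

text \<open>\<open>phi\<close> is a quadratic spline with knots -1, -1/2, 1/2 and 1; the
  coefficients are half the jumps 4, -8, 8, -4 of its second derivative. In this form it can be
  differentiated without treating the knots separately.\<close>

lemma phi_eq_truncated_powers:
  "phi t = 2 * (max 0 (t + 1))\<^sup>2 - 4 * (max 0 (t + 1 / 2))\<^sup>2 + 4 * (max 0 (t - 1 / 2))\<^sup>2 - 2 * (max 0 (t - 1))\<^sup>2"
  by (auto simp: phi_def max_def power2_eq_square algebra_simps)

lemma truncated_square_has_derivative:
  "((\<lambda>t. (max 0 (t - a))\<^sup>2) has_real_derivative 2 * max 0 (t - a)) (at t)" for a t :: real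
proof -
  consider "t < a" | "t = a" | "a < t" by linarith
  then show ?thesis
  proof cases
    case 1
    have "((\<lambda>_. 0) has_real_derivative 2 * max 0 (t - a)) (at t)" using 1 by (simp add: max_def)
    then show ?thesis
      by (rule has_field_derivative_transform_within_open[of _ _ _ "{..<a}"]) (use 1 in \<open>auto simp: max_def\<close>)
  next
    case 2
    have "((\<lambda>h. ((max 0 (a + h - a))\<^sup>2 - (max 0 (a - a))\<^sup>2) / h) \<longlongrightarrow> 0) (at 0)"
    proof (rule Lim_null_comparison[OF always_eventually])
      show "\<forall>h. norm (((max 0 (a + h - a))\<^sup>2 - (max 0 (a - a))\<^sup>2) / h) \<le> \<bar>h\<bar>"
        by (auto simp: max_def power2_eq_square)
      show "((\<lambda>h::real. \<bar>h\<bar>) \<longlongrightarrow> 0) (at 0)" using tendsto_rabs[OF tendsto_ident_at, of 0 UNIV] by simp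
    qed
    then show ?thesis using 2 by (simp add: DERIV_def)
  next
    case 3
    have "((\<lambda>t. (t - a)\<^sup>2) has_real_derivative 2 * max 0 (t - a)) (at t)"
      using 3 by (auto intro!: derivative_eq_intros)
    then show ?thesis
      by (rule has_field_derivative_transform_within_open[of _ _ _ "{a<..}"]) (use 3 in \<open>auto simp: max_def\<close>)
  qed
qed

lemma phi_has_derivative: "(phi has_real_derivative dphi t) (at t)"
proof -
  have "((\<lambda>t. 2 * (max 0 (t - (-1)))\<^sup>2 - 4 * (max 0 (t - (-1/2)))\<^sup>2 + 4 * (max 0 (t - 1/2))\<^sup>2 - 2 * (max 0 (t - 1))\<^sup>2)
      has_real_derivative 2 * (2 * max 0 (t - (-1))) - 4 * (2 * max 0 (t - (-1/2))) + 4 * (2 * max 0 (t - 1/2))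
        - 2 * (2 * max 0 (t - 1))) (at t)"
    by (intro DERIV_diff DERIV_add DERIV_cmult truncated_square_has_derivative)
  moreover have "phi = (\<lambda>t. 2 * (max 0 (t - (-1)))\<^sup>2 - 4 * (max 0 (t - (-1/2)))\<^sup>2 + 4 * (max 0 (t - 1/2))\<^sup>2 - 2 * (max 0 (t - 1))\<^sup>2)"
    by (simp add: fun_eq_iff phi_eq_truncated_powers)
  ultimately show ?thesis by (simp add: dphi_def)
qed

lemma abs_phi_le: "\<bar>phi t\<bar> \<le> 1"
proof -
  have "0 \<le> x\<^sup>2 \<and> x\<^sup>2 \<le> 1/4" if "-1/2 \<le> x" "x \<le> 1/2" for x :: real
    using that abs_le_square_iff[of x "1/2"] by (auto simp: power2_eq_square)
  from this[of t] this[of "t + 1"] this[of "t - 1"] show ?thesis by (auto simp: phi_def)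
qed

lemma abs_dphi_le: "\<bar>dphi t\<bar> \<le> 2"
  by (auto simp: dphi_def max_def)

lemma phi_outside: "1 \<le> \<bar>t\<bar> \<Longrightarrow> phi t = 0" and dphi_outside: "1 \<le> \<bar>t\<bar> \<Longrightarrow> dphi t = 0"
  by (auto simp: phi_def dphi_def max_def)

lemma continuous_dphi: "continuous_on UNIV dphi"
  unfolding dphi_def by (intro continuous_intros)

definition dphi_n :: "int \<Rightarrow> real \<Rightarrow> complex" where
  "dphi_n n t = complex_of_real (dphi (t - of_int n))"

lemma phi_n_has_derivative: "(phi_n n has_vector_derivative dphi_n n t) (at t)"
proof -
  have "((\<lambda>t. phi (t - of_int n)) has_real_derivative dphi (t - of_int n) * 1) (at t)"
    by (rule DERIV_chain2[OF phi_has_derivative]) (auto intro!: derivative_eq_intros)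
  then show ?thesis
    unfolding phi_n_def[abs_def] dphi_n_def by (auto dest: has_vector_derivative_of_real)
qed

lemma phi_n_le: "norm (phi_n n t) \<le> 1" and dphi_n_le: "norm (dphi_n n t) \<le> 2"
  by (simp_all add: phi_n_def dphi_n_def abs_phi_le abs_dphi_le)

lemma phi_n_outside: "1 \<le> \<bar>t - of_int n\<bar> \<Longrightarrow> phi_n n t = 0"
  and dphi_n_outside: "1 \<le> \<bar>t - of_int n\<bar> \<Longrightarrow> dphi_n n t = 0"
  by (simp_all add: phi_n_def dphi_n_def phi_outside dphi_outside)

lemma continuous_phi_n: "continuous_on UNIV (phi_n n)" and continuous_dphi_n: "continuous_on UNIV (dphi_n n)"
proof -
  show "continuous_on UNIV (phi_n n)"
    by (meson continuous_at_imp_continuous_on has_vector_derivative_continuous phi_n_has_derivative)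
  show "continuous_on UNIV (dphi_n n)"
    unfolding dphi_n_def[abs_def]
    by (intro continuous_intros continuous_on_compose2[OF continuous_dphi]) auto
qed

text \<open>Only the two integers next to \<open>t\<close> contribute, and
  \<open>phi x + phi (x - 1) = 1\<close> on \<open>[0, 1)\<close>.\<close>

lemma phi_n_partition_of_unity:
  assumes "finite A" "{\<lfloor>t\<rfloor>, \<lfloor>t\<rfloor> + 1} \<subseteq> A"
  shows "(\<Sum>n\<in>A. phi_n n t) = 1"
proof -
  have "(\<Sum>n\<in>A. phi_n n t) = (\<Sum>n\<in>{\<lfloor>t\<rfloor>, \<lfloor>t\<rfloor> + 1}. phi_n n t)"
  proof (intro sum.mono_neutral_right assms ballI)
    fix n assume "n \<in> A - {\<lfloor>t\<rfloor>, \<lfloor>t\<rfloor> + 1}"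
    then have "n < \<lfloor>t\<rfloor> \<or> \<lfloor>t\<rfloor> + 1 < n" by auto
    then have "1 \<le> \<bar>t - of_int n\<bar>" by linarith
    then show "phi_n n t = 0" by (rule phi_n_outside)
  qed
  also have "\<dots> = complex_of_real (phi (frac t) + phi (frac t - 1))"
    by (simp add: phi_n_def frac_def algebra_simps)
  also have "phi (frac t) + phi (frac t - 1) = 1"
  proof -
    have "phi x + phi (x - 1) = 1" if "0 \<le> x" "x < 1" for x
      using that by (auto simp: phi_def power2_eq_square algebra_simps)
    then show ?thesis by (simp add: frac_lt_1)
  qed
  finally show ?thesis by simp
qed

lemma phi_n_mult_test_fun:
  assumes "test_fun \<psi>"
  shows "weak_deriv (\<lambda>t. phi_n n t * \<psi> t) (\<lambda>t. phi_n n t * vderiv \<psi> t + dphi_n n t * \<psi> t)"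
    and "W12 (\<lambda>t. phi_n n t * \<psi> t)"
proof -
  have *: "((\<lambda>t. phi_n n t * \<psi> t) has_vector_derivative phi_n n t * vderiv \<psi> t + dphi_n n t * \<psi> t) (at t)" for t
    by (intro has_vector_derivative_mult phi_n_has_derivative test_fun_has_derivative assms)
  have **: "continuous_on UNIV (\<lambda>t. phi_n n t * vderiv \<psi> t + dphi_n n t * \<psi> t)"
    by (intro continuous_intros continuous_phi_n continuous_dphi_n test_fun_continuous test_fun_vderiv assms)
  have ***: "phi_n n t * \<psi> t = 0" if "\<bar>real_of_int n\<bar> + 1 < \<bar>t\<bar>" for t
    using phi_n_outside[of t n] that by auto
  show "weak_deriv (\<lambda>t. phi_n n t * \<psi> t) (\<lambda>t. phi_n n t * vderiv \<psi> t + dphi_n n t * \<psi> t)"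
    by (rule weak_deriv_classical(1)[OF * **]) (rule ***)
  show "W12 (\<lambda>t. phi_n n t * \<psi> t)"
    by (rule weak_deriv_classical(2)[OF * **]) (rule ***)
qed

lemma mult_phi_eq_plateau:
  assumes "Wm12_loc f" "test_fun \<psi>"
  obtains S0 where "\<And>S. S0 \<le> S \<Longrightarrow>
    mult_phi f n \<psi> = W12_pairing (dist_mult f (plateau (-S) S)) (\<lambda>t. phi_n n t * \<psi> t)"
proof -
  have "phi_n n t * \<psi> t = 0" if "\<bar>real_of_int n\<bar> + 1 < \<bar>t\<bar>" for t
    using phi_n_outside[of t n] that by auto
  from loc_pairing_eq_plateau[OF assms(1) phi_n_mult_test_fun(2)[OF assms(2)] this]
  show ?thesis using that unfolding mult_phi_def by blast
qed

text \<open>The summands \<open>phi_n n t * \<psi> t\<close> are not test functions, so additivity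
  of \<open>f\<close> says nothing about them. Choosing one plateau that works for all relevant
  \<open>n\<close> and is 1 on the support of \<open>\<psi>\<close> turns every term into a value of
  the same functional \<open>P\<close>, which is additive on \<open>W12\<close>.\<close>

lemma Wm12_loc_eq_sum_mult_phi:
  assumes f: "Wm12_loc f" and \<psi>: "test_fun \<psi>" and supp: "\<And>t. R < \<bar>t\<bar> \<Longrightarrow> \<psi> t = 0" and N: "R + 1 \<le> of_int N"
  shows "f \<psi> = (\<Sum>n\<in>{-N..N}. mult_phi f n \<psi>)"
proof -
  have "\<exists>S0. \<forall>S\<ge>S0. mult_phi f n \<psi> = W12_pairing (dist_mult f (plateau (-S) S)) (\<lambda>t. phi_n n t * \<psi> t)" for n
    using mult_phi_eq_plateau[OF f \<psi>] by metis
  then obtain S0 where S0: "\<And>n S. S0 n \<le> S \<Longrightarrow>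
      mult_phi f n \<psi> = W12_pairing (dist_mult f (plateau (-S) S)) (\<lambda>t. phi_n n t * \<psi> t)"
    by metis
  define S where "S = Max (insert R (S0 ` {-N..N}))"
  have S: "R \<le> S" "\<And>n. n \<in> {-N..N} \<Longrightarrow> S0 n \<le> S" unfolding S_def by (rule Max_ge; simp)+
  define P where "P = W12_pairing (dist_mult f (plateau (-S) S))"
  note P = W12_pairing[OF Wm12_loc_mult[OF f test_fun_plateau[of "-S" S]], folded P_def]
  have "(\<Sum>n\<in>{-N..N}. mult_phi f n \<psi>) = (\<Sum>n\<in>{-N..N}. P (\<lambda>t. phi_n n t * \<psi> t))"
    unfolding P_def by (intro sum.cong refl S0 S)
  also have "\<dots> = P (\<lambda>t. \<Sum>n\<in>{-N..N}. phi_n n t * \<psi> t)"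
    by (rule W12_functional_sum[OF P(1), symmetric]) (auto intro: phi_n_mult_test_fun \<psi>)
  also have "(\<lambda>t. \<Sum>n\<in>{-N..N}. phi_n n t * \<psi> t) = \<psi>"
  proof
    fix t
    show "(\<Sum>n\<in>{-N..N}. phi_n n t * \<psi> t) = \<psi> t"
    proof (cases "R < \<bar>t\<bar>")
      case False
      \<comment> \<open>The extra 1 in \<open>R + 1 \<le> of_int N\<close> makes room for the
        neighbour \<open>\<lfloor>t\<rfloor> + 1\<close>.\<close>
      then have "- N \<le> \<lfloor>t\<rfloor>" "\<lfloor>t\<rfloor> + 1 \<le> N" using N by linarith+
      then have "{\<lfloor>t\<rfloor>, \<lfloor>t\<rfloor> + 1} \<subseteq> {-N..N}" by auto
      then show ?thesis using phi_n_partition_of_unity[of "{-N..N}" t] by (simp flip: sum_distrib_right)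
    qed (simp add: supp)
  qed
  also have "P \<psi> = f (\<lambda>t. plateau (-S) S t * \<psi> t)" using P(2)[OF \<psi>] by (simp add: dist_mult_def)
  also have "(\<lambda>t. plateau (-S) S t * \<psi> t) = \<psi>"
  proof
    fix t show "plateau (-S) S t * \<psi> t = \<psi> t"
      using supp[of t] S(1) by (cases "R < \<bar>t\<bar>") (auto simp: plateau_eq_1)
  qed
  finally show ?thesis by simp
qed


section \<open>First-order forms\<close>

lemma set_integrable_interval_of_unit:
  fixes g :: "real \<Rightarrow> 'a::{banach, second_countable_topology}"
  assumes "\<And>t. set_integrable lebesgue {t..t + 1} g"
  shows "set_integrable lebesgue {a..b} g"
proof -
  have "set_integrable lebesgue {a..a + real n} g" for n
  proof (induction n)
    case 0
    show ?case by (rule set_integrable_subset[OF assms[of a]]) auto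
  next
    case (Suc n)
    have "set_integrable lebesgue ({a..a + real n} \<union> {a + real n..a + real n + 1}) g"
      by (intro set_integrable_Un Suc assms) auto
    moreover have "{a..a + real n} \<union> {a + real n..a + real n + 1} = {a..a + real (Suc n)}" by auto
    ultimately show ?case by simp
  qed
  moreover obtain n :: nat where "b - a \<le> real n" using real_arch_simple by blast
  then have "{a..b} \<subseteq> {a..a + real n}" by auto
  ultimately show ?thesis using set_integrable_subset[of lebesgue "{a..a + real n}" g "{a..b}"] by simp
qed

lemma set_integral_two_unit_intervals_le:
  fixes g :: "real \<Rightarrow> real"
  assumes int: "\<And>t. set_integrable lebesgue {t..t + 1} g" and nn: "\<And>t. 0 \<le> g t"
    and bound: "\<And>t. (LINT s:{t..t + 1}|lebesgue. g s) \<le> B"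
  shows "(LINT s:{c - 1..c + 1}|lebesgue. g s) \<le> 2 * B"
proof -
  have i: "set_integrable lebesgue {c - 1..c} g" "set_integrable lebesgue {c..c + 1} g"
      "set_integrable lebesgue {c - 1..c + 1} g"
    using int[of "c - 1"] int[of c] set_integrable_interval_of_unit[OF int] by auto
  have "(LINT s:{c - 1..c + 1}|lebesgue. g s) \<le>
      (LINT s|lebesgue. indicator {c - 1..c} s *\<^sub>R g s + indicator {c..c + 1} s *\<^sub>R g s)"
    unfolding set_lebesgue_integral_def
    by (rule integral_mono) (use i nn in \<open>auto simp: set_integrable_def indicator_def\<close>)
  also have "\<dots> = (LINT s:{c - 1..c}|lebesgue. g s) + (LINT s:{c..c + 1}|lebesgue. g s)"
    unfolding set_lebesgue_integral_def
    by (rule Bochner_Integration.integral_add) (use i in \<open>auto simp: set_integrable_def\<close>)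
  finally show ?thesis using bound[of "c - 1"] bound[of c] by simp
qed

lemma L2_unif_integral_le:
  assumes "L2_unif \<sigma>"
  shows "(LINT s:{t..t + 1}|lebesgue. (norm (\<sigma> s))\<^sup>2) \<le> (norm_L2_unif \<sigma>)\<^sup>2" "0 \<le> norm_L2_unif \<sigma>"
proof -
  have le: "(LINT s:{t..t + 1}|lebesgue. (norm (\<sigma> s))\<^sup>2) \<le> (SUP t. LINT s:{t..t + 1}|lebesgue. (norm (\<sigma> s))\<^sup>2)" for t
    using assms by (intro cSUP_upper) (auto simp: L2_unif_def)
  have "0 \<le> (LINT s:{t..t + 1}|lebesgue. (norm (\<sigma> s))\<^sup>2)" for t
    unfolding set_lebesgue_integral_def by (intro Bochner_Integration.integral_nonneg) auto
  from order_trans[OF this le] have "0 \<le> (SUP t. LINT s:{t..t + 1}|lebesgue. (norm (\<sigma> s))\<^sup>2)" .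
  with le[of t] show "(LINT s:{t..t + 1}|lebesgue. (norm (\<sigma> s))\<^sup>2) \<le> (norm_L2_unif \<sigma>)\<^sup>2" "0 \<le> norm_L2_unif \<sigma>"
    unfolding norm_L2_unif_def by simp_all
qed

lemma L1_unif_integral_le:
  assumes "L1_unif \<tau>"
  shows "(LINT s:{t..t + 1}|lebesgue. norm (\<tau> s)) \<le> norm_L1_unif \<tau>" "0 \<le> norm_L1_unif \<tau>"
proof -
  have le: "(LINT s:{t..t + 1}|lebesgue. norm (\<tau> s)) \<le> norm_L1_unif \<tau>" for t
    unfolding norm_L1_unif_def using assms by (intro cSUP_upper) (auto simp: L1_unif_def)
  have "0 \<le> (LINT s:{t..t + 1}|lebesgue. norm (\<tau> s))" for t
    unfolding set_lebesgue_integral_def by (intro Bochner_Integration.integral_nonneg) auto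
  from order_trans[OF this le] show "0 \<le> norm_L1_unif \<tau>" .
  show "(LINT s:{t..t + 1}|lebesgue. norm (\<tau> s)) \<le> norm_L1_unif \<tau>" by (rule le)
qed

text \<open>The first part serves smooth cutoffs of arbitrary size; the second is for windows of
  length 2 such as those of \<open>phi_n\<close>, which are covered by two unit intervals. The
  resulting factor \<open>sqrt 2\<close> is rounded up to 2.\<close>

lemma L2_unif_mult_bounded_support:
  assumes \<sigma>: "L2_unif \<sigma>" and w: "w \<in> borel_measurable lebesgue" "\<And>t. norm (w t) \<le> A * indicator {a..b} t"
  shows "L2 (\<lambda>t. \<sigma> t * w t)"
    and "0 \<le> A \<Longrightarrow> {a..b} = {c - 1..c + 1} \<Longrightarrow> norm_L2 (\<lambda>t. \<sigma> t * w t) \<le> 2 * A * norm_L2_unif \<sigma>"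
proof -
  have int: "set_integrable lebesgue {t..t + 1} (\<lambda>s. (norm (\<sigma> s))\<^sup>2)" for t
    using \<sigma> by (auto simp: L2_unif_def)
  have i: "integrable lebesgue (\<lambda>s. A\<^sup>2 * (indicator {a..b} s *\<^sub>R (norm (\<sigma> s))\<^sup>2))"
    using set_integrable_interval_of_unit[OF int, of a b] unfolding set_integrable_def by simp
  have le: "(norm (\<sigma> t * w t))\<^sup>2 \<le> A\<^sup>2 * (indicator {a..b} t *\<^sub>R (norm (\<sigma> t))\<^sup>2)" for t
  proof (cases "t \<in> {a..b}")
    case True
    have "(norm (w t))\<^sup>2 \<le> A\<^sup>2" using w(2)[of t] True by (intro power_mono) auto
    then have "(norm (\<sigma> t))\<^sup>2 * (norm (w t))\<^sup>2 \<le> (norm (\<sigma> t))\<^sup>2 * A\<^sup>2" by (intro mult_left_mono) auto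
    then show ?thesis using True by (simp add: norm_mult power_mult_distrib mult.commute)
  qed (use w(2)[of t] in auto)
  have m: "(\<lambda>t. \<sigma> t * w t) \<in> borel_measurable lebesgue"
    using \<sigma> w(1) unfolding L2_unif_def by (intro borel_measurable_times) auto
  have i2: "integrable lebesgue (\<lambda>t. (norm (\<sigma> t * w t))\<^sup>2)"
    by (rule Bochner_Integration.integrable_bound[OF i])
       (use m le in \<open>auto intro!: borel_measurable_power borel_measurable_norm\<close>)
  then show "L2 (\<lambda>t. \<sigma> t * w t)" using m by (simp add: L2_def)
  assume A: "0 \<le> A" and ab: "{a..b} = {c - 1..c + 1}"
  have "(norm_L2 (\<lambda>t. \<sigma> t * w t))\<^sup>2 \<le> (LINT s|lebesgue. A\<^sup>2 * (indicator {a..b} s *\<^sub>R (norm (\<sigma> s))\<^sup>2))"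
    unfolding norm_L2_power2 by (rule integral_mono[OF i2 i le])
  also have "\<dots> = A\<^sup>2 * (LINT s:{c - 1..c + 1}|lebesgue. (norm (\<sigma> s))\<^sup>2)"
    unfolding set_lebesgue_integral_def ab by (rule integral_mult_right_zero)
  also have "\<dots> \<le> A\<^sup>2 * (2 * (norm_L2_unif \<sigma>)\<^sup>2)"
    by (intro mult_left_mono set_integral_two_unit_intervals_le int L2_unif_integral_le \<sigma>) auto
  also have "\<dots> \<le> (2 * A * norm_L2_unif \<sigma>)\<^sup>2"
    by (simp add: power_mult_distrib)
  finally show "norm_L2 (\<lambda>t. \<sigma> t * w t) \<le> 2 * A * norm_L2_unif \<sigma>"
    by (rule power2_le_imp_le) (use A L2_unif_integral_le(2)[OF \<sigma>] in auto)
qed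

lemma L1_unif_mult_bounded_support:
  assumes \<tau>: "L1_unif \<tau>" and w: "w \<in> borel_measurable lebesgue" "\<And>t. norm (w t) \<le> A * indicator {a..b} t"
  shows "integrable lebesgue (\<lambda>t. \<tau> t * w t)"
    and "0 \<le> A \<Longrightarrow> {a..b} = {c - 1..c + 1} \<Longrightarrow> (LINT t|lebesgue. norm (\<tau> t * w t)) \<le> 2 * A * norm_L1_unif \<tau>"
proof -
  have int: "set_integrable lebesgue {t..t + 1} (\<lambda>s. norm (\<tau> s))" for t
    using \<tau> by (auto simp: L1_unif_def)
  have i: "integrable lebesgue (\<lambda>s. A * (indicator {a..b} s *\<^sub>R norm (\<tau> s)))"
    using set_integrable_interval_of_unit[OF int, of a b] unfolding set_integrable_def by simp
  have le: "norm (\<tau> t * w t) \<le> A * (indicator {a..b} t *\<^sub>R norm (\<tau> t))" for t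
    using mult_left_mono[OF w(2)[of t] norm_ge_zero, of "\<tau> t"] by (simp add: norm_mult algebra_simps)
  have m: "(\<lambda>t. \<tau> t * w t) \<in> borel_measurable lebesgue"
    using \<tau> w(1) unfolding L1_unif_def by (intro borel_measurable_times) auto
  show i2: "integrable lebesgue (\<lambda>t. \<tau> t * w t)"
    by (rule Bochner_Integration.integrable_bound[OF i m])
       (use le abs_ge_self order_trans in \<open>fastforce simp del: norm_mult\<close>)
  assume A: "0 \<le> A" and ab: "{a..b} = {c - 1..c + 1}"
  have "(LINT t|lebesgue. norm (\<tau> t * w t)) \<le> (LINT s|lebesgue. A * (indicator {a..b} s *\<^sub>R norm (\<tau> s)))"
    by (rule integral_mono[OF integrable_norm[OF i2] i le])
  also have "\<dots> = A * (LINT s:{c - 1..c + 1}|lebesgue. norm (\<tau> s))"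
    unfolding set_lebesgue_integral_def ab by (rule integral_mult_right_zero)
  also have "\<dots> \<le> A * (2 * norm_L1_unif \<tau>)"
    by (intro mult_left_mono set_integral_two_unit_intervals_le int L1_unif_integral_le \<tau> A) auto
  finally show "(LINT t|lebesgue. norm (\<tau> t * w t)) \<le> 2 * A * norm_L1_unif \<tau>" by simp
qed

text \<open>The Sobolev embedding into bounded functions, needed to pair \<open>W12\<close> with
  integrable densities. Near an integer \<open>u\<close> is \<open>d + prim c v t\<close>: the
  primitive is at most \<open>norm_L2 v\<close>, and integrating over a window of length 2 gives
  \<open>norm d \<le> norm_L2 u + norm_L2 v\<close>. The three terms account for the 3.\<close>

lemma W12_sup_bound:
  assumes v: "weak_deriv u v" "L2 u"
  shows "AE t in lebesgue. norm (u t) \<le> 3 * norm_W12 u"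
proof -
  note v2 = weak_deriv_L2[OF v(1)]
  have "AE t in lebesgue. \<bar>t - of_int n\<bar> \<le> 1 \<longrightarrow> norm (u t) \<le> 3 * norm_W12 u" for n :: int
  proof -
    define c where "c = real_of_int n"
    define I where "I = (indicator {c - 1..c + 1} :: real \<Rightarrow> complex)"
    obtain d where d: "AE t in lebesgue. u t = d + prim c v t"
      using weak_deriv_imp_prim[OF L2_locally_integrable[OF v(2)] v(1)] by blast
    have p: "norm (prim c v t) \<le> norm_L2 v" if "\<bar>t - c\<bar> \<le> 1" for t
    proof -
      have "norm (prim c v t) \<le> sqrt \<bar>t - c\<bar> * norm_L2 v" by (rule norm_prim_le[OF v2])
      also have "\<dots> \<le> 1 * norm_L2 v" using that by (intro mult_right_mono) auto
      finally show ?thesis by simp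
    qed
    have Im: "I \<in> borel_measurable lebesgue" unfolding I_def by (rule borel_measurable_indicator) simp
    have I1: "norm (I t) \<le> 1" for t by (simp add: I_def indicator_def)
    have nI: "norm_L2 I = sqrt 2"
    proof -
      have "(\<lambda>t. (norm (I t))\<^sup>2) = (indicator {c - 1..c + 1} :: real \<Rightarrow> real)"
        by (auto simp: I_def indicator_def)
      then show ?thesis by (simp add: norm_L2_def measure_lborel_Icc)
    qed
    have pm: "(\<lambda>t. I t * prim c v t) \<in> borel_measurable lebesgue"
      by (intro borel_measurable_times Im continuous_imp_lebesgue_measurable continuous_prim v2)
    have pI: "norm (I t * prim c v t) \<le> norm_L2 v * indicator {c - 1..c + 1} t" for t
      using p[of t] by (auto simp: I_def indicator_def)
    note pL = norm_L2_bounded_support[OF pm pI _ norm_L2_nonneg]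
    have "norm_L2 (\<lambda>t. d * I t) = norm_L2 (\<lambda>t. I t * u t + (-1) * (I t * prim c v t))"
      unfolding norm_L2_def
    proof (intro arg_cong[where f = sqrt] integral_cong_AE)
      show "AE t in lebesgue. (norm (d * I t))\<^sup>2 = (norm (I t * u t + (-1) * (I t * prim c v t)))\<^sup>2"
        using d by (rule AE_mp) (auto simp: algebra_simps)
    qed (use Im pm L2_measurable[OF v(2)] in \<open>auto intro!: borel_measurable_power borel_measurable_norm borel_measurable_times borel_measurable_diff\<close>)
    also have "\<dots> \<le> norm_L2 (\<lambda>t. I t * u t) + norm_L2 (\<lambda>t. (-1) * (I t * prim c v t))"
      by (intro norm_L2_triangle L2_cmult pL L2_bounded_mult(1)[OF v(2) Im I1]) auto
    also have "\<dots> \<le> 1 * norm_L2 u + norm_L2 v * sqrt 2"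
      unfolding norm_L2_cmult using L2_bounded_mult(2)[OF v(2) Im I1] pL(2) by simp
    finally have "norm d * sqrt 2 \<le> norm_L2 u + norm_L2 v * sqrt 2"
      unfolding norm_L2_cmult nI by simp
    also have "\<dots> \<le> norm_L2 u * sqrt 2 + norm_L2 v * sqrt 2"
      using mult_left_mono[of 1 "sqrt 2" "norm_L2 u"] by simp
    finally have "norm d * sqrt 2 \<le> (norm_L2 u + norm_L2 v) * sqrt 2" by (simp add: distrib_right)
    then have "norm d \<le> norm_L2 u + norm_L2 v" by (rule mult_right_le_imp_le) simp
    then have *: "norm (d + prim c v t) \<le> 3 * norm_W12 u" if "\<bar>t - c\<bar> \<le> 1" for t
      using p[OF that] norm_triangle_ineq[of d "prim c v t"] norm_L2_le_norm_W12[OF v(1)] by linarith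
    show ?thesis using d by (rule AE_mp) (use * in \<open>auto simp: c_def\<close>)
  qed
  then have "AE t in lebesgue. \<forall>n :: int. \<bar>t - of_int n\<bar> \<le> 1 \<longrightarrow> norm (u t) \<le> 3 * norm_W12 u"
    by (simp only: AE_all_countable) blast
  then show ?thesis
  proof (rule AE_mp, intro AE_I2 impI)
    fix t assume *: "\<forall>n :: int. \<bar>t - of_int n\<bar> \<le> 1 \<longrightarrow> norm (u t) \<le> 3 * norm_W12 u"
    have "\<bar>t - of_int \<lfloor>t\<rfloor>\<bar> \<le> 1" by linarith
    with * show "norm (u t) \<le> 3 * norm_W12 u" by blast
  qed
qed

text \<open>
  The pairing of \<open>u\<close> with the distribution \<open>q - p + r'\<close>; it depends only on the almost everywhere
  defined weak derivative, hence not on the choice made by \<open>SOME\<close>.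
\<close>

definition first_order_form ::
  "(real \<Rightarrow> complex) \<Rightarrow> (real \<Rightarrow> complex) \<Rightarrow> (real \<Rightarrow> complex) \<Rightarrow> (real \<Rightarrow> complex) \<Rightarrow> complex" where
  "first_order_form p r q u = (LINT t|lebesgue. q t * u t) -
     (LINT t|lebesgue. p t * u t + r t * (SOME v. weak_deriv u v) t)"

lemma first_order_form_eq:
  assumes "L2 p" "L2 r" "integrable lebesgue q" and u: "weak_deriv u v" "L2 u"
  shows "first_order_form p r q u = (LINT t|lebesgue. q t * u t) - ((LINT t|lebesgue. p t * u t) + (LINT t|lebesgue. r t * v t))"
proof -
  have w: "weak_deriv u (SOME v. weak_deriv u v)" (is "weak_deriv u ?w")
    using someI[of "weak_deriv u", OF u(1)] by simp
  note v = weak_deriv_L2[OF u(1)] weak_deriv_L2[OF w]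
  have "(LINT t|lebesgue. r t * ?w t) = (LINT t|lebesgue. r t * v t)"
  proof (rule integral_cong_AE)
    show "AE t in lebesgue. r t * ?w t = r t * v t"
      using weak_deriv_unique[OF w u(1)] by auto
  qed (intro borel_measurable_times L2_measurable assms v)+
  then show ?thesis
    using L2_mult_integrable[OF assms(1) u(2)] L2_mult_integrable[OF assms(2) v(2)]
    by (simp add: first_order_form_def)
qed

lemma integrable_mult_W12:
  assumes q: "integrable lebesgue q" and u: "weak_deriv u v" "L2 u"
  shows "integrable lebesgue (\<lambda>t. q t * u t)"
    "norm (LINT t|lebesgue. q t * u t) \<le> 3 * (LINT t|lebesgue. norm (q t)) * norm_W12 u"
proof -
  have i: "integrable lebesgue (\<lambda>t. norm (q t) * (3 * norm_W12 u))"
    using q by simp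
  have ae: "AE t in lebesgue. norm (q t * u t) \<le> norm (q t) * (3 * norm_W12 u)"
    using W12_sup_bound[OF u] by (rule AE_mp) (auto simp: norm_mult intro!: mult_left_mono)
  show *: "integrable lebesgue (\<lambda>t. q t * u t)"
  proof (rule Bochner_Integration.integrable_bound[OF i])
    show "(\<lambda>t. q t * u t) \<in> borel_measurable lebesgue"
      by (intro borel_measurable_times borel_measurable_integrable[OF q] L2_measurable u)
    show "AE t in lebesgue. norm (q t * u t) \<le> norm (norm (q t) * (3 * norm_W12 u))"
      using ae by (simp add: abs_mult)
  qed
  have "norm (LINT t|lebesgue. q t * u t) \<le> (LINT t|lebesgue. norm (q t * u t))" by (rule integral_norm_bound)
  also have "\<dots> \<le> (LINT t|lebesgue. norm (q t) * (3 * norm_W12 u))"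
    by (rule integral_mono_AE[OF integrable_norm[OF *] i ae])
  finally show "norm (LINT t|lebesgue. q t * u t) \<le> 3 * (LINT t|lebesgue. norm (q t)) * norm_W12 u"
    by (simp add: algebra_simps)
qed

lemma first_order_form_functional:
  assumes p: "L2 p" and r: "L2 r" and q: "integrable lebesgue q"
  shows "W12_functional (first_order_form p r q)"
    and "\<And>u. W12 u \<Longrightarrow> norm (first_order_form p r q u) \<le>
      (norm_L2 p + norm_L2 r + 3 * (LINT t|lebesgue. norm (q t))) * norm_W12 u"
proof -
  note eq = first_order_form_eq[OF assms]
  show bound: "norm (first_order_form p r q u) \<le>
      (norm_L2 p + norm_L2 r + 3 * (LINT t|lebesgue. norm (q t))) * norm_W12 u" if u: "W12 u" for u
  proof -
    obtain v where v: "weak_deriv u v" "L2 u" "L2 v" using W12E[OF u] by blast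
    note n = norm_L2_le_norm_W12[OF v(1)]
    have "norm (LINT t|lebesgue. p t * u t) \<le> norm_L2 p * norm_W12 u"
      using L2_Cauchy_Schwarz[OF p v(2)] mult_left_mono[OF n(1) norm_L2_nonneg[of p]] by linarith
    moreover have "norm (LINT t|lebesgue. r t * v t) \<le> norm_L2 r * norm_W12 u"
      using L2_Cauchy_Schwarz[OF r v(3)] mult_left_mono[OF n(2) norm_L2_nonneg[of r]] by linarith
    moreover note integrable_mult_W12(2)[OF q v(1,2)]
    moreover have "norm (first_order_form p r q u) \<le> norm (LINT t|lebesgue. q t * u t) +
        (norm (LINT t|lebesgue. p t * u t) + norm (LINT t|lebesgue. r t * v t))"
      unfolding eq[OF v(1,2)]
      by (rule order_trans[OF norm_triangle_ineq4 add_left_mono[OF norm_triangle_ineq]])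
    ultimately show ?thesis unfolding distrib_right by linarith
  qed
  show "W12_functional (first_order_form p r q)"
    unfolding W12_functional_def
  proof (intro conjI allI impI exI)
    fix u u' assume "W12 u" "W12 u'"
    then obtain v v' where v: "weak_deriv u v" "L2 u" "L2 v" "locally_integrable u"
        "weak_deriv u' v'" "L2 u'" "L2 v'" "locally_integrable u'" using W12E by metis
    show "first_order_form p r q (\<lambda>t. u t + u' t) = first_order_form p r q u + first_order_form p r q u'"
      unfolding eq[OF weak_deriv_add[OF v(4,1,8,5)] L2_add[OF v(2,6)]] eq[OF v(1,2)] eq[OF v(5,6)]
      using L2_mult_integrable[OF p v(2)] L2_mult_integrable[OF p v(6)] L2_mult_integrable[OF r v(3)]
        L2_mult_integrable[OF r v(7)] integrable_mult_W12(1)[OF q v(1,2)] integrable_mult_W12(1)[OF q v(5,6)]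
      by (simp add: distrib_left)
  next
    fix c u assume "W12 u"
    then obtain v where v: "weak_deriv u v" "L2 u" using W12E by metis
    show "first_order_form p r q (\<lambda>t. c * u t) = c * first_order_form p r q u"
      unfolding eq[OF weak_deriv_cmult[OF v(1)] L2_cmult[OF v(2)]] eq[OF v] mult.left_commute[of _ c]
      by (simp add: right_diff_distrib distrib_left)
  qed (rule bound)
qed


section \<open>Upper estimate and local representation\<close>

lemma norm_phi_n_le_indicator: "norm (phi_n n t) \<le> 1 * indicator {of_int n - 1..of_int n + 1} t"
  and norm_dphi_n_le_indicator: "norm (dphi_n n t) \<le> 2 * indicator {of_int n - 1..of_int n + 1} t"
proof -
  have out: "1 \<le> \<bar>t - of_int n\<bar>" if "t \<notin> {of_int n - 1..of_int n + 1}" using that by auto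
  show "norm (phi_n n t) \<le> 1 * indicator {of_int n - 1..of_int n + 1} t"
    using phi_n_le[of n t] phi_n_outside[OF out] by (cases "t \<in> {of_int n - 1..of_int n + 1}") auto
  show "norm (dphi_n n t) \<le> 2 * indicator {of_int n - 1..of_int n + 1} t"
    using dphi_n_le[of n t] dphi_n_outside[OF out] by (cases "t \<in> {of_int n - 1..of_int n + 1}") auto
qed

lemma plateau_times_phi_n:
  assumes "\<bar>real_of_int n\<bar> + 2 \<le> S"
  shows "plateau (-S) S t * phi_n n t = phi_n n t" "plateau (-S) S t * dphi_n n t = dphi_n n t"
    "vderiv (plateau (-S) S) t * phi_n n t = 0"
proof -
  \<comment> \<open>The margin 2 places the support of \<open>phi_n n\<close> inside the open
    interval \<open>(-S, S)\<close>, where the plateau is 1 with derivative 0.\<close>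
  consider "1 \<le> \<bar>t - of_int n\<bar>" | "t \<in> {-S<..<S}" using assms by fastforce
  then have "(plateau (-S) S t = 1 \<and> vderiv (plateau (-S) S) t = 0) \<or> (phi_n n t = 0 \<and> dphi_n n t = 0)"
  proof cases
    case 2
    then have "plateau (-S) S t = 1" by (auto intro: plateau_eq_1)
    moreover have "vderiv (plateau (-S) S) t = 0"
      by (rule has_vector_derivative_locally_const[OF test_fun_has_derivative[OF test_fun_plateau],
            where U = "{-S<..<S}" and c = 1]) (use 2 in \<open>auto intro: plateau_eq_1\<close>)
    ultimately show ?thesis by simp
  qed (simp add: phi_n_outside dphi_n_outside)
  then show "plateau (-S) S t * phi_n n t = phi_n n t" "plateau (-S) S t * dphi_n n t = dphi_n n t"
    "vderiv (plateau (-S) S) t * phi_n n t = 0" by auto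
qed

text \<open>The hypothesis on \<open>f\<close> speaks only of test functions. It is first used for
  \<open>\<theta> * f\<close> with a smooth plateau \<open>\<theta>\<close>, extended to all of
  \<open>W12\<close> by uniqueness, and only then evaluated at
  \<open>phi_n n t * \<psi> t\<close>.\<close>

lemma mult_phi_first_order:
  assumes f: "Wm12_loc f" and \<sigma>: "L2_unif \<sigma>" and \<tau>: "L1_unif \<tau>"
    and eq: "dist_eq f (dist_add (dist_deriv (dist_of_fun \<sigma>)) (dist_of_fun \<tau>))" and \<psi>: "test_fun \<psi>"
  shows "mult_phi f n \<psi> =
    first_order_form (\<lambda>t. \<sigma> t * dphi_n n t) (\<lambda>t. \<sigma> t * phi_n n t) (\<lambda>t. \<tau> t * phi_n n t) \<psi>"
proof -
  obtain S0 where S0: "\<And>S. S0 \<le> S \<Longrightarrow>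
      mult_phi f n \<psi> = W12_pairing (dist_mult f (plateau (-S) S)) (\<lambda>t. phi_n n t * \<psi> t)"
    using mult_phi_eq_plateau[OF f \<psi>] by blast
  define S where "S = max S0 (\<bar>real_of_int n\<bar> + 2)"
  define \<theta> where "\<theta> = plateau (-S) S"
  have \<theta>: "test_fun \<theta>" by (simp add: \<theta>_def test_fun_plateau)
  note d\<theta> = test_fun_vderiv[OF \<theta>]
  obtain R where R: "\<And>t. R < \<bar>t\<bar> \<Longrightarrow> \<theta> t = 0" using test_fun_bounded_support[OF \<theta>] by blast
  obtain K where K: "\<And>t. norm (vderiv \<theta> t) \<le> K" using test_fun_bounded[OF d\<theta>] by blast
  have b1: "norm (\<theta> t) \<le> 1 * indicator {-R..R} t" for t
    using norm_plateau_le R[of t] by (cases "R < \<bar>t\<bar>") (auto simp: \<theta>_def indicator_def)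
  have d0: "vderiv \<theta> t = 0" if "R < \<bar>t\<bar>" for t
    by (rule vderiv_eq_0[OF test_fun_has_derivative[OF \<theta>] R that])
  have b2: "norm (vderiv \<theta> t) \<le> K * indicator {-R..R} t" for t
    using K[of t] d0[of t] by (cases "R < \<bar>t\<bar>") (auto simp: indicator_def)
  note L = L2_unif_mult_bounded_support(1)[OF \<sigma> test_fun_measurable[OF d\<theta>] b2]
    L2_unif_mult_bounded_support(1)[OF \<sigma> test_fun_measurable[OF \<theta>] b1]
    L1_unif_mult_bounded_support(1)[OF \<tau> test_fun_measurable[OF \<theta>] b1]
  note m = continuous_imp_lebesgue_measurable[OF continuous_phi_n[of n]]
    continuous_imp_lebesgue_measurable[OF continuous_dphi_n[of n]]
  note L' = L2_unif_mult_bounded_support(1)[OF \<sigma> m(2) norm_dphi_n_le_indicator]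
    L2_unif_mult_bounded_support(1)[OF \<sigma> m(1) norm_phi_n_le_indicator]
    L1_unif_mult_bounded_support(1)[OF \<tau> m(1) norm_phi_n_le_indicator]
  have P: "W12_pairing (dist_mult f \<theta>) u =
      first_order_form (\<lambda>t. \<sigma> t * vderiv \<theta> t) (\<lambda>t. \<sigma> t * \<theta> t) (\<lambda>t. \<tau> t * \<theta> t) u" if u: "W12 u" for u
  proof (rule W12_functional_unique[OF W12_pairing(1)[OF Wm12_loc_mult[OF f \<theta>]] first_order_form_functional(1)[OF L] _ u])
    fix \<xi> assume \<xi>: "test_fun \<xi>"
    have "W12_pairing (dist_mult f \<theta>) \<xi> = f (\<lambda>t. \<theta> t * \<xi> t)"
      using W12_pairing(2)[OF Wm12_loc_mult[OF f \<theta>] \<xi>] by (simp add: dist_mult_def)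
    also have "\<dots> = - (LINT t|lebesgue. \<sigma> t * vderiv (\<lambda>t. \<theta> t * \<xi> t) t) + (LINT t|lebesgue. \<tau> t * (\<theta> t * \<xi> t))"
      using eq test_fun_mult[OF \<theta> \<xi>]
      by (simp add: dist_eq_def dist_add_def dist_deriv_def dist_of_fun_def)
    also have "(LINT t|lebesgue. \<sigma> t * vderiv (\<lambda>t. \<theta> t * \<xi> t) t) =
        (LINT t|lebesgue. \<sigma> t * vderiv \<theta> t * \<xi> t + \<sigma> t * \<theta> t * vderiv \<xi> t)"
      by (simp add: vderiv_mult[OF \<theta> \<xi>] algebra_simps)
    also have "\<dots> = (LINT t|lebesgue. \<sigma> t * vderiv \<theta> t * \<xi> t) + (LINT t|lebesgue. \<sigma> t * \<theta> t * vderiv \<xi> t)"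
      by (intro Bochner_Integration.integral_add L2_mult_integrable L L2_test_fun test_fun_vderiv \<xi>)
    finally show "W12_pairing (dist_mult f \<theta>) \<xi> =
      first_order_form (\<lambda>t. \<sigma> t * vderiv \<theta> t) (\<lambda>t. \<sigma> t * \<theta> t) (\<lambda>t. \<tau> t * \<theta> t) \<xi>"
      unfolding first_order_form_eq[OF L weak_deriv_test_fun(1)[OF \<xi>] L2_test_fun[OF \<xi>]]
      by (simp add: mult.assoc)
  qed
  note w = phi_n_mult_test_fun[OF \<psi>, of n]
  have "L2 (\<lambda>t. phi_n n t * \<psi> t)" using w(2) by (simp add: W12_def)
  note eq1 = first_order_form_eq[OF L w(1) this]
  \<comment> \<open>The plateau is 1 around the support of \<open>phi_n n\<close>, so it disappears
    from the result.\<close>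
  have pt: "\<theta> t * phi_n n t = phi_n n t" "\<theta> t * dphi_n n t = dphi_n n t" "vderiv \<theta> t * phi_n n t = 0" for t
    unfolding \<theta>_def by (intro plateau_times_phi_n; simp add: S_def)+
  have "\<tau> t * \<theta> t * (phi_n n t * \<psi> t) = \<tau> t * (\<theta> t * phi_n n t) * \<psi> t"
    "\<sigma> t * vderiv \<theta> t * (phi_n n t * \<psi> t) = \<sigma> t * (vderiv \<theta> t * phi_n n t) * \<psi> t"
    "\<sigma> t * \<theta> t * (phi_n n t * vderiv \<psi> t + dphi_n n t * \<psi> t) =
      \<sigma> t * (\<theta> t * phi_n n t) * vderiv \<psi> t + \<sigma> t * (\<theta> t * dphi_n n t) * \<psi> t" for t
    by (simp_all add: algebra_simps)
  note eq2 = eq1[unfolded this[unfolded pt mult_zero_left mult_zero_right]]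
  have "mult_phi f n \<psi> = W12_pairing (dist_mult f \<theta>) (\<lambda>t. phi_n n t * \<psi> t)"
    unfolding \<theta>_def by (rule S0) (simp add: S_def)
  also have "\<dots> = (LINT t|lebesgue. \<tau> t * phi_n n t * \<psi> t) -
      (LINT t|lebesgue. \<sigma> t * phi_n n t * vderiv \<psi> t + \<sigma> t * dphi_n n t * \<psi> t)"
    unfolding P[OF w(2)] eq2 by simp
  also have "(LINT t|lebesgue. \<sigma> t * phi_n n t * vderiv \<psi> t + \<sigma> t * dphi_n n t * \<psi> t) =
      (LINT t|lebesgue. \<sigma> t * phi_n n t * vderiv \<psi> t) + (LINT t|lebesgue. \<sigma> t * dphi_n n t * \<psi> t)"
    by (intro Bochner_Integration.integral_add L2_mult_integrable L' L2_test_fun test_fun_vderiv \<psi>)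
  finally show ?thesis
    unfolding first_order_form_eq[OF L' weak_deriv_test_fun(1)[OF \<psi>] L2_test_fun[OF \<psi>]]
    by (simp add: add.commute)
qed

lemma norm_Wm12_unif_le:
  assumes f: "Wm12_unif f" and \<sigma>: "L2_unif \<sigma>" and \<tau>: "L1_unif \<tau>"
    and eq: "dist_eq f (dist_add (dist_deriv (dist_of_fun \<sigma>)) (dist_of_fun \<tau>))"
  shows "norm_Wm12_unif f \<le> 6 * (norm_L2_unif \<sigma> + norm_L1_unif \<tau>)"
  unfolding norm_Wm12_unif_def
proof (rule cSUP_least)
  fix n
  have loc: "Wm12_loc f" and W: "Wm12 (mult_phi f n)" using f by (auto simp: Wm12_unif_def)
  note m = continuous_imp_lebesgue_measurable[OF continuous_phi_n[of n]]
    continuous_imp_lebesgue_measurable[OF continuous_dphi_n[of n]]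
  note A = L2_unif_mult_bounded_support[OF \<sigma> m(2) norm_dphi_n_le_indicator]
    and B = L2_unif_mult_bounded_support[OF \<sigma> m(1) norm_phi_n_le_indicator]
    and C = L1_unif_mult_bounded_support[OF \<tau> m(1) norm_phi_n_le_indicator]
  note form = first_order_form_functional[OF A(1) B(1) C(1)]
  show "norm_Wm12 (mult_phi f n) \<le> 6 * (norm_L2_unif \<sigma> + norm_L1_unif \<tau>)"
  proof (rule norm_Wm12_least)
    fix u assume u: "W12 u"
    have "W12_pairing (mult_phi f n) u =
        first_order_form (\<lambda>t. \<sigma> t * dphi_n n t) (\<lambda>t. \<sigma> t * phi_n n t) (\<lambda>t. \<tau> t * phi_n n t) u"
      using W12_functional_unique[OF W12_pairing(1)[OF W] form(1) _ u]
        mult_phi_first_order[OF loc \<sigma> \<tau> eq] W12_pairing(2)[OF W] by simp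
    then have "norm (W12_pairing (mult_phi f n) u) \<le>
      (norm_L2 (\<lambda>t. \<sigma> t * dphi_n n t) + norm_L2 (\<lambda>t. \<sigma> t * phi_n n t) +
        3 * (LINT t|lebesgue. norm (\<tau> t * phi_n n t))) * norm_W12 u"
      using form(2)[OF u] by simp
    \<comment> \<open>The bounds 2 for \<open>dphi_n\<close> and 1 for \<open>phi_n\<close> are
      doubled by the window length; the factor 3 is that of \<open>W12_sup_bound\<close>. Both norms
      end up with the factor 6.\<close>
    also have "\<dots> \<le> (2 * 2 * norm_L2_unif \<sigma> + 2 * 1 * norm_L2_unif \<sigma> + 3 * (2 * 1 * norm_L1_unif \<tau>)) * norm_W12 u"
      by (intro mult_right_mono add_mono mult_left_mono A(2)[where c = "of_int n"] B(2)[where c = "of_int n"]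
          C(2)[where c = "of_int n"]) auto
    finally show "norm (W12_pairing (mult_phi f n) u) \<le> 6 * (norm_L2_unif \<sigma> + norm_L1_unif \<tau>) * norm_W12 u"
      by simp
  qed
qed simp

text \<open>Integrate the derivative of \<open>(c + 1 - t) * \<psi> t\<close> over
  \<open>[c, c + 1]\<close>. This writes evaluation at \<open>c\<close> as a bounded density plus
  the derivative of a square integrable ramp.\<close>

lemma test_fun_value_eq_integrals:
  assumes \<psi>: "test_fun \<psi>"
  shows "\<psi> c = (LINT t|lebesgue. indicator {c..<c + 1} t * \<psi> t) -
    (LINT t|lebesgue. (of_real (c + 1 - t) * indicator {c..c + 1} t) * vderiv \<psi> t)"
proof -
  have d: "((\<lambda>t. of_real (c + 1 - t) * \<psi> t) has_vector_derivative
      of_real (c + 1 - t) * vderiv \<psi> t + (-1) * \<psi> t) (at t)" for t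
  proof (rule has_vector_derivative_mult[OF _ test_fun_has_derivative[OF \<psi>]])
    have "((\<lambda>t. c + 1 - t) has_real_derivative (-1)) (at t)" by (auto intro!: derivative_eq_intros)
    from has_vector_derivative_of_real[OF this]
    show "((\<lambda>t. complex_of_real (c + 1 - t)) has_vector_derivative -1) (at t)" by simp
  qed
  have cont: "continuous_on A (\<lambda>t. of_real (c + 1 - t) * vderiv \<psi> t + (-1) * \<psi> t)" for A
    by (intro continuous_intros continuous_on_subset[OF test_fun_continuous[OF \<psi>]]
        continuous_on_subset[OF test_fun_continuous[OF test_fun_vderiv[OF \<psi>]]]) auto
  have "(LINT t|lebesgue. indicator {c..c + 1} t *\<^sub>R (of_real (c + 1 - t) * vderiv \<psi> t + (-1) * \<psi> t)) =
      (LINT t|lborel. indicator {c..c + 1} t *\<^sub>R (of_real (c + 1 - t) * vderiv \<psi> t + (-1) * \<psi> t))"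
    by (intro integral_completion borel_measurable_scaleR borel_measurable_indicator)
       (auto intro!: borel_measurable_continuous_onI cont[simplified])
  also have "\<dots> = of_real (c + 1 - (c + 1)) * \<psi> (c + 1) - of_real (c + 1 - c) * \<psi> c"
    by (rule integral_FTC_atLeastAtMost) (auto intro: has_vector_derivative_at_within d[simplified] cont[simplified])
  also have "\<dots> = - \<psi> c" by simp
  also have "(LINT t|lebesgue. indicator {c..c + 1} t *\<^sub>R (of_real (c + 1 - t) * vderiv \<psi> t + (-1) * \<psi> t)) =
      (LINT t|lebesgue. (of_real (c + 1 - t) * indicator {c..c + 1} t) * vderiv \<psi> t - indicator {c..c + 1} t * \<psi> t)"
    by (rule arg_cong[where f = "integral\<^sup>L lebesgue"]) (auto simp: fun_eq_iff indicator_def)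
  also have "\<dots> = (LINT t|lebesgue. (of_real (c + 1 - t) * indicator {c..c + 1} t) * vderiv \<psi> t) -
      (LINT t|lebesgue. indicator {c..c + 1} t * \<psi> t)"
  proof (rule Bochner_Integration.integral_diff)
    show "integrable lebesgue (\<lambda>t. indicator {c..c + 1} t * \<psi> t)"
      by (intro L2_mult_integrable L2_indicator_interval L2_test_fun \<psi>)
    have "L2 (\<lambda>t. of_real (c + 1 - t) * vderiv \<psi> t)"
    proof -
      obtain R where "\<And>t. R < \<bar>t\<bar> \<Longrightarrow> vderiv \<psi> t = 0" using test_fun_bounded_support[OF test_fun_vderiv[OF \<psi>]] by blast
      then show ?thesis
        by (intro L2_continuous_support[where R = R] continuous_intros test_fun_continuous test_fun_vderiv \<psi>) auto
    qed
    from L2_mult_integrable[OF L2_indicator_interval this, of c "c + 1"]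
    show "integrable lebesgue (\<lambda>t. (of_real (c + 1 - t) * indicator {c..c + 1} t) * vderiv \<psi> t)"
      by (simp add: mult.left_commute mult.assoc)
  qed
  \<comment> \<open>The right end point is dropped so that the translates by integers partition the
    line.\<close>
  also have "(LINT t|lebesgue. indicator {c..c + 1} t * \<psi> t) = (LINT t|lebesgue. indicator {c..<c + 1} t * \<psi> t)"
  proof (intro integral_cong_AE borel_measurable_times borel_measurable_indicator test_fun_measurable \<psi>)
    have "AE t in lebesgue. t \<noteq> c + 1" by (intro AE_completion AE_lborel_singleton)
    then show "AE t in lebesgue. indicator {c..c + 1} t * \<psi> t = indicator {c..<c + 1} t * \<psi> t"
      by (rule AE_mp) (auto simp: indicator_def)
  qed auto
  finally show ?thesis by (simp add: algebra_simps)
qed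

text \<open>A single bound \<open>X\<close> serves all \<open>n\<close>, as gluing requires. The
  radius 2 is that of the cutoff: a plateau on \<open>[n - 1, n + 1]\<close> and ramps of width
  1.\<close>

definition local_rep ::
  "((real \<Rightarrow> complex) \<Rightarrow> complex) \<Rightarrow> int \<Rightarrow> real \<Rightarrow> (real \<Rightarrow> complex) \<Rightarrow> complex \<Rightarrow> bool" where
  "local_rep f n X s a \<longleftrightarrow>
     L2 s \<and> (\<forall>t. 2 < \<bar>t - of_int n\<bar> \<longrightarrow> s t = 0) \<and> norm_L2 s \<le> X \<and> norm a \<le> X \<and>
     (\<forall>\<psi>. test_fun \<psi> \<longrightarrow> mult_phi f n \<psi> =
       (LINT t|lebesgue. (a * indicator {of_int n..<of_int n + 1} t) * \<psi> t) - (LINT t|lebesgue. s t * vderiv \<psi> t))"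

text \<open>The factor \<open>7 + 6 * K\<close> is the Riesz bound \<open>5 + 4 * K\<close> for
  \<open>r = 2\<close> plus the bound \<open>2 + 2 * K\<close> for the value \<open>a\<close> of the
  functional at the cutoff, which also multiplies the ramp \<open>k\<close> contained in
  \<open>s\<close>.\<close>

lemma local_rep_exists:
  assumes W: "Wm12 (mult_phi f n)" and K: "0 \<le> K" "\<And>a b t. norm (vderiv (plateau a b) t) \<le> K"
    and X: "(7 + 6 * K) * norm_Wm12 (mult_phi f n) \<le> X"
  obtains s a where "local_rep f n X s a"
proof -
  define c where "c = real_of_int n"
  define \<eta> where "\<eta> = plateau (c - 1) (c + 1)"
  define M where "M = norm_Wm12 (mult_phi f n)"
  define F where "F = W12_pairing (mult_phi f n)"
  note F = W12_pairing[OF W, folded F_def]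
  have M: "0 \<le> M" "\<And>u. W12 u \<Longrightarrow> norm (F u) \<le> M * norm_W12 u"
    using norm_Wm12_nonneg[OF W] norm_Wm12_upper[OF W] by (auto simp: M_def F_def)
  have \<eta>: "test_fun \<eta>" "\<forall>t. 2 < \<bar>t - c\<bar> \<longrightarrow> \<eta> t = 0" "\<And>t. norm (\<eta> t) \<le> 1" "\<And>t. norm (vderiv \<eta> t) \<le> K"
    by (auto simp: \<eta>_def test_fun_plateau norm_plateau_le K intro!: plateau_eq_0)
  note cp = cutoff_prim[OF \<eta> _ _ K(1), simplified]
  define G where "G h = F (\<lambda>t. \<eta> t * prim c h t)" for h
  obtain g where "L2 g" "norm_L2 g \<le> M * (2 * 2 + 2 * 2 * K + 1)"
    "\<And>h. L2 h \<Longrightarrow> F (\<lambda>t. \<eta> t * prim c h t) = (LINT t|lebesgue. g t * h t)"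
    by (rule cutoff_prim_Riesz[OF F(1) M \<eta> zero_less_numeral K(1)], assumption) (rule that)
  note g = this[folded G_def]
  \<comment> \<open>On \<open>[c - 2, c + 2]\<close> a primitive from \<open>c\<close> depends only
    on the values there, so \<open>g\<close> may be truncated by \<open>I\<close>; this gives
    \<open>s\<close> bounded support.\<close>
  define I where "I = (indicator {c - 2..c + 2} :: real \<Rightarrow> complex)"
  define k where "k t = of_real (c + 1 - t) * (indicator {c..c + 1} t :: complex)" for t
  define a where "a = F \<eta>"
  define s where "s t = a * k t - I t * g t" for t
  have Ig: "L2 (\<lambda>t. I t * g t)" unfolding I_def by (intro L2_indicator g) auto
  have nIg: "norm_L2 (\<lambda>t. I t * g t) \<le> 1 * norm_L2 g"
    unfolding I_def by (intro L2_bounded_mult(2) g borel_measurable_indicator) (auto simp: indicator_def)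
  have km: "k \<in> borel_measurable lebesgue"
    unfolding k_def[abs_def]
    by (intro borel_measurable_times borel_measurable_indicator continuous_imp_lebesgue_measurable continuous_intros) auto
  have k1: "norm (k t) \<le> 1 * indicator {c..c + 1} t" for t
  proof (cases "t \<in> {c..c + 1}")
    case True
    then have "norm (k t) = \<bar>c + 1 - t\<bar>"
      unfolding k_def by (simp only: indicator_simps mult_1_right norm_of_real)
    with True show ?thesis by auto
  qed (simp add: k_def)
  have k: "L2 k" "norm_L2 k \<le> 1" using norm_L2_bounded_support[OF km k1] by auto
  have s: "L2 s" unfolding s_def by (intro L2_diff L2_cmult k Ig)
  have \<eta>_le: "norm (\<eta> t) \<le> 1 * indicator {c - 2..c + 2} t" for t
    using \<eta>(2,3) by (cases "2 < \<bar>t - c\<bar>") (auto simp: indicator_def)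
  have d\<eta>_le: "norm (vderiv \<eta> t) \<le> K * indicator {c - 2..c + 2} t" for t
    using \<eta>(4)[of t] vderiv_eq_0_outside[OF test_fun_has_derivative[OF \<eta>(1)], of 2 c t] \<eta>(2)
    by (cases "2 < \<bar>t - c\<bar>") (auto simp: indicator_def)
  have "norm_L2 \<eta> \<le> 1 * sqrt (c + 2 - (c - 2))"
    by (rule norm_L2_bounded_support(2)[OF test_fun_measurable[OF \<eta>(1)] \<eta>_le]) auto
  moreover have "norm_L2 (vderiv \<eta>) \<le> K * sqrt (c + 2 - (c - 2))"
    by (rule norm_L2_bounded_support(2)[OF test_fun_measurable[OF test_fun_vderiv[OF \<eta>(1)]] d\<eta>_le]) (use K in auto)
  \<comment> \<open>The cutoff lives on an interval of length 4, hence the bound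
    \<open>2 + 2 * K\<close> for its norm.\<close>
  moreover have "sqrt (c + 2 - (c - 2)) = 2" by simp
  ultimately have "norm_W12 \<eta> \<le> 2 + 2 * K"
    using norm_W12_le[OF weak_deriv_test_fun(1)[OF \<eta>(1)]] by simp
  with M(2)[OF weak_deriv_test_fun(2)[OF \<eta>(1)]] M(1) have a: "norm a \<le> (2 + 2 * K) * M"
  proof -
    assume "norm_W12 \<eta> \<le> 2 + 2 * K" "norm (F \<eta>) \<le> M * norm_W12 \<eta>" "0 \<le> M"
    then have "norm (F \<eta>) \<le> M * (2 + 2 * K)" using mult_left_mono order_trans by blast
    then show ?thesis by (simp add: a_def mult.commute)
  qed
  have s_norm: "norm_L2 s \<le> (7 + 6 * K) * M"
  proof -
    have "norm_L2 s \<le> norm_L2 (\<lambda>t. a * k t) + norm_L2 (\<lambda>t. (-1) * (I t * g t))"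
      using norm_L2_triangle[OF L2_cmult[OF k(1), of a] L2_cmult[OF Ig, of "-1"]] by (simp add: s_def[abs_def])
    also have "\<dots> \<le> norm a * 1 + norm_L2 g"
      unfolding norm_L2_cmult using nIg mult_left_mono[OF k(2) norm_ge_zero[of a]] by simp
    finally show ?thesis using a g(2) by (simp add: algebra_simps)
  qed
  have rep: "mult_phi f n \<psi> = (LINT t|lebesgue. (a * indicator {c..<c + 1} t) * \<psi> t) - (LINT t|lebesgue. s t * vderiv \<psi> t)"
    if \<psi>: "test_fun \<psi>" for \<psi>
  proof -
    note d = L2_test_fun[OF test_fun_vderiv[OF \<psi>]]
    have pe: "prim c (\<lambda>t. I t * vderiv \<psi> t) t = prim c (vderiv \<psi>) t" if "\<bar>t - c\<bar> \<le> 2" for t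
    proof -
      have "kern c t x * (I x * vderiv \<psi> x) = kern c t x * vderiv \<psi> x" for x
        using that by (auto simp: kern_def I_def indicator_def)
      then show ?thesis by (simp only: prim_def)
    qed
    \<comment> \<open>The cutoff is 1 on the support of \<open>phi_n n\<close>, so
      \<open>mult_phi f n\<close> does not distinguish \<open>\<psi>\<close> from
      \<open>\<eta> * \<psi>\<close>.\<close>
    have \<eta>1: "phi_n n t * (\<eta> t * \<psi> t) = phi_n n t * \<psi> t" for t
      using phi_n_outside[of t n] by (cases "1 \<le> \<bar>t - c\<bar>") (auto simp: \<eta>_def c_def plateau_eq_1)
    have "mult_phi f n \<psi> = mult_phi f n (\<lambda>t. \<eta> t * \<psi> t)" by (simp add: mult_phi_def \<eta>1)
    also have "\<dots> = F (\<lambda>t. \<eta> t * \<psi> t)" by (rule F(2)[symmetric]) (intro test_fun_mult \<eta> \<psi>)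
    also have "(\<lambda>t. \<eta> t * \<psi> t) = (\<lambda>t. \<eta> t * prim c (\<lambda>t. I t * vderiv \<psi> t) t + \<psi> c * \<eta> t)"
    proof
      fix t show "\<eta> t * \<psi> t = \<eta> t * prim c (\<lambda>t. I t * vderiv \<psi> t) t + \<psi> c * \<eta> t"
      proof (cases "2 < \<bar>t - c\<bar>")
        case False
        then have "\<psi> t = prim c (\<lambda>t. I t * vderiv \<psi> t) t + \<psi> c"
          using pe[of t] prim_vderiv[OF \<psi>, of c t] by simp
        then have "\<eta> t * \<psi> t = \<eta> t * (prim c (\<lambda>t. I t * vderiv \<psi> t) t + \<psi> c)" by (rule arg_cong)
        then show ?thesis by (simp only: distrib_left mult.commute)
      qed (use \<eta>(2) in simp)
    qed
    also have "F \<dots> = G (\<lambda>t. I t * vderiv \<psi> t) + \<psi> c * a"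
    proof -
      have Id: "L2 (\<lambda>t. I t * vderiv \<psi> t)" unfolding I_def by (intro L2_indicator d) auto
      note W\<eta> = weak_deriv_test_fun(2)[OF \<eta>(1)]
      show ?thesis
        using W12_functional_add[OF F(1) cp(1)[OF Id] W12_cmult[OF W\<eta>]] W12_functional_cmult[OF F(1) W\<eta>]
        by (simp add: G_def a_def)
    qed
    also have "G (\<lambda>t. I t * vderiv \<psi> t) = (LINT t|lebesgue. (I t * g t) * vderiv \<psi> t)"
      using g(3)[of "\<lambda>t. I t * vderiv \<psi> t"] L2_indicator[OF d, of "{c - 2..c + 2}"]
      by (simp add: I_def mult.left_commute mult.assoc)
    also have "\<psi> c = (LINT t|lebesgue. indicator {c..<c + 1} t * \<psi> t) - (LINT t|lebesgue. k t * vderiv \<psi> t)"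
      unfolding k_def by (rule test_fun_value_eq_integrals[OF \<psi>])
    also have "(LINT t|lebesgue. (I t * g t) * vderiv \<psi> t) +
        ((LINT t|lebesgue. indicator {c..<c + 1} t * \<psi> t) - (LINT t|lebesgue. k t * vderiv \<psi> t)) * a =
        a * (LINT t|lebesgue. indicator {c..<c + 1} t * \<psi> t) -
        (a * (LINT t|lebesgue. k t * vderiv \<psi> t) - (LINT t|lebesgue. (I t * g t) * vderiv \<psi> t))"
      by (simp add: algebra_simps)
    also have "a * (LINT t|lebesgue. indicator {c..<c + 1} t * \<psi> t) = (LINT t|lebesgue. (a * indicator {c..<c + 1} t) * \<psi> t)"
      by (simp add: mult.assoc)
    also have "a * (LINT t|lebesgue. k t * vderiv \<psi> t) - (LINT t|lebesgue. (I t * g t) * vderiv \<psi> t) =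
        (LINT t|lebesgue. s t * vderiv \<psi> t)"
      using L2_mult_integrable[OF k(1) d] L2_mult_integrable[OF Ig d]
      by (simp add: s_def left_diff_distrib mult.assoc)
    finally show ?thesis .
  qed
  have s0: "s t = 0" if "2 < \<bar>t - of_int n\<bar>" for t
    using that by (auto simp: s_def k_def I_def indicator_def c_def)
  have "(2 + 2 * K) * M \<le> (7 + 6 * K) * M" using K M by (intro mult_right_mono) auto
  with a s_norm X[folded M_def] have "norm_L2 s \<le> X" "norm a \<le> X" by linarith+
  with s s0 rep have "local_rep f n X s a" unfolding local_rep_def c_def by simp
  then show ?thesis by (rule that)
qed

lemma L2_unifI:
  assumes m: "\<sigma> \<in> borel_measurable lebesgue" and "0 \<le> X"
    and L: "\<And>t. L2 (\<lambda>s. indicator {t..t + 1} s * \<sigma> s)" "\<And>t. norm_L2 (\<lambda>s. indicator {t..t + 1} s * \<sigma> s) \<le> X"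
  shows "L2_unif \<sigma>" "norm_L2_unif \<sigma> \<le> X"
proof -
  have eq: "(\<lambda>s. (norm (indicator {t..t + 1} s * \<sigma> s))\<^sup>2) = (\<lambda>s. indicator {t..t + 1} s *\<^sub>R (norm (\<sigma> s))\<^sup>2)" for t
    by (auto simp: indicator_def)
  have int: "set_integrable lebesgue {t..t + 1} (\<lambda>s. (norm (\<sigma> s))\<^sup>2)" for t
    using L2_integrable[OF L(1)[of t]] by (simp add: set_integrable_def eq)
  have le: "(LINT s:{t..t + 1}|lebesgue. (norm (\<sigma> s))\<^sup>2) \<le> X\<^sup>2" for t
  proof -
    have "(LINT s:{t..t + 1}|lebesgue. (norm (\<sigma> s))\<^sup>2) = (norm_L2 (\<lambda>s. indicator {t..t + 1} s * \<sigma> s))\<^sup>2"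
      by (simp add: norm_L2_power2 eq set_lebesgue_integral_def)
    then show ?thesis using L(2)[of t] by (simp add: power_mono)
  qed
  show "L2_unif \<sigma>" unfolding L2_unif_def using m int le by (auto intro!: bdd_aboveI)
  have "(SUP t. LINT s:{t..t + 1}|lebesgue. (norm (\<sigma> s))\<^sup>2) \<le> X\<^sup>2" by (rule cSUP_least) (use le in auto)
  then show "norm_L2_unif \<sigma> \<le> X" unfolding norm_L2_unif_def by (rule real_le_lsqrt[OF \<open>0 \<le> X\<close>])
qed

lemma L1_unifI:
  assumes m: "\<tau> \<in> borel_measurable lebesgue" and X: "\<And>t. norm (\<tau> t) \<le> X"
  shows "L1_unif \<tau>" "norm_L1_unif \<tau> \<le> X"
proof -
  have i: "integrable lebesgue (\<lambda>s. indicator {t..t + 1} s *\<^sub>R X)" for t :: real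
    by (intro integrable_scaleR_left integrable_real_indicator) (auto simp: emeasure_lborel_Icc_eq)
  have le: "indicator {t..t + 1} s *\<^sub>R norm (\<tau> s) \<le> indicator {t..t + 1} s *\<^sub>R X" for s t
    using X by (auto simp: indicator_def)
  have int: "set_integrable lebesgue {t..t + 1} (\<lambda>s. norm (\<tau> s))" for t
    unfolding set_integrable_def
  proof (rule Bochner_Integration.integrable_bound[OF i[of t]])
    show "(\<lambda>s. indicator {t..t + 1} s *\<^sub>R norm (\<tau> s)) \<in> borel_measurable lebesgue"
      by (intro borel_measurable_scaleR borel_measurable_indicator measurable_compose[OF m borel_measurable_norm]) auto
    have "norm (indicator {t..t + 1} s *\<^sub>R norm (\<tau> s)) \<le> norm (indicator {t..t + 1} s *\<^sub>R X)" for s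
      using order_trans[OF le abs_ge_self, of t s] by (simp add: abs_mult)
    then show "AE s in lebesgue. norm (indicator {t..t + 1} s *\<^sub>R norm (\<tau> s)) \<le> norm (indicator {t..t + 1} s *\<^sub>R X)"
      by simp
  qed
  have b: "(LINT s:{t..t + 1}|lebesgue. norm (\<tau> s)) \<le> X" for t
  proof -
    have "(LINT s:{t..t + 1}|lebesgue. norm (\<tau> s)) \<le> (LINT s|lebesgue. indicator {t..t + 1} s *\<^sub>R X)"
      unfolding set_lebesgue_integral_def
      by (rule integral_mono[OF int[unfolded set_integrable_def] i le])
    also have "\<dots> = X" by (simp add: measure_lborel_Icc)
    finally show ?thesis .
  qed
  show "L1_unif \<tau>" unfolding L1_unif_def using m int b by (auto intro!: bdd_aboveI)
  show "norm_L1_unif \<tau> \<le> X" unfolding norm_L1_unif_def by (rule cSUP_least) (use b in auto)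
qed


section \<open>Gluing the local representations\<close>

text \<open>The defining window moves with \<open>t\<close>; replacing it by any larger fixed finite
  index set is what makes measurability, norms and integrals of the sum accessible.\<close>

lemma int_window_sum:
  fixes s :: "int \<Rightarrow> real \<Rightarrow> complex"
  assumes supp: "\<And>n t. 2 < \<bar>t - of_int n\<bar> \<Longrightarrow> s n t = 0" and A: "finite A" "{\<lfloor>t\<rfloor> - 2..\<lfloor>t\<rfloor> + 3} \<subseteq> A"
  shows "(\<Sum>n\<in>{\<lfloor>t\<rfloor> - 2..\<lfloor>t\<rfloor> + 3}. s n t) = (\<Sum>n\<in>A. s n t)"
proof (intro sum.mono_neutral_left A ballI)
  fix n assume "n \<in> A - {\<lfloor>t\<rfloor> - 2..\<lfloor>t\<rfloor> + 3}"
  then have "n < \<lfloor>t\<rfloor> - 2 \<or> \<lfloor>t\<rfloor> + 3 < n" by auto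
  then have "2 < \<bar>t - of_int n\<bar>" by linarith
  then show "s n t = 0" by (rule supp)
qed

lemma glue_local_representations:
  fixes s :: "int \<Rightarrow> real \<Rightarrow> complex" and a :: "int \<Rightarrow> complex"
  assumes rep: "\<And>n. local_rep f n X (s n) (a n)"
  defines "\<sigma> \<equiv> \<lambda>t. \<Sum>n\<in>{\<lfloor>t\<rfloor> - 2..\<lfloor>t\<rfloor> + 3}. s n t" and "\<tau> \<equiv> \<lambda>t. a \<lfloor>t\<rfloor>"
  shows "L2_unif \<sigma>" "norm_L2_unif \<sigma> \<le> 7 * X" "L1_unif \<tau>" "norm_L1_unif \<tau> \<le> X" "bounded (range \<tau>)"
proof -
  have s: "\<And>n. L2 (s n)" "\<And>n t. 2 < \<bar>t - of_int n\<bar> \<Longrightarrow> s n t = 0" "\<And>n. norm_L2 (s n) \<le> X"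
    and a: "\<And>n. norm (a n) \<le> X" using rep unfolding local_rep_def by simp_all
  have X: "0 \<le> X" using a[of 0] norm_ge_zero order_trans by blast
  have "(\<lambda>t::real. \<lfloor>t\<rfloor>) \<in> lebesgue \<rightarrow>\<^sub>M count_space UNIV"
    by (intro measurable_completion) (simp add: measurable_lborel1 measurable_real_floor)
  then have "\<tau> \<in> borel_measurable lebesgue"
    unfolding \<tau>_def by (rule measurable_compose) simp
  with a show "L1_unif \<tau>" "norm_L1_unif \<tau> \<le> X" unfolding \<tau>_def by (auto intro: L1_unifI)
  show "bounded (range \<tau>)" unfolding bounded_iff \<tau>_def using a by blast
  have window: "\<sigma> t = (\<Sum>n\<in>A. s n t)" if "finite A" "{\<lfloor>t\<rfloor> - 2..\<lfloor>t\<rfloor> + 3} \<subseteq> A" for A t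
    unfolding \<sigma>_def by (rule int_window_sum[OF s(2) that])
  have m: "\<sigma> \<in> borel_measurable lebesgue"
  \<comment> \<open>At each point the symmetric partial sums are eventually constant.\<close>
  proof (rule borel_measurable_LIMSEQ_metric)
    show "(\<lambda>t. \<Sum>n\<in>{- int k..int k}. s n t) \<in> borel_measurable lebesgue" for k
      by (intro L2_measurable L2_sum s)
    fix t
    have "\<forall>\<^sub>F k in sequentially. \<sigma> t = (\<Sum>n\<in>{- int k..int k}. s n t)"
      by (rule eventually_sequentiallyI[of "nat (\<bar>\<lfloor>t\<rfloor>\<bar> + 3)"]) (rule window; auto)
    then show "(\<lambda>k. \<Sum>n\<in>{- int k..int k}. s n t) \<longlonglongrightarrow> \<sigma> t"
      by (rule Lim_transform_eventually[OF tendsto_const])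
  qed
  have loc: "L2 (\<lambda>x. indicator {t..t + 1} x * \<sigma> x)" "norm_L2 (\<lambda>x. indicator {t..t + 1} x * \<sigma> x) \<le> 7 * X" for t
  proof -
    \<comment> \<open>For \<open>x\<close> in \<open>[t, t + 1]\<close> the floor of
      \<open>x\<close> is that of \<open>t\<close> or one more, so the union of the windows has
      seven indices; this is the 7 in the norm bound.\<close>
    define A where "A = {\<lfloor>t\<rfloor> - 2..\<lfloor>t\<rfloor> + 4}"
    have eq: "(\<lambda>x. indicator {t..t + 1} x * \<sigma> x) = (\<lambda>x. indicator {t..t + 1} x * (\<Sum>n\<in>A. s n x))"
    proof
      fix x show "indicator {t..t + 1} x * \<sigma> x = indicator {t..t + 1} x * (\<Sum>n\<in>A. s n x)"
      proof (cases "x \<in> {t..t + 1}")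
        case True
        then have "\<lfloor>t\<rfloor> \<le> \<lfloor>x\<rfloor>" "\<lfloor>x\<rfloor> \<le> \<lfloor>t\<rfloor> + 1" by (auto simp: floor_mono) linarith
        then have "\<sigma> x = (\<Sum>n\<in>A. s n x)" by (intro window) (auto simp: A_def)
        then show ?thesis by simp
      qed simp
    qed
    have sumL: "L2 (\<lambda>x. \<Sum>n\<in>A. s n x)" by (intro L2_sum s)
    have im: "(indicator {t..t + 1} :: real \<Rightarrow> complex) \<in> borel_measurable lebesgue"
      by (rule borel_measurable_indicator) simp
    have i1: "norm (indicator {t..t + 1} x :: complex) \<le> 1" for x by (simp add: indicator_def)
    note b = L2_bounded_mult[OF sumL im i1]
    show "L2 (\<lambda>x. indicator {t..t + 1} x * \<sigma> x)" unfolding eq by (rule b(1))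
    have "norm_L2 (\<lambda>x. \<Sum>n\<in>B. s n x) \<le> of_nat (card B) * X" if "finite B" for B
      using that
    proof (induction B)
      case empty
      show ?case by (simp add: norm_L2_def)
    next
      case (insert n B)
      have "norm_L2 (\<lambda>x. s n x + (\<Sum>n\<in>B. s n x)) \<le> norm_L2 (s n) + norm_L2 (\<lambda>x. \<Sum>n\<in>B. s n x)"
        by (intro norm_L2_triangle s L2_sum)
      with insert s(3)[of n] show ?case by (simp add: distrib_right)
    qed
    from this[of A] have "norm_L2 (\<lambda>x. \<Sum>n\<in>A. s n x) \<le> 7 * X" by (simp add: A_def)
    with b(2) show "norm_L2 (\<lambda>x. indicator {t..t + 1} x * \<sigma> x) \<le> 7 * X" unfolding eq by simp
  qed
  show "L2_unif \<sigma>" "norm_L2_unif \<sigma> \<le> 7 * X"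
    using L2_unifI[OF m _ loc] X by auto
qed

text \<open>Against a fixed test function only finitely many \<open>n\<close> matter, so the
  infinite gluing becomes a finite sum that commutes with the integrals.\<close>

lemma glued_representation:
  fixes s :: "int \<Rightarrow> real \<Rightarrow> complex" and a :: "int \<Rightarrow> complex"
  assumes f: "Wm12_loc f" and rep: "\<And>n. local_rep f n X (s n) (a n)"
  shows "dist_eq f (dist_add (dist_deriv (dist_of_fun (\<lambda>t. \<Sum>n\<in>{\<lfloor>t\<rfloor> - 2..\<lfloor>t\<rfloor> + 3}. s n t)))
    (dist_of_fun (\<lambda>t. a \<lfloor>t\<rfloor>)))"
  unfolding dist_eq_def
proof (intro allI impI)
  fix \<psi> assume \<psi>: "test_fun \<psi>"
  have s: "\<And>n. L2 (s n)" "\<And>n t. 2 < \<bar>t - of_int n\<bar> \<Longrightarrow> s n t = 0"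
    and mult_phi: "\<And>n. mult_phi f n \<psi> =
      (LINT t|lebesgue. (a n * indicator {of_int n..<of_int n + 1} t) * \<psi> t) - (LINT t|lebesgue. s n t * vderiv \<psi> t)"
    using rep \<psi> unfolding local_rep_def by simp_all
  obtain R where R: "R > 0" "\<And>t. R < \<bar>t\<bar> \<Longrightarrow> \<psi> t = 0" using test_fun_bounded_support[OF \<psi>] by blast
  have d0: "vderiv \<psi> t = 0" if "R < \<bar>t\<bar>" for t
    by (rule vderiv_eq_0[OF test_fun_has_derivative[OF \<psi>] R(2) that])
  \<comment> \<open>Large enough for \<open>Wm12_loc_eq_sum_mult_phi\<close> and for the window of
    every \<open>t\<close> in the support of \<open>\<psi>\<close>, which reaches up to
    \<open>\<lfloor>t\<rfloor> + 3\<close>.\<close>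
  define N where "N = \<lceil>R\<rceil> + 4"
  have N: "R + 1 \<le> of_int N" unfolding N_def by linarith
  note d = test_fun_vderiv[OF \<psi>]
  have int_s: "integrable lebesgue (\<lambda>t. s n t * vderiv \<psi> t)" for n
    by (intro L2_mult_integrable s L2_test_fun d)
  have int_a: "integrable lebesgue (\<lambda>t. (a n * indicator {of_int n..<of_int n + 1} t) * \<psi> t)" for n
  proof -
    have "integrable lebesgue (\<lambda>t. \<psi> t * indicator {of_int n..<of_int n + 1} t)"
      by (rule locally_integrable_mult[OF L2_locally_integrable[OF L2_test_fun[OF \<psi>]] borel_measurable_indicator,
            where B = 1 and R = "\<bar>of_int n\<bar> + 1"]) (auto simp: indicator_def)
    then have "integrable lebesgue (\<lambda>t. a n * (\<psi> t * indicator {of_int n..<of_int n + 1} t))" by simp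
    moreover have "(\<lambda>t. a n * (\<psi> t * indicator {of_int n..<of_int n + 1} t)) =
        (\<lambda>t. (a n * indicator {of_int n..<of_int n + 1} t) * \<psi> t)"
      by (intro ext) (simp only: mult_ac)
    ultimately show ?thesis by (simp only:)
  qed
  have sum_s: "(\<Sum>n\<in>{-N..N}. s n t * vderiv \<psi> t) = (\<Sum>n\<in>{\<lfloor>t\<rfloor> - 2..\<lfloor>t\<rfloor> + 3}. s n t) * vderiv \<psi> t" for t
  proof (cases "R < \<bar>t\<bar>")
    case False
    then have "- N \<le> \<lfloor>t\<rfloor> - 2" "\<lfloor>t\<rfloor> + 3 \<le> N" unfolding N_def by linarith+
    then have "(\<Sum>n\<in>{\<lfloor>t\<rfloor> - 2..\<lfloor>t\<rfloor> + 3}. s n t) = (\<Sum>n\<in>{-N..N}. s n t)"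
      by (intro int_window_sum s) auto
    then show ?thesis by (simp add: sum_distrib_right)
  qed (simp add: d0)
  have sum_a: "(\<Sum>n\<in>{-N..N}. (a n * indicator {of_int n..<of_int n + 1} t) * \<psi> t) = a \<lfloor>t\<rfloor> * \<psi> t" for t
  proof (cases "R < \<bar>t\<bar>")
    case False
    then have N: "- N \<le> \<lfloor>t\<rfloor>" "\<lfloor>t\<rfloor> \<le> N" unfolding N_def by linarith+
    have "(\<Sum>n\<in>{-N..N}. (a n * indicator {of_int n..<of_int n + 1} t) * \<psi> t) =
        (\<Sum>n\<in>{-N..N}. if \<lfloor>t\<rfloor> = n then a n * \<psi> t else 0)"
    proof (rule sum.cong[OF refl])
      fix n
      \<comment> \<open>Exactly one half-open unit interval contains \<open>t\<close>, so a single
        coefficient survives.\<close>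
      have "t \<in> {of_int n..<of_int n + 1} \<longleftrightarrow> \<lfloor>t\<rfloor> = n" by (simp add: floor_eq_iff)
      then show "(a n * indicator {of_int n..<of_int n + 1} t) * \<psi> t = (if \<lfloor>t\<rfloor> = n then a n * \<psi> t else 0)"
        by (cases "\<lfloor>t\<rfloor> = n") (simp_all only: indicator_simps if_True if_False mult_1_right mult_zero_left mult_zero_right simp_thms)
    qed
    also have "\<dots> = a \<lfloor>t\<rfloor> * \<psi> t" using N by (simp add: sum.delta)
    finally show ?thesis .
  qed (simp add: R(2))
  have "f \<psi> = (\<Sum>n\<in>{-N..N}. mult_phi f n \<psi>)"
    by (rule Wm12_loc_eq_sum_mult_phi[OF f \<psi> R(2) N])
  also have "\<dots> = (\<Sum>n\<in>{-N..N}. LINT t|lebesgue. (a n * indicator {of_int n..<of_int n + 1} t) * \<psi> t)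
      - (\<Sum>n\<in>{-N..N}. LINT t|lebesgue. s n t * vderiv \<psi> t)"
    unfolding mult_phi by (rule sum_subtractf)
  also have "(\<Sum>n\<in>{-N..N}. LINT t|lebesgue. (a n * indicator {of_int n..<of_int n + 1} t) * \<psi> t) =
      (LINT t|lebesgue. a \<lfloor>t\<rfloor> * \<psi> t)"
    unfolding sum_a[symmetric] by (rule Bochner_Integration.integral_sum[symmetric]) (rule int_a)
  also have "(\<Sum>n\<in>{-N..N}. LINT t|lebesgue. s n t * vderiv \<psi> t) =
      (LINT t|lebesgue. (\<Sum>n\<in>{\<lfloor>t\<rfloor> - 2..\<lfloor>t\<rfloor> + 3}. s n t) * vderiv \<psi> t)"
    unfolding sum_s[symmetric] by (rule Bochner_Integration.integral_sum[symmetric]) (rule int_s)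
  finally show "f \<psi> = dist_add (dist_deriv (dist_of_fun (\<lambda>t. \<Sum>n\<in>{\<lfloor>t\<rfloor> - 2..\<lfloor>t\<rfloor> + 3}. s n t)))
      (dist_of_fun (\<lambda>t. a \<lfloor>t\<rfloor>)) \<psi>"
    by (simp add: dist_add_def dist_deriv_def dist_of_fun_def)
qed

theorem theorem2p1:
  "\<exists>C::real. C > 0 \<and> (\<forall>f. Wm12_unif f \<longrightarrow>
     (\<exists>\<sigma> \<tau>. L2_unif \<sigma> \<and> L1_unif \<tau> \<and>
        dist_eq f (dist_add (dist_deriv (dist_of_fun \<sigma>)) (dist_of_fun \<tau>)) \<and>
        inverse C * (norm_L2_unif \<sigma> + norm_L1_unif \<tau>) \<le> norm_Wm12_unif f \<and>
        norm_Wm12_unif f \<le> C * (norm_L2_unif \<sigma> + norm_L1_unif \<tau>) \<and>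
        bounded (range \<tau>)))"
proof -
  obtain K where K: "K > 0" "\<And>a b t. norm (vderiv (plateau a b) t) \<le> K" using vderiv_plateau_bounded by blast
  \<comment> \<open>Gluing bounds the two norms by \<open>7 * X\<close> and \<open>X\<close>, hence
    the 8; this value also exceeds the 6 of the upper estimate.\<close>
  define C where "C = 8 * (7 + 6 * K)"
  have C: "0 < C" "6 \<le> C" using K by (simp_all add: C_def)
  show ?thesis
  proof (intro exI[of _ C] conjI allI impI C(1))
    fix f assume f: "Wm12_unif f"
    have loc: "Wm12_loc f" and W: "\<And>n. Wm12 (mult_phi f n)" using f by (auto simp: Wm12_unif_def)
    define M where "M = norm_Wm12_unif f"
    have M: "norm_Wm12 (mult_phi f n) \<le> M" for n
      unfolding M_def norm_Wm12_unif_def using f by (intro cSUP_upper) (auto simp: Wm12_unif_def)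
    define X where "X = (7 + 6 * K) * M"
    have "\<exists>s a. local_rep f n X s a" for n
    proof -
      have "(7 + 6 * K) * norm_Wm12 (mult_phi f n) \<le> X"
        unfolding X_def using M K by (intro mult_left_mono) auto
      from local_rep_exists[OF W less_imp_le[OF K(1)] K(2) this] show ?thesis by blast
    qed
    then obtain s a where rep: "\<And>n. local_rep f n X (s n) (a n)" by metis
    define \<sigma> where "\<sigma> = (\<lambda>t. \<Sum>n\<in>{\<lfloor>t\<rfloor> - 2..\<lfloor>t\<rfloor> + 3}. s n t)"
    define \<tau> where "\<tau> = (\<lambda>t :: real. a \<lfloor>t\<rfloor>)"
    note glue = glue_local_representations[OF rep, folded \<sigma>_def \<tau>_def]
    have eq: "dist_eq f (dist_add (dist_deriv (dist_of_fun \<sigma>)) (dist_of_fun \<tau>))"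
      unfolding \<sigma>_def \<tau>_def by (rule glued_representation[OF loc rep])
    have "norm_L2_unif \<sigma> + norm_L1_unif \<tau> \<le> C * M"
    proof -
      have "7 * X + X = C * M" by (simp add: X_def C_def algebra_simps)
      then show ?thesis using glue(2,4) by linarith
    qed
    then have lower: "inverse C * (norm_L2_unif \<sigma> + norm_L1_unif \<tau>) \<le> M"
      using C by (simp add: field_simps)
    have "0 \<le> norm_L2_unif \<sigma> + norm_L1_unif \<tau>"
      using L2_unif_integral_le(2)[OF glue(1)] L1_unif_integral_le(2)[OF glue(3)] by simp
    then have "6 * (norm_L2_unif \<sigma> + norm_L1_unif \<tau>) \<le> C * (norm_L2_unif \<sigma> + norm_L1_unif \<tau>)"
      by (intro mult_right_mono C)
    with norm_Wm12_unif_le[OF f glue(1,3) eq]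
    have upper: "norm_Wm12_unif f \<le> C * (norm_L2_unif \<sigma> + norm_L1_unif \<tau>)" by linarith
    show "\<exists>\<sigma> \<tau>. L2_unif \<sigma> \<and> L1_unif \<tau> \<and>
        dist_eq f (dist_add (dist_deriv (dist_of_fun \<sigma>)) (dist_of_fun \<tau>)) \<and>
        inverse C * (norm_L2_unif \<sigma> + norm_L1_unif \<tau>) \<le> norm_Wm12_unif f \<and>
        norm_Wm12_unif f \<le> C * (norm_L2_unif \<sigma> + norm_L1_unif \<tau>) \<and>
        bounded (range \<tau>)"
      using glue(1,3,5) eq lower upper unfolding M_def by blast
  qed
qed

end
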